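(* Let $(G,H,\mathcal G)$ be a pseudo-Riemannian generalized Lie group. Then there exist a left-invariant pseudo-Riemannian metric $g$ on $G$ and a closed left-invariant three-form $H'$ with $H'\in[H]\in H^3(\mathfrak g)$ (Lie algebra cohomology) such that $(G,H,\mathcal G)$ is isomorphic to $(G,H',\mathcal G_g)$ by an isomorphism $\Phi$ covering the identity map of $G$.
   Context: Let $G$ be a Lie group with Lie algebra $\mathfrak g$, $\mathbb TG=TG\oplus T^*G$ with projection (anchor) $\pi:\mathbb TG\to TG$, and scalar product $\langle X+\xi,Y+\eta\rangle=\frac12(\xi(Y)+\eta(X))$. For a closed left-invariant three-form $H$, the Dorfman bracket on $\Gamma(\mathbb TG)$ is $[X+\xi,Y+\eta]_H=\mathcal L_X(Y+\eta)-\iota_Yd\xi+H(X,Y,\cdot)$. Left-invariant sections of $\mathbb TG$ are identified with elements of $E=\mathfrak g\oplus\mathfrak g^*$ and left-invariant tensors with tensors on $\mathfrak g$ or $E$. A (left-invariant) generalized pseudo-Riemannian metric on $G$ is a symmetric bilinear form $\mathcal G\in\mathrm{Sym}^2E^*$ such that the endomorphism $\mathcal G^{\mathrm{end}}$ of $E$ defined by $\langle\mathcal G^{\mathrm{end}}\cdot,\cdot\rangle=\mathcal G$ is an involution and the restriction of $\mathcal G$ to $\mathfrak g^*$ is non-degenerate. A pseudo-Riemannian generalized Lie group is a triple $(G,H,\mathcal G)$ of a Lie group $G$, a closed left-invariant three-form $H$ on $G$ and such a $\mathcal G$. For a left-invariant pseudo-Riemannian metric $g$, $\mathcal G_g(X+\xi,Y+\eta)=\frac12(g(X,Y)+g^{-1}(\xi,\eta))$.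 An isomorphism $(G,H,\mathcal G)\to(G',H',\mathcal G')$ is an isomorphism of vector bundles $\Phi:\mathbb TG\to\mathbb TG'$ covering an isomorphism of Lie groups $\varphi:G\to G'$ which maps anchor, scalar product and Dorfman bracket $(\pi,\langle\cdot,\cdot\rangle,[\cdot,\cdot]_H)$ to those of $G'$ determined by $H'$, and maps $\mathcal G$ to $\mathcal G'$. *)

theory Defs
  imports "HOL-Analysis.Analysis" "HOL-Algebra.Group" "HOL-Library.Function_Algebras"
begin

text \<open>
  Manifolds here have a whole type as underlying set and are given by a smooth atlas. A chart is a
  pair \<open>(U, \<phi>)\<close> with values in a finite-dimensional inner product space \<open>'v\<close> (class \<open>real_inner\<close>
  rather than \<open>euclidean_space\<close>, since the latter excludes dimension zero). Tangent vectors at \<open>p\<close>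
  are velocities of smooth curves through \<open>p\<close>, regarded as derivations of the germs at \<open>p\<close> of smooth
  functions. Operators on functions and tensors on a subspace are represented by total functions that
  vanish outside their domain, so that equality of such objects is equality in HOL.
\<close>

section \<open>Linear algebra on subspaces\<close>

instantiation "fun" :: (type, real_vector) real_vector
begin

definition scaleR_fun_def: "scaleR c f = (\<lambda>x. c *\<^sub>R f x)"

instance
  by standard (auto simp: scaleR_fun_def fun_eq_iff scaleR_add_right scaleR_add_left)

end

definition dual_space :: "'b::real_vector set \<Rightarrow> ('b \<Rightarrow> real) set" where
  "dual_space V = {\<alpha>. (\<forall>u\<in>V. \<forall>v\<in>V. \<alpha> (u + v) = \<alpha> u + \<alpha> v) \<and>
                       (\<forall>c. \<forall>u\<in>V. \<alpha> (c *\<^sub>R u) = c * \<alpha> u) \<and>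
                       (\<forall>u. u \<notin> V \<longrightarrow> \<alpha> u = 0)}"

definition bilinear_forms :: "'b::real_vector set \<Rightarrow> ('b \<Rightarrow> 'b \<Rightarrow> real) set" where
  "bilinear_forms V = {\<beta>. (\<forall>v. (\<lambda>u. \<beta> u v) \<in> dual_space V) \<and> (\<forall>u. \<beta> u \<in> dual_space V)}"

definition trilinear_forms :: "'b::real_vector set \<Rightarrow> ('b \<Rightarrow> 'b \<Rightarrow> 'b \<Rightarrow> real) set" where
  "trilinear_forms V = {\<omega>. (\<forall>v w. (\<lambda>u. \<omega> u v w) \<in> dual_space V) \<and>
                            (\<forall>u w. (\<lambda>v. \<omega> u v w) \<in> dual_space V) \<and>
                            (\<forall>u v. \<omega> u v \<in> dual_space V)}"

definition symmetric_forms :: "'b::real_vector set \<Rightarrow> ('b \<Rightarrow> 'b \<Rightarrow> real) set" where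
  "symmetric_forms V = {\<beta> \<in> bilinear_forms V. \<forall>u v. \<beta> u v = \<beta> v u}"

definition alternating_forms2 :: "'b::real_vector set \<Rightarrow> ('b \<Rightarrow> 'b \<Rightarrow> real) set" where
  "alternating_forms2 V = {\<beta> \<in> bilinear_forms V. \<forall>u. \<beta> u u = 0}"

definition alternating_forms3 :: "'b::real_vector set \<Rightarrow> ('b \<Rightarrow> 'b \<Rightarrow> 'b \<Rightarrow> real) set" where
  "alternating_forms3 V =
     {\<omega> \<in> trilinear_forms V. \<forall>u v. \<omega> u u v = 0 \<and> \<omega> u v v = 0 \<and> \<omega> u v u = 0}"

definition nondegenerate_on :: "'b::real_vector set \<Rightarrow> ('b \<Rightarrow> 'b \<Rightarrow> real) \<Rightarrow> bool" where
  "nondegenerate_on V \<beta> \<longleftrightarrow> (\<forall>u\<in>V. (\<forall>v\<in>V. \<beta> u v = 0) \<longrightarrow> u = 0)"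

definition sharp :: "'b::real_vector set \<Rightarrow> ('b \<Rightarrow> 'b \<Rightarrow> real) \<Rightarrow> ('b \<Rightarrow> real) \<Rightarrow> 'b" where
  "sharp V h \<xi> = (THE X. X \<in> V \<and> (\<forall>Y\<in>V. h X Y = \<xi> Y))"

definition inverse_metric ::
  "'b::real_vector set \<Rightarrow> ('b \<Rightarrow> 'b \<Rightarrow> real) \<Rightarrow> ('b \<Rightarrow> real) \<Rightarrow> ('b \<Rightarrow> real) \<Rightarrow> real" where
  "inverse_metric V h \<xi> \<eta> = h (sharp V h \<xi>) (sharp V h \<eta>)"


section \<open>Lie algebra cohomology in degree three\<close>

text \<open>The Lie algebra is given by its underlying subspace \<open>V\<close> and its bracket \<open>br\<close>.\<close>

definition ce_d2 :: "('b \<Rightarrow> 'b \<Rightarrow> 'b) \<Rightarrow> ('b \<Rightarrow> 'b \<Rightarrow> real) \<Rightarrow> 'b \<Rightarrow> 'b \<Rightarrow> 'b \<Rightarrow> real" where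
  "ce_d2 br \<beta> u v w = - \<beta> (br u v) w + \<beta> (br u w) v - \<beta> (br v w) u"

definition ce_d3 ::
  "('b \<Rightarrow> 'b \<Rightarrow> 'b) \<Rightarrow> ('b \<Rightarrow> 'b \<Rightarrow> 'b \<Rightarrow> real) \<Rightarrow> 'b \<Rightarrow> 'b \<Rightarrow> 'b \<Rightarrow> 'b \<Rightarrow> real" where
  "ce_d3 br \<omega> u v w z =
     - \<omega> (br u v) w z + \<omega> (br u w) v z - \<omega> (br u z) v w
     - \<omega> (br v w) u z + \<omega> (br v z) u w - \<omega> (br w z) u v"

definition ce_cocycles3 ::
  "'b::real_vector set \<Rightarrow> ('b \<Rightarrow> 'b \<Rightarrow> 'b) \<Rightarrow> ('b \<Rightarrow> 'b \<Rightarrow> 'b \<Rightarrow> real) set" where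
  "ce_cocycles3 V br =
     {\<omega> \<in> alternating_forms3 V. \<forall>u\<in>V. \<forall>v\<in>V. \<forall>w\<in>V. \<forall>z\<in>V. ce_d3 br \<omega> u v w z = 0}"

definition cohomology_class3 ::
  "'b::real_vector set \<Rightarrow> ('b \<Rightarrow> 'b \<Rightarrow> 'b) \<Rightarrow> ('b \<Rightarrow> 'b \<Rightarrow> 'b \<Rightarrow> real)
     \<Rightarrow> ('b \<Rightarrow> 'b \<Rightarrow> 'b \<Rightarrow> real) set" where
  "cohomology_class3 V br \<omega> =
     {\<omega>' \<in> ce_cocycles3 V br. \<exists>\<beta>\<in>alternating_forms2 V.
        \<forall>u\<in>V. \<forall>v\<in>V. \<forall>w\<in>V. \<omega>' u v w = \<omega> u v w + ce_d2 br \<beta> u v w}"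


section \<open>Smooth maps\<close>

primrec C_k_on ::
  "nat \<Rightarrow> 'v::real_normed_vector set \<Rightarrow> ('v \<Rightarrow> 'w::real_normed_vector) \<Rightarrow> bool" where
  "C_k_on 0 S f \<longleftrightarrow> continuous_on S f"
| "C_k_on (Suc k) S f \<longleftrightarrow> (\<forall>x\<in>S. f differentiable (at x)) \<and>
     (\<forall>v. C_k_on k S (\<lambda>x. frechet_derivative f (at x) v))"

text \<open>Only used for open subsets of finite-dimensional spaces.\<close>

definition smooth_on :: "'v::real_normed_vector set \<Rightarrow> ('v \<Rightarrow> 'w::real_normed_vector) \<Rightarrow> bool" where
  "smooth_on S f \<longleftrightarrow> (\<forall>k. C_k_on k S f)"

type_synonym ('a, 'v) atlas = "('a set \<times> ('a \<Rightarrow> 'v)) set"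

definition model_atlas :: "('v, 'v) atlas" where
  "model_atlas = {(UNIV, id)}"

definition prod_atlas :: "('a, 'v) atlas \<Rightarrow> ('b, 'w) atlas \<Rightarrow> ('a \<times> 'b, 'v \<times> 'w) atlas" where
  "prod_atlas A B = {(U \<times> V, map_prod \<phi> \<psi>) | U \<phi> V \<psi>. (U, \<phi>) \<in> A \<and> (V, \<psi>) \<in> B}"

definition smooth_map_on ::
  "('a::topological_space, 'v::real_normed_vector) atlas
     \<Rightarrow> ('b::topological_space, 'w::real_normed_vector) atlas \<Rightarrow> 'a set \<Rightarrow> ('a \<Rightarrow> 'b) \<Rightarrow> bool" where
  "smooth_map_on A B S F \<longleftrightarrow> continuous_on S F \<and>
     (\<forall>(U, \<phi>)\<in>A. \<forall>(V, \<psi>)\<in>B. smooth_on (\<phi> ` (U \<inter> S \<inter> F -` V)) (\<psi> \<circ> F \<circ> inv_into U \<phi>))"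

definition smooth_atlas :: "('a::topological_space, 'v::real_normed_vector) atlas \<Rightarrow> bool" where
  "smooth_atlas A \<longleftrightarrow>
     (\<forall>(U, \<phi>)\<in>A. open U \<and> open (\<phi> ` U) \<and> homeomorphism U (\<phi> ` U) \<phi> (inv_into U \<phi>)) \<and>
     (\<Union>(U, \<phi>)\<in>A. U) = UNIV \<and>
     (\<forall>(U, \<phi>)\<in>A. \<forall>(V, \<psi>)\<in>A. smooth_on (\<phi> ` (U \<inter> V)) (\<psi> \<circ> inv_into U \<phi>))"

definition smooth_fun_on ::
  "('a::topological_space, 'v::real_normed_vector) atlas \<Rightarrow> 'a set \<Rightarrow> ('a \<Rightarrow> real) \<Rightarrow> bool" where
  "smooth_fun_on A S f \<longleftrightarrow> smooth_map_on A model_atlas S f"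

definition smooth_near ::
  "('a::topological_space, 'v::real_normed_vector) atlas \<Rightarrow> 'a \<Rightarrow> ('a \<Rightarrow> real) \<Rightarrow> bool" where
  "smooth_near A p f \<longleftrightarrow> (\<exists>S. open S \<and> p \<in> S \<and> smooth_fun_on A S f)"


section \<open>Tangent vectors, vector fields and forms\<close>

type_synonym 'a tangent = "('a \<Rightarrow> real) \<Rightarrow> real"
type_synonym 'a cotangent = "'a tangent \<Rightarrow> real"

definition velocity ::
  "('a::topological_space, 'v::real_normed_vector) atlas \<Rightarrow> (real \<Rightarrow> 'a) \<Rightarrow> 'a tangent" where
  "velocity A c = (\<lambda>f. if smooth_near A (c 0) f then deriv (\<lambda>t. f (c t)) 0 else 0)"

definition tangent_space ::
  "('a::topological_space, 'v::real_normed_vector) atlas \<Rightarrow> 'a \<Rightarrow> 'a tangent set" where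
  "tangent_space A p =
     {velocity A c | c. c 0 = p \<and> (\<exists>\<epsilon>>0. smooth_map_on model_atlas A {-\<epsilon><..<\<epsilon>} c)}"

abbreviation cotangent_space ::
  "('a::topological_space, 'v::real_normed_vector) atlas \<Rightarrow> 'a \<Rightarrow> 'a cotangent set" where
  "cotangent_space A p \<equiv> dual_space (tangent_space A p)"

text \<open>The differential at \<open>p\<close> of a map \<open>F\<close> into the manifold with atlas \<open>B\<close>.\<close>

definition tangent_map ::
  "('b::topological_space, 'w::real_normed_vector) atlas \<Rightarrow> ('a \<Rightarrow> 'b) \<Rightarrow> 'a
     \<Rightarrow> 'a tangent \<Rightarrow> 'b tangent" where
  "tangent_map B F p u = (\<lambda>f. if smooth_near B (F p) f then u (f \<circ> F) else 0)"

definition vector_field ::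
  "('a::topological_space, 'v::real_normed_vector) atlas \<Rightarrow> ('a \<Rightarrow> 'a tangent) \<Rightarrow> bool" where
  "vector_field A X \<longleftrightarrow> (\<forall>p. X p \<in> tangent_space A p) \<and>
     (\<forall>S f. open S \<and> smooth_fun_on A S f \<longrightarrow> smooth_fun_on A S (\<lambda>p. X p f))"

definition one_form ::
  "('a::topological_space, 'v::real_normed_vector) atlas \<Rightarrow> ('a \<Rightarrow> 'a cotangent) \<Rightarrow> bool" where
  "one_form A \<xi> \<longleftrightarrow> (\<forall>p. \<xi> p \<in> cotangent_space A p) \<and>
     (\<forall>X. vector_field A X \<longrightarrow> smooth_fun_on A UNIV (\<lambda>p. \<xi> p (X p)))"

definition three_form ::
  "('a::topological_space, 'v::real_normed_vector) atlas
     \<Rightarrow> ('a \<Rightarrow> 'a tangent \<Rightarrow> 'a tangent \<Rightarrow> 'a tangent \<Rightarrow> real) \<Rightarrow> bool" where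
  "three_form A H \<longleftrightarrow> (\<forall>p. H p \<in> alternating_forms3 (tangent_space A p)) \<and>
     (\<forall>X Y Z. vector_field A X \<and> vector_field A Y \<and> vector_field A Z \<longrightarrow>
        smooth_fun_on A UNIV (\<lambda>p. H p (X p) (Y p) (Z p)))"

definition lie_bracket ::
  "('a::topological_space, 'v::real_normed_vector) atlas
     \<Rightarrow> ('a \<Rightarrow> 'a tangent) \<Rightarrow> ('a \<Rightarrow> 'a tangent) \<Rightarrow> 'a \<Rightarrow> 'a tangent" where
  "lie_bracket A X Y p =
     (\<lambda>f. if smooth_near A p f then X p (\<lambda>q. Y q f) - Y p (\<lambda>q. X q f) else 0)"

text \<open>
  The exterior derivative of a one-form and of a three-form, evaluated on vector fields; the latter
  is only needed in order to express closedness.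
\<close>

definition ext_d1 ::
  "('a::topological_space, 'v::real_normed_vector) atlas \<Rightarrow> ('a \<Rightarrow> 'a cotangent)
     \<Rightarrow> ('a \<Rightarrow> 'a tangent) \<Rightarrow> ('a \<Rightarrow> 'a tangent) \<Rightarrow> 'a \<Rightarrow> real" where
  "ext_d1 A \<xi> Y Z p =
     Y p (\<lambda>q. \<xi> q (Z q)) - Z p (\<lambda>q. \<xi> q (Y q)) - \<xi> p (lie_bracket A Y Z p)"

definition ext_d3 ::
  "('a::topological_space, 'v::real_normed_vector) atlas
     \<Rightarrow> ('a \<Rightarrow> 'a tangent \<Rightarrow> 'a tangent \<Rightarrow> 'a tangent \<Rightarrow> real)
     \<Rightarrow> ('a \<Rightarrow> 'a tangent) \<Rightarrow> ('a \<Rightarrow> 'a tangent) \<Rightarrow> ('a \<Rightarrow> 'a tangent) \<Rightarrow> ('a \<Rightarrow> 'a tangent)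
     \<Rightarrow> 'a \<Rightarrow> real" where
  "ext_d3 A H X Y Z W p =
       X p (\<lambda>q. H q (Y q) (Z q) (W q)) - Y p (\<lambda>q. H q (X q) (Z q) (W q))
     + Z p (\<lambda>q. H q (X q) (Y q) (W q)) - W p (\<lambda>q. H q (X q) (Y q) (Z q))
     - H p (lie_bracket A X Y p) (Z p) (W p) + H p (lie_bracket A X Z p) (Y p) (W p)
     - H p (lie_bracket A X W p) (Y p) (Z p) - H p (lie_bracket A Y Z p) (X p) (W p)
     + H p (lie_bracket A Y W p) (X p) (Z p) - H p (lie_bracket A Z W p) (X p) (Y p)"

definition closed_three_form ::
  "('a::topological_space, 'v::real_normed_vector) atlas
     \<Rightarrow> ('a \<Rightarrow> 'a tangent \<Rightarrow> 'a tangent \<Rightarrow> 'a tangent \<Rightarrow> real) \<Rightarrow> bool" where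
  "closed_three_form A H \<longleftrightarrow> three_form A H \<and>
     (\<forall>X Y Z W p. vector_field A X \<and> vector_field A Y \<and> vector_field A Z \<and> vector_field A W \<longrightarrow>
        ext_d3 A H X Y Z W p = 0)"

text \<open>The one-form whose value on each vector field \<open>Z\<close> is the function \<open>\<psi> Z\<close>.\<close>

definition one_form_of ::
  "('a::topological_space, 'v::real_normed_vector) atlas
     \<Rightarrow> (('a \<Rightarrow> 'a tangent) \<Rightarrow> 'a \<Rightarrow> real) \<Rightarrow> 'a \<Rightarrow> 'a cotangent" where
  "one_form_of A \<psi> = (THE \<zeta>. one_form A \<zeta> \<and> (\<forall>Z p. vector_field A Z \<longrightarrow> \<zeta> p (Z p) = \<psi> Z p))"

definition lie_derivative_form ::
  "('a::topological_space, 'v::real_normed_vector) atlas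
     \<Rightarrow> ('a \<Rightarrow> 'a tangent) \<Rightarrow> ('a \<Rightarrow> 'a cotangent) \<Rightarrow> 'a \<Rightarrow> 'a cotangent" where
  "lie_derivative_form A X \<eta> =
     one_form_of A (\<lambda>Z p. X p (\<lambda>q. \<eta> q (Z q)) - \<eta> p (lie_bracket A X Z p))"

definition contract_d1 ::
  "('a::topological_space, 'v::real_normed_vector) atlas
     \<Rightarrow> ('a \<Rightarrow> 'a tangent) \<Rightarrow> ('a \<Rightarrow> 'a cotangent) \<Rightarrow> 'a \<Rightarrow> 'a cotangent" where
  "contract_d1 A Y \<xi> = one_form_of A (ext_d1 A \<xi> Y)"


section \<open>The generalized tangent bundle\<close>

type_synonym 'a gen_tangent = "'a tangent \<times> 'a cotangent"

definition gen_space ::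
  "('a::topological_space, 'v::real_normed_vector) atlas \<Rightarrow> 'a \<Rightarrow> 'a gen_tangent set" where
  "gen_space A p = tangent_space A p \<times> cotangent_space A p"

definition scalar_product :: "'a gen_tangent \<Rightarrow> 'a gen_tangent \<Rightarrow> real" where
  "scalar_product x y = (snd x (fst y) + snd y (fst x)) / 2"

definition gen_section ::
  "('a::topological_space, 'v::real_normed_vector) atlas \<Rightarrow> ('a \<Rightarrow> 'a gen_tangent) \<Rightarrow> bool" where
  "gen_section A e \<longleftrightarrow> vector_field A (\<lambda>p. fst (e p)) \<and> one_form A (\<lambda>p. snd (e p))"

definition dorfman ::
  "('a::topological_space, 'v::real_normed_vector) atlas
     \<Rightarrow> ('a \<Rightarrow> 'a tangent \<Rightarrow> 'a tangent \<Rightarrow> 'a tangent \<Rightarrow> real)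
     \<Rightarrow> ('a \<Rightarrow> 'a gen_tangent) \<Rightarrow> ('a \<Rightarrow> 'a gen_tangent) \<Rightarrow> 'a \<Rightarrow> 'a gen_tangent" where
  "dorfman A H e e' = (\<lambda>p.
     let X = (\<lambda>q. fst (e q)); \<xi> = (\<lambda>q. snd (e q)); Y = (\<lambda>q. fst (e' q)); \<eta> = (\<lambda>q. snd (e' q))
     in (lie_bracket A X Y p,
         lie_derivative_form A X \<eta> p - contract_d1 A Y \<xi> p + H p (X p) (Y p)))"

definition push_section ::
  "('a \<Rightarrow> 'b) \<Rightarrow> ('a \<Rightarrow> 'a gen_tangent \<Rightarrow> 'b gen_tangent)
     \<Rightarrow> ('a \<Rightarrow> 'a gen_tangent) \<Rightarrow> 'b \<Rightarrow> 'b gen_tangent" where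
  "push_section \<phi> \<Phi> e = (\<lambda>q. let p = the_inv \<phi> q in \<Phi> p (e p))"

text \<open>
  Isomorphisms of vector bundles covering a diffeomorphism \<open>\<phi>\<close>: fibrewise linear bijections such that
  both \<open>\<Phi>\<close> and its inverse are smooth, i.e. a (not necessarily smooth) section is smooth iff its
  image is.
\<close>

definition gen_bundle_iso ::
  "('a::topological_space, 'v::real_normed_vector) atlas
     \<Rightarrow> ('b::topological_space, 'w::real_normed_vector) atlas
     \<Rightarrow> ('a \<Rightarrow> 'b) \<Rightarrow> ('a \<Rightarrow> 'a gen_tangent \<Rightarrow> 'b gen_tangent) \<Rightarrow> bool" where
  "gen_bundle_iso A B \<phi> \<Phi> \<longleftrightarrow>
     bij \<phi> \<and> smooth_map_on A B UNIV \<phi> \<and> smooth_map_on B A UNIV (the_inv \<phi>) \<and>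
     (\<forall>p. bij_betw (\<Phi> p) (gen_space A p) (gen_space B (\<phi> p)) \<and>
          (\<forall>x\<in>gen_space A p. \<forall>y\<in>gen_space A p. \<Phi> p (x + y) = \<Phi> p x + \<Phi> p y) \<and>
          (\<forall>c. \<forall>x\<in>gen_space A p. \<Phi> p (c *\<^sub>R x) = c *\<^sub>R \<Phi> p x)) \<and>
     (\<forall>e. (\<forall>p. e p \<in> gen_space A p) \<longrightarrow>
        (gen_section A e \<longleftrightarrow> gen_section B (push_section \<phi> \<Phi> e)))"


section \<open>Lie groups and left-invariant structures\<close>

record ('a, 'v) lie_group_data = "'a monoid" +
  atlas :: "('a, 'v) atlas"

locale lie_group = group G
  for G :: "('a::{t2_space, second_countable_topology}, 'v::real_inner) lie_group_data" (structure) +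
  assumes carrier_UNIV: "carrier G = UNIV"
    and finite_dimensional: "\<exists>B::'v set. finite B \<and> span B = UNIV"
    and smooth_atlas: "smooth_atlas (atlas G)"
    and smooth_mult:
      "smooth_map_on (prod_atlas (atlas G) (atlas G)) (atlas G) UNIV (\<lambda>(a, b). a \<otimes> b)"
    and smooth_inv: "smooth_map_on (atlas G) (atlas G) UNIV (\<lambda>a. inv a)"

definition left_translate ::
  "('a::topological_space, 'v::real_normed_vector) lie_group_data
     \<Rightarrow> 'a \<Rightarrow> 'a \<Rightarrow> 'a tangent \<Rightarrow> 'a tangent" where
  "left_translate G a p = tangent_map (atlas G) (\<lambda>q. a \<otimes>\<^bsub>G\<^esub> q) p"

text \<open>The Lie algebra is the tangent space at the identity, with the bracket of the left-invariant
  vector fields \<open>left_field G u\<close>.\<close>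

abbreviation lie_algebra ::
  "('a::topological_space, 'v::real_normed_vector) lie_group_data \<Rightarrow> 'a tangent set" where
  "lie_algebra G \<equiv> tangent_space (atlas G) \<one>\<^bsub>G\<^esub>"

definition left_field ::
  "('a::topological_space, 'v::real_normed_vector) lie_group_data
     \<Rightarrow> 'a tangent \<Rightarrow> 'a \<Rightarrow> 'a tangent" where
  "left_field G u = (\<lambda>p. left_translate G p \<one>\<^bsub>G\<^esub> u)"

definition lie_algebra_bracket ::
  "('a::topological_space, 'v::real_normed_vector) lie_group_data
     \<Rightarrow> 'a tangent \<Rightarrow> 'a tangent \<Rightarrow> 'a tangent" where
  "lie_algebra_bracket G u v = lie_bracket (atlas G) (left_field G u) (left_field G v) \<one>\<^bsub>G\<^esub>"

definition left_invariant_closed_three_form ::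
  "('a::topological_space, 'v::real_normed_vector) lie_group_data
     \<Rightarrow> ('a \<Rightarrow> 'a tangent \<Rightarrow> 'a tangent \<Rightarrow> 'a tangent \<Rightarrow> real) \<Rightarrow> bool" where
  "left_invariant_closed_three_form G H \<longleftrightarrow> closed_three_form (atlas G) H \<and>
     (\<forall>a p. \<forall>u\<in>tangent_space (atlas G) p. \<forall>v\<in>tangent_space (atlas G) p.
        \<forall>w\<in>tangent_space (atlas G) p.
          H (a \<otimes>\<^bsub>G\<^esub> p) (left_translate G a p u) (left_translate G a p v) (left_translate G a p w)
            = H p u v w)"

definition left_invariant_metric ::
  "('a::topological_space, 'v::real_normed_vector) lie_group_data
     \<Rightarrow> ('a \<Rightarrow> 'a tangent \<Rightarrow> 'a tangent \<Rightarrow> real) \<Rightarrow> bool" where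
  "left_invariant_metric G g \<longleftrightarrow>
     (\<forall>p. g p \<in> symmetric_forms (tangent_space (atlas G) p) \<and>
          nondegenerate_on (tangent_space (atlas G) p) (g p)) \<and>
     (\<forall>X Y. vector_field (atlas G) X \<and> vector_field (atlas G) Y \<longrightarrow>
        smooth_fun_on (atlas G) UNIV (\<lambda>p. g p (X p) (Y p))) \<and>
     (\<forall>a p. \<forall>u\<in>tangent_space (atlas G) p. \<forall>v\<in>tangent_space (atlas G) p.
        g (a \<otimes>\<^bsub>G\<^esub> p) (left_translate G a p u) (left_translate G a p v) = g p u v)"


section \<open>Pseudo-Riemannian generalized Lie groups\<close>

text \<open>\<open>gen_algebra G\<close> is the direct sum \<open>E\<close> of the Lie algebra and its dual.\<close>

abbreviation gen_algebra ::
  "('a::topological_space, 'v::real_normed_vector) lie_group_data \<Rightarrow> 'a gen_tangent set" where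
  "gen_algebra G \<equiv> gen_space (atlas G) \<one>\<^bsub>G\<^esub>"

definition gen_endomorphism ::
  "('a::topological_space, 'v::real_normed_vector) lie_group_data
     \<Rightarrow> ('a gen_tangent \<Rightarrow> 'a gen_tangent \<Rightarrow> real) \<Rightarrow> 'a gen_tangent \<Rightarrow> 'a gen_tangent" where
  "gen_endomorphism G \<G> x =
     (THE y. y \<in> gen_algebra G \<and> (\<forall>z\<in>gen_algebra G. scalar_product y z = \<G> x z))"

definition generalized_metric ::
  "('a::topological_space, 'v::real_normed_vector) lie_group_data
     \<Rightarrow> ('a gen_tangent \<Rightarrow> 'a gen_tangent \<Rightarrow> real) \<Rightarrow> bool" where
  "generalized_metric G \<G> \<longleftrightarrow> \<G> \<in> symmetric_forms (gen_algebra G) \<and>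
     (\<forall>x\<in>gen_algebra G. gen_endomorphism G \<G> (gen_endomorphism G \<G> x) = x) \<and>
     nondegenerate_on (dual_space (lie_algebra G)) (\<lambda>\<xi> \<eta>. \<G> (0, \<xi>) (0, \<eta>))"

definition gen_metric_of ::
  "('a::topological_space, 'v::real_normed_vector) lie_group_data
     \<Rightarrow> ('a \<Rightarrow> 'a tangent \<Rightarrow> 'a tangent \<Rightarrow> real)
     \<Rightarrow> 'a gen_tangent \<Rightarrow> 'a gen_tangent \<Rightarrow> real" where
  "gen_metric_of G g x y =
     (if x \<in> gen_algebra G \<and> y \<in> gen_algebra G
      then (g \<one>\<^bsub>G\<^esub> (fst x) (fst y) +
            inverse_metric (lie_algebra G) (g \<one>\<^bsub>G\<^esub>) (snd x) (snd y)) / 2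
      else 0)"

text \<open>\<open>to_identity G p\<close> is the map of fibres from \<open>p\<close> to the identity induced by left translation;
  it identifies bilinear forms on \<open>gen_algebra G\<close> with left-invariant tensor fields.\<close>

definition to_identity ::
  "('a::topological_space, 'v::real_normed_vector) lie_group_data
     \<Rightarrow> 'a \<Rightarrow> 'a gen_tangent \<Rightarrow> 'a gen_tangent" where
  "to_identity G p x =
     (left_translate G (inv\<^bsub>G\<^esub> p) p (fst x),
      \<lambda>w. if w \<in> lie_algebra G then snd x (left_translate G p \<one>\<^bsub>G\<^esub> w) else 0)"

definition left_invariant_field ::
  "('a::topological_space, 'v::real_normed_vector) lie_group_data
     \<Rightarrow> ('a gen_tangent \<Rightarrow> 'a gen_tangent \<Rightarrow> real)
     \<Rightarrow> 'a \<Rightarrow> 'a gen_tangent \<Rightarrow> 'a gen_tangent \<Rightarrow> real" where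
  "left_invariant_field G \<G> p x y = \<G> (to_identity G p x) (to_identity G p y)"

definition generalized_lie_group ::
  "('a::{t2_space, second_countable_topology}, 'v::real_inner) lie_group_data
     \<Rightarrow> ('a \<Rightarrow> 'a tangent \<Rightarrow> 'a tangent \<Rightarrow> 'a tangent \<Rightarrow> real)
     \<Rightarrow> ('a gen_tangent \<Rightarrow> 'a gen_tangent \<Rightarrow> real) \<Rightarrow> bool" where
  "generalized_lie_group G H \<G> \<longleftrightarrow>
     lie_group G \<and> left_invariant_closed_three_form G H \<and> generalized_metric G \<G>"

definition generalized_lie_group_iso ::
  "('a::{t2_space, second_countable_topology}, 'v::real_inner) lie_group_data
     \<Rightarrow> ('a \<Rightarrow> 'a tangent \<Rightarrow> 'a tangent \<Rightarrow> 'a tangent \<Rightarrow> real)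
     \<Rightarrow> ('a gen_tangent \<Rightarrow> 'a gen_tangent \<Rightarrow> real)
     \<Rightarrow> ('b::{t2_space, second_countable_topology}, 'w::real_inner) lie_group_data
     \<Rightarrow> ('b \<Rightarrow> 'b tangent \<Rightarrow> 'b tangent \<Rightarrow> 'b tangent \<Rightarrow> real)
     \<Rightarrow> ('b gen_tangent \<Rightarrow> 'b gen_tangent \<Rightarrow> real)
     \<Rightarrow> ('a \<Rightarrow> 'b) \<Rightarrow> ('a \<Rightarrow> 'a gen_tangent \<Rightarrow> 'b gen_tangent) \<Rightarrow> bool" where
  "generalized_lie_group_iso G H \<G> G' H' \<G>' \<phi> \<Phi> \<longleftrightarrow>
     generalized_lie_group G H \<G> \<and> generalized_lie_group G' H' \<G>' \<and>
     \<phi> \<in> iso G G' \<and> gen_bundle_iso (atlas G) (atlas G') \<phi> \<Phi> \<and>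
     (\<forall>p. \<forall>x\<in>gen_space (atlas G) p. fst (\<Phi> p x) = tangent_map (atlas G') \<phi> p (fst x)) \<and>
     (\<forall>p. \<forall>x\<in>gen_space (atlas G) p. \<forall>y\<in>gen_space (atlas G) p.
        scalar_product (\<Phi> p x) (\<Phi> p y) = scalar_product x y) \<and>
     (\<forall>e e'. gen_section (atlas G) e \<and> gen_section (atlas G) e' \<longrightarrow>
        push_section \<phi> \<Phi> (dorfman (atlas G) H e e') =
          dorfman (atlas G') H' (push_section \<phi> \<Phi> e) (push_section \<phi> \<Phi> e')) \<and>
     (\<forall>p. \<forall>x\<in>gen_space (atlas G) p. \<forall>y\<in>gen_space (atlas G) p.
        left_invariant_field G' \<G>' (\<phi> p) (\<Phi> p x) (\<Phi> p y) = left_invariant_field G \<G> p x y)"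

end

theory Submission
  imports Defs
begin

text \<open>
  The restriction of \<open>2 \<G>\<close> to the dual of the Lie algebra is a non-degenerate symmetric form, hence
  the inverse of a metric \<open>g\<close>. If \<open>A\<close> is the block of the endomorphism of \<open>\<G>\<close> that maps the Lie algebra
  to itself, the involution property forces \<open>B X Y = g (A X) Y\<close> to be skew, and \<open>\<G>\<close> is the pull-back of
  \<open>\<G>\<^sub>g\<close> under the shear \<open>X + \<xi> \<mapsto> X + \<xi> + B X\<close>. This shear preserves the anchor and the scalar product and
  turns the Dorfman bracket twisted by \<open>H\<close> into the one twisted by \<open>H - dB\<close>.

  On the analytic side, left-invariant vector fields form a global frame with smooth coefficients,
  since left translation to the identity depends smoothly on the point. So expressions that are
  linear over smooth functions are determined by their values on left-invariant fields, and no
  bump functions are needed.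
\<close>

section \<open>Calculus in finite-dimensional inner product spaces\<close>

text \<open>Let \<sigma> be the block of the endomorphism from the dual into the Lie algebra, and
  \<tau> the block in the opposite direction. Symmetry of \<G> makes the block on the dual the
  transpose A* of A, and the square being the identity gives A \<sigma> + \<sigma> A* = 0 and A A +
  \<sigma> \<tau> = 1. The first identity is the skewness of g A; the second determines \<tau>, so
  \<G> depends on g and A alone. Conjugating the endomorphism of the metric of g by the shear gives
  the diagonal block g^{-1} B, which has to be A: this is the origin of B = g A.

  The obstacle is analytic. Closedness, Lie derivatives and the Dorfman bracket are defined through
  arbitrary global vector fields, partly by definite descriptions. So dB must be identified with the
  Chevalley-Eilenberg differential on all fields, not only on invariant ones, and each description
  needs existence as well as uniqueness. Tensors extended by zero outside the fibres must in
  addition be compared there.\<close>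

definition finite_frame :: "'v::real_inner set \<Rightarrow> bool" where
  "finite_frame B \<longleftrightarrow> finite B \<and> (\<forall>x. (\<Sum>b\<in>B. (x \<bullet> b) *\<^sub>R b) = x)"

text \<open>Normalising the non-zero members of an orthogonal spanning set gives an orthonormal
  basis; the expansion holds on the spanning set and extends by linearity. Frames take the place of
  \<open>Basis\<close>, because the class \<open>real_inner\<close> admits the zero space. Only the
  expansion is required of a frame, so it may contain zero.\<close>

lemma finite_frame_exists:
  assumes "finite (B::'v::real_inner set)" "span B = UNIV"
  shows "\<exists>C::'v set. finite_frame C"
proof -
  obtain C where C: "finite C" "span C = (UNIV::'v set)" "pairwise orthogonal C"
    using basis_orthogonal[OF assms(1)] assms(2) by auto
  define n where "n = (\<lambda>c::'v. c /\<^sub>R norm c)"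
  have inj: "inj_on n (C - {0})"
  proof (rule inj_onI, rule ccontr)
    fix c d assume cd: "c \<in> C - {0}" "d \<in> C - {0}" "n c = n d" "c \<noteq> d"
    then have "c \<bullet> d = 0"
      using C(3) by (auto simp: pairwise_def orthogonal_def)
    then have "n c \<bullet> n d = 0" by (simp add: n_def)
    then have "n d = 0" using cd(3) by simp
    then show False using cd by (simp add: n_def)
  qed
  have expand: "(\<Sum>c\<in>C - {0}. (x \<bullet> n c) *\<^sub>R n c) = x" for x
  proof -
    have "x \<in> span C" using C by simp
    then show ?thesis
    proof (induction rule: span_induct_alt)
      case base
      then show ?case by simp
    next
      case (step a c y)
      have *: "(\<Sum>d\<in>C - {0}. (c \<bullet> n d) *\<^sub>R n d) = c"
      proof (cases "c = 0")
        case False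
        have "(\<Sum>d\<in>C - {0}. (c \<bullet> n d) *\<^sub>R n d) = (\<Sum>d\<in>C - {0}. if d = c then c else 0)"
        proof (rule sum.cong[OF refl])
          fix d assume d: "d \<in> C - {0}"
          show "(c \<bullet> n d) *\<^sub>R n d = (if d = c then c else 0)"
          proof (cases "d = c")
            case True
            then show ?thesis using False
              by (simp add: n_def dot_square_norm power2_eq_square field_simps)
          next
            case False
            then have "c \<bullet> d = 0"
              using C(3) d step(1) by (auto simp: pairwise_def orthogonal_def)
            then show ?thesis using False by (simp add: n_def)
          qed
        qed
        also have "\<dots> = c" using C(1) step(1) False by simp
        finally show ?thesis .
      qed simp
      have "(\<Sum>d\<in>C - {0}. ((a *\<^sub>R c + y) \<bullet> n d) *\<^sub>R n d) =
        (\<Sum>d\<in>C - {0}. a *\<^sub>R (c \<bullet> n d) *\<^sub>R n d + (y \<bullet> n d) *\<^sub>R n d)"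
        by (simp add: inner_add_left scaleR_add_left)
      also have "\<dots> = a *\<^sub>R c + y"
        unfolding sum.distrib scaleR_sum_right[symmetric] * step(2) ..
      finally show ?case .
    qed
  qed
  have "finite_frame (n ` (C - {0}))"
    unfolding finite_frame_def using C(1) by (simp add: sum.reindex[OF inj] expand)
  then show ?thesis by blast
qed

lemma finite_frame_real: "finite_frame {1::real}"
  by (simp add: finite_frame_def)

lemma finite_frame_prod:
  assumes "finite_frame (B::'v::real_inner set)" "finite_frame (C::'w::real_inner set)"
  shows "\<exists>D::('v \<times> 'w) set. finite_frame D"
proof -
  \<comment> \<open>Both frames may contain zero; removing it from C keeps (0, 0) out of the
    intersection of the two images, so that the sum splits.\<close>
  define D :: "('v \<times> 'w) set" where "D = (\<lambda>b. (b, 0)) ` B \<union> (\<lambda>c. (0, c)) ` (C - {0})"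
  have fin: "finite B" "finite C" using assms by (auto simp: finite_frame_def)
  have C0: "(\<Sum>c\<in>C - {0}. (y \<bullet> c) *\<^sub>R c) = y" for y
    using assms(2) sum.mono_neutral_left[of C "C - {0}" "\<lambda>c. (y \<bullet> c) *\<^sub>R c"]
    by (auto simp: finite_frame_def)
  have "(\<Sum>d\<in>D. (x \<bullet> d) *\<^sub>R d) = x" for x
  proof -
    have "(\<Sum>d\<in>D. (x \<bullet> d) *\<^sub>R d) =
      (\<Sum>d\<in>(\<lambda>b. (b, 0)) ` B. (x \<bullet> d) *\<^sub>R d) + (\<Sum>d\<in>(\<lambda>c. (0, c)) ` (C - {0}). (x \<bullet> d) *\<^sub>R d)"
      unfolding D_def by (rule sum.union_disjoint) (use fin in auto)
    also have "\<dots> = (\<Sum>b\<in>B. ((fst x \<bullet> b) *\<^sub>R b, 0)) + (\<Sum>c\<in>C - {0}. (0, (snd x \<bullet> c) *\<^sub>R c))"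
      by (simp add: sum.reindex inj_on_def inner_prod_def)
    also have "\<dots> = x"
      using assms(1) C0 by (simp add: prod_eq_iff fst_sum snd_sum finite_frame_def)
    finally show ?thesis .
  qed
  moreover have "finite D" using fin by (simp add: D_def)
  ultimately show ?thesis unfolding finite_frame_def by blast
qed

text \<open>This trades a direction that varies from point to point for variable coefficients and
  fixed directions, the only ones along which \<open>C_k_on\<close> differentiates.\<close>

lemma linear_frame_expand:
  assumes "finite_frame B" "linear f"
  shows "f x = (\<Sum>b\<in>B. (x \<bullet> b) *\<^sub>R f b)"
proof -
  have "f x = f (\<Sum>b\<in>B. (x \<bullet> b) *\<^sub>R b)" using assms(1) by (simp add: finite_frame_def)
  also have "\<dots> = (\<Sum>b\<in>B. (x \<bullet> b) *\<^sub>R f b)"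
    using assms(2) by (simp add: linear_sum linear_cmul)
  finally show ?thesis .
qed

subsection \<open>Functions of class \<open>C_k\<close>\<close>

lemma C_k_on_subset: "C_k_on k T f \<Longrightarrow> S \<subseteq> T \<Longrightarrow> C_k_on k S f"
  by (induction k arbitrary: f) (auto intro: continuous_on_subset)

text \<open>\<open>frechet_derivative\<close> at a point sees a whole neighbourhood. Since S is
  open, agreement on S passes to the derivatives, and the induction continues with them.\<close>

lemma C_k_on_cong:
  assumes "open S" "\<And>x. x \<in> S \<Longrightarrow> f x = g x" "C_k_on k S f"
  shows "C_k_on k S g"
  using assms(2,3)
proof (induction k arbitrary: f g)
  case 0
  then show ?case using continuous_on_cong by force
next
  case (Suc k)
  have d: "(g has_derivative frechet_derivative f (at x)) (at x)" if "x \<in> S" for x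
    using Suc.prems that assms(1)
    by (auto simp: frechet_derivative_works intro: has_derivative_transform_within_open)
  then have e: "frechet_derivative f (at x) = frechet_derivative g (at x)" if "x \<in> S" for x
    using that frechet_derivative_at by blast
  show ?case
    using d Suc.prems(2) Suc.IH[of "\<lambda>x. frechet_derivative f (at x) v" "\<lambda>x. frechet_derivative g (at x) v" for v] e
    by (auto simp: differentiable_def)
qed

lemma C_k_on_local:
  assumes "\<And>x. x \<in> S \<Longrightarrow> \<exists>T. open T \<and> x \<in> T \<and> C_k_on k T f"
  shows "C_k_on k S f"
  using assms
proof (induction k arbitrary: f)
  case 0
  have "continuous (at x) f" if "x \<in> S" for x
    using 0[OF that] continuous_on_eq_continuous_at by auto
  then show ?case by (simp add: continuous_at_imp_continuous_on)
next
  case (Suc k)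
  show ?case
    unfolding C_k_on.simps
  proof (intro conjI ballI allI)
    show "f differentiable at x" if "x \<in> S" for x
      using Suc.prems[OF that] by auto
    show "C_k_on k S (\<lambda>x. frechet_derivative f (at x) v)" for v
      by (rule Suc.IH) (use Suc.prems in fastforce)
  qed
qed

lemma C_k_on_SucD: "C_k_on (Suc k) S f \<Longrightarrow> C_k_on k S f"
proof (induction k arbitrary: f)
  case 0
  then show ?case
    by (auto intro: continuous_at_imp_continuous_on differentiable_imp_continuous_within)
next
  case (Suc k)
  then show ?case by (metis C_k_on.simps(2))
qed

lemma C_k_on_const [simp]: "C_k_on k S (\<lambda>x. c)"
  by (induction k arbitrary: c) auto

lemma C_k_on_bounded_linear:
  assumes "bounded_linear f"
  shows "C_k_on k S f"
proof (cases k)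
  case 0
  then show ?thesis using assms by (simp add: linear_continuous_on)
next
  case (Suc k)
  have d: "(f has_derivative f) (at x)" for x
    using assms by (rule bounded_linear_imp_has_derivative)
  then have "frechet_derivative f (at x) = f" for x
    using frechet_derivative_at by metis
  then show ?thesis
    using d by (auto simp: Suc differentiable_def)
qed

lemma C_k_on_SucI:
  assumes "open S" "\<And>x. x \<in> S \<Longrightarrow> (f has_derivative f' x) (at x)"
    and "\<And>v. C_k_on k S (\<lambda>x. f' x v)"
  shows "C_k_on (Suc k) S f"
  unfolding C_k_on.simps
proof (intro conjI ballI allI)
  show "f differentiable at x" if "x \<in> S" for x
    using assms(2)[OF that] differentiableI by blast
  show "C_k_on k S (\<lambda>x. frechet_derivative f (at x) v)" for v
    by (rule C_k_on_cong[OF assms(1) _ assms(3)]) (simp add: frechet_derivative_at[OF assms(2)])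
qed

lemma C_k_on_SucE:
  assumes "C_k_on (Suc k) S f"
  obtains "\<And>x. x \<in> S \<Longrightarrow> (f has_derivative frechet_derivative f (at x)) (at x)"
    and "\<And>v. C_k_on k S (\<lambda>x. frechet_derivative f (at x) v)" and "C_k_on k S f"
  using assms C_k_on_SucD[OF assms] by (simp add: frechet_derivative_works)

lemma C_k_on_bounded_linear_comp:
  assumes "bounded_linear L" "open S" "C_k_on k S f"
  shows "C_k_on k S (\<lambda>x. L (f x))"
  using assms(3)
proof (induction k arbitrary: f)
  case 0
  then show ?case
    using assms(1) bounded_linear.continuous_on by auto
next
  case (Suc k)
  show ?case
    using Suc.prems
    by (rule C_k_on_SucE)
      (rule C_k_on_SucI[OF assms(2) bounded_linear.has_derivative[OF assms(1)] Suc.IH])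
qed

lemma C_k_on_add:
  assumes "open S" "C_k_on k S f" "C_k_on k S g"
  shows "C_k_on k S (\<lambda>x. f x + g x)"
  using assms(2,3)
proof (induction k arbitrary: f g)
  case 0
  then show ?case by (auto intro: continuous_on_add)
next
  case (Suc k)
  show ?case
    by (rule C_k_on_SucE[OF Suc.prems(1)], rule C_k_on_SucE[OF Suc.prems(2)],
        rule C_k_on_SucI[OF assms(1) has_derivative_add Suc.IH])
qed

lemma C_k_on_bilinear:
  assumes "bounded_bilinear pr" "open S" "C_k_on k S f" "C_k_on k S g"
  shows "C_k_on k S (\<lambda>x. pr (f x) (g x))"
  using assms(3,4)
proof (induction k arbitrary: f g)
  case 0
  then show ?case using assms(1) by (auto intro: bounded_bilinear.continuous_on)
next
  case (Suc k)
  show ?case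
    by (rule C_k_on_SucE[OF Suc.prems(1)], rule C_k_on_SucE[OF Suc.prems(2)],
        rule C_k_on_SucI[OF assms(2) bounded_bilinear.FDERIV[OF assms(1)]
          C_k_on_add[OF assms(2) Suc.IH Suc.IH]])
qed

lemma C_k_on_sum:
  assumes "open S" "\<And>i. i \<in> I \<Longrightarrow> C_k_on k S (f i)"
  shows "C_k_on k S (\<lambda>x. \<Sum>i\<in>I. f i x)"
  using assms(2) by (induction I rule: infinite_finite_induct) (auto intro: C_k_on_add assms(1))

lemma C_k_on_Pair:
  assumes "open S" "C_k_on k S f" "C_k_on k S g"
  shows "C_k_on k S (\<lambda>x. (f x, g x))"
proof -
  have "C_k_on k S (\<lambda>x. (f x, 0) + (0, g x))"
    by (intro C_k_on_add assms C_k_on_bounded_linear_comp[OF _ assms(1), where L="\<lambda>a. (a, 0)"]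
        C_k_on_bounded_linear_comp[OF _ assms(1), where L="\<lambda>a. (0, a)"]
        bounded_linear_Pair bounded_linear_ident bounded_linear_zero)
  then show ?thesis by simp
qed

text \<open>The chain rule leaves the derivative of g at \<open>f x\<close> in the direction of the
  derivative of f, which depends on x. Expanded in the frame it becomes a sum of products of a
  component of the derivative of f and a derivative of g in a fixed direction composed with f; the
  induction hypothesis, with g generalised, covers the latter.\<close>

lemma C_k_on_comp:
  fixes f :: "'u::real_normed_vector \<Rightarrow> 'v::real_inner" and g :: "'v \<Rightarrow> 'w::real_normed_vector"
  assumes B: "finite_frame (B::'v set)" and "open S" "open T"
    and "C_k_on k S f" "C_k_on k T g" "f ` S \<subseteq> T"
  shows "C_k_on k S (\<lambda>x. g (f x))"
  using assms(4-)
proof (induction k arbitrary: g)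
  case 0
  then show ?case using continuous_on_compose2 by auto
next
  case (Suc k)
  note f = C_k_on_SucE[OF Suc.prems(1)] and g = C_k_on_SucE[OF Suc.prems(2)]
  have fT: "f x \<in> T" if "x \<in> S" for x using Suc.prems that by auto
  have dg: "g differentiable at (f x)" if "x \<in> S" for x
    using Suc.prems fT[OF that] by simp
  have d: "((\<lambda>x. g (f x)) has_derivative
      (\<lambda>v. frechet_derivative g (at (f x)) (frechet_derivative f (at x) v))) (at x)" if "x \<in> S" for x
    by (rule f, rule g, rule has_derivative_compose) (use fT that in auto)
  have e: "frechet_derivative g (at (f x)) (frechet_derivative f (at x) v) =
      (\<Sum>b\<in>B. (frechet_derivative f (at x) v \<bullet> b) *\<^sub>R frechet_derivative g (at (f x)) b)"
    if "x \<in> S" for x v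
    using linear_frame_expand[OF B linear_frechet_derivative[OF dg[OF that]]] .
  have c: "C_k_on k S (\<lambda>x. (\<Sum>b\<in>B. (frechet_derivative f (at x) v \<bullet> b) *\<^sub>R frechet_derivative g (at (f x)) b))" for v
    by (rule f, rule g,
        intro C_k_on_sum C_k_on_bilinear[OF bounded_bilinear_scaleR] assms(2) Suc.IH Suc.prems(3)
          C_k_on_bounded_linear_comp[OF bounded_linear_inner_left])
  show ?case
    by (rule C_k_on_SucI[OF assms(2) d], assumption, rule C_k_on_cong[OF assms(2) _ c]) (simp add: e)
qed

subsection \<open>Smooth functions\<close>

lemma smooth_on_subset: "smooth_on T f \<Longrightarrow> S \<subseteq> T \<Longrightarrow> smooth_on S f"
  unfolding smooth_on_def by (blast intro: C_k_on_subset)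

lemma smooth_on_cong:
  "open S \<Longrightarrow> (\<And>x. x \<in> S \<Longrightarrow> f x = g x) \<Longrightarrow> smooth_on S f \<Longrightarrow> smooth_on S g"
  unfolding smooth_on_def using C_k_on_cong by blast

lemma smooth_on_local:
  "(\<And>x. x \<in> S \<Longrightarrow> \<exists>T. open T \<and> x \<in> T \<and> smooth_on T f) \<Longrightarrow> smooth_on S f"
  unfolding smooth_on_def by (meson C_k_on_local)

lemma smooth_on_imp_differentiable: "smooth_on S f \<Longrightarrow> x \<in> S \<Longrightarrow> f differentiable (at x)"
  unfolding smooth_on_def using C_k_on.simps(2) by blast

lemma smooth_on_imp_continuous_on: "smooth_on S f \<Longrightarrow> continuous_on S f"
  unfolding smooth_on_def using C_k_on.simps(1) by blast

lemma smooth_on_frechet_derivative: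
  "smooth_on S f \<Longrightarrow> smooth_on S (\<lambda>x. frechet_derivative f (at x) v)"
  unfolding smooth_on_def using C_k_on.simps(2) by blast

lemma smooth_on_const [simp]: "smooth_on S (\<lambda>x. c)"
  by (simp add: smooth_on_def)

lemma smooth_on_bounded_linear: "bounded_linear f \<Longrightarrow> smooth_on S f"
  by (simp add: smooth_on_def C_k_on_bounded_linear)

lemma smooth_on_id [simp]: "smooth_on S (\<lambda>x. x)" "smooth_on S id"
  by (simp_all add: smooth_on_bounded_linear bounded_linear_ident id_def)

lemma smooth_on_add:
  "open S \<Longrightarrow> smooth_on S f \<Longrightarrow> smooth_on S g \<Longrightarrow> smooth_on S (\<lambda>x. f x + g x)"
  by (simp add: smooth_on_def C_k_on_add)

lemma smooth_on_mult:
  fixes f g :: "_ \<Rightarrow> real"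
  shows "open S \<Longrightarrow> smooth_on S f \<Longrightarrow> smooth_on S g \<Longrightarrow> smooth_on S (\<lambda>x. f x * g x)"
  by (simp add: smooth_on_def C_k_on_bilinear[OF bounded_bilinear_mult])

lemma smooth_on_Pair:
  "open S \<Longrightarrow> smooth_on S f \<Longrightarrow> smooth_on S g \<Longrightarrow> smooth_on S (\<lambda>x. (f x, g x))"
  by (simp add: smooth_on_def C_k_on_Pair)

lemma smooth_on_comp:
  fixes f :: "'u::real_normed_vector \<Rightarrow> 'v::real_inner" and g :: "'v \<Rightarrow> 'w::real_normed_vector"
  assumes "finite_frame (B::'v set)" "open S" "open T" "smooth_on S f" "smooth_on T g" "f ` S \<subseteq> T"
  shows "smooth_on S (\<lambda>x. g (f x))"
  using assms C_k_on_comp unfolding smooth_on_def by blast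

section \<open>Symmetry of second derivatives\<close>

lemma second_difference_mean_value:
  fixes f :: "'v::real_normed_vector \<Rightarrow> real"
  assumes f: "smooth_on S f" and h: "0 < h"
    and S: "\<And>s t. 0 \<le> s \<Longrightarrow> s \<le> h \<Longrightarrow> 0 \<le> t \<Longrightarrow> t \<le> h \<Longrightarrow> x + s *\<^sub>R u + t *\<^sub>R v \<in> S"
  obtains s t where "0 < s" "s < h" "0 < t" "t < h"
    "f (x + h *\<^sub>R u + h *\<^sub>R v) - f (x + h *\<^sub>R u) - f (x + h *\<^sub>R v) + f x =
      h * h * frechet_derivative (\<lambda>y. frechet_derivative f (at y) u) (at (x + s *\<^sub>R u + t *\<^sub>R v)) v"
proof -
  define df where "df = (\<lambda>y. frechet_derivative f (at y) u)"
  have df: "smooth_on S df" unfolding df_def by (rule smooth_on_frechet_derivative[OF f])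
  have d: "((\<lambda>s. f (x + s *\<^sub>R u + t *\<^sub>R v)) has_real_derivative df (x + s *\<^sub>R u + t *\<^sub>R v)) (at s)"
    if "0 \<le> s" "s \<le> h" "0 \<le> t" "t \<le> h" for s t
  proof -
    have l: "(f has_derivative frechet_derivative f (at (x + s *\<^sub>R u + t *\<^sub>R v))) (at (x + s *\<^sub>R u + t *\<^sub>R v))"
      using smooth_on_imp_differentiable[OF f S[OF that]] by (simp add: frechet_derivative_works)
    have "((\<lambda>s. f (x + s *\<^sub>R u + t *\<^sub>R v)) has_derivative
        (\<lambda>k. frechet_derivative f (at (x + s *\<^sub>R u + t *\<^sub>R v)) (k *\<^sub>R u))) (at s)"
      by (rule has_derivative_compose[where g=f and f="\<lambda>s. x + s *\<^sub>R u + t *\<^sub>R v" and x=s, OF _ l]) (auto intro!: derivative_eq_intros)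
    moreover have "frechet_derivative f (at (x + s *\<^sub>R u + t *\<^sub>R v)) (k *\<^sub>R u) =
        k * df (x + s *\<^sub>R u + t *\<^sub>R v)" for k
      using linear_cmul[OF has_derivative_linear[OF l]] by (simp add: df_def)
    ultimately show ?thesis by (simp add: has_field_derivative_def mult_commute_abs)
  qed
  have d': "((\<lambda>t. df (x + s *\<^sub>R u + t *\<^sub>R v)) has_real_derivative
      frechet_derivative df (at (x + s *\<^sub>R u + t *\<^sub>R v)) v) (at t)"
    if "0 \<le> s" "s \<le> h" "0 \<le> t" "t \<le> h" for s t
  proof -
    have l: "(df has_derivative frechet_derivative df (at (x + s *\<^sub>R u + t *\<^sub>R v))) (at (x + s *\<^sub>R u + t *\<^sub>R v))"
      using smooth_on_imp_differentiable[OF df S[OF that]] by (simp add: frechet_derivative_works)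
    have "((\<lambda>t. df (x + s *\<^sub>R u + t *\<^sub>R v)) has_derivative
        (\<lambda>k. frechet_derivative df (at (x + s *\<^sub>R u + t *\<^sub>R v)) (k *\<^sub>R v))) (at t)"
      by (rule has_derivative_compose[where g=df and f="\<lambda>t. x + s *\<^sub>R u + t *\<^sub>R v" and x=t, OF _ l]) (auto intro!: derivative_eq_intros)
    moreover have "frechet_derivative df (at (x + s *\<^sub>R u + t *\<^sub>R v)) (k *\<^sub>R v) =
        k * frechet_derivative df (at (x + s *\<^sub>R u + t *\<^sub>R v)) v" for k
      using linear_cmul[OF has_derivative_linear[OF l]] by simp
    ultimately show ?thesis by (simp add: has_field_derivative_def mult_commute_abs)
  qed
  \<comment> \<open>The second difference is the increment in s of the increment over
    \<open>h *\<^sub>R v\<close>. The mean value theorem in s, and then in t for the resulting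
    difference of \<open>df\<close>, produces the mixed derivative at an intermediate point.\<close>
  have "\<exists>s>0. s < h \<and>
    (f (x + h *\<^sub>R u + h *\<^sub>R v) - f (x + h *\<^sub>R u + 0 *\<^sub>R v)) - (f (x + 0 *\<^sub>R u + h *\<^sub>R v) - f (x + 0 *\<^sub>R u + 0 *\<^sub>R v)) =
       (h - 0) * (df (x + s *\<^sub>R u + h *\<^sub>R v) - df (x + s *\<^sub>R u + 0 *\<^sub>R v))"
    by (rule MVT2[OF h, of "\<lambda>s. f (x + s *\<^sub>R u + h *\<^sub>R v) - f (x + s *\<^sub>R u + 0 *\<^sub>R v)"])
      (rule DERIV_diff[OF d d]; use h in simp)
  then obtain s where s: "0 < s" "s < h"
    "(f (x + h *\<^sub>R u + h *\<^sub>R v) - f (x + h *\<^sub>R u + 0 *\<^sub>R v)) - (f (x + 0 *\<^sub>R u + h *\<^sub>R v) - f (x + 0 *\<^sub>R u + 0 *\<^sub>R v)) =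
       (h - 0) * (df (x + s *\<^sub>R u + h *\<^sub>R v) - df (x + s *\<^sub>R u + 0 *\<^sub>R v))"
    by blast
  have "\<exists>t>0. t < h \<and> df (x + s *\<^sub>R u + h *\<^sub>R v) - df (x + s *\<^sub>R u + 0 *\<^sub>R v) =
       (h - 0) * frechet_derivative df (at (x + s *\<^sub>R u + t *\<^sub>R v)) v"
    by (rule MVT2[OF h, of "\<lambda>t. df (x + s *\<^sub>R u + t *\<^sub>R v)"])
      (rule d'; use s(1,2) in simp)
  then obtain t where t: "0 < t" "t < h"
    "df (x + s *\<^sub>R u + h *\<^sub>R v) - df (x + s *\<^sub>R u + 0 *\<^sub>R v) =
       (h - 0) * frechet_derivative df (at (x + s *\<^sub>R u + t *\<^sub>R v)) v"
    by blast
  show ?thesis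
    by (rule that[OF s(1,2) t(1,2)]) (use s(3) t(3) in \<open>simp add: df_def\<close>)
qed

text \<open>The second difference is symmetric in u and v, and it equals h * h times either mixed
  derivative at a suitable intermediate point. So the two mixed derivatives take a common value at
  points close to x, which contradicts their continuity if they differ at x.\<close>

lemma second_derivative_symmetric:
  fixes f :: "'v::real_normed_vector \<Rightarrow> real"
  assumes "open S" "x \<in> S" and f: "smooth_on S f"
  shows "frechet_derivative (\<lambda>y. frechet_derivative f (at y) u) (at x) v =
    frechet_derivative (\<lambda>y. frechet_derivative f (at y) v) (at x) u" (is "?P x = ?Q x")
proof (rule ccontr)
  assume ne: "?P x \<noteq> ?Q x"
  \<comment> \<open>Half of the gap: two deviations smaller than e cannot bridge it.\<close>
  define e where "e = \<bar>?P x - ?Q x\<bar> / 2"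
  have e: "e > 0" using ne by (simp add: e_def)
  have "continuous_on S ?P" "continuous_on S ?Q"
    by (intro smooth_on_imp_continuous_on smooth_on_frechet_derivative f)+
  then have cont: "isCont ?P x" "isCont ?Q x"
    using assms(1,2) by (auto simp: continuous_on_eq_continuous_at)
  obtain d1 where d1: "d1 > 0" "\<And>y. dist y x < d1 \<Longrightarrow> \<bar>?P y - ?P x\<bar> < e"
    using cont(1) e unfolding continuous_at_eps_delta by (auto simp: dist_real_def)
  obtain d2 where d2: "d2 > 0" "\<And>y. dist y x < d2 \<Longrightarrow> \<bar>?Q y - ?Q x\<bar> < e"
    using cont(2) e unfolding continuous_at_eps_delta by (auto simp: dist_real_def)
  obtain d3 where d3: "d3 > 0" "\<And>y. dist y x < d3 \<Longrightarrow> y \<in> S"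
    using assms(1,2) unfolding open_dist by blast
  define d where "d = min d1 (min d2 d3)"
  have d: "d > 0" using d1 d2 d3 by (simp add: d_def)
  \<comment> \<open>Small enough to keep the parallelogram with sides \<open>h *\<^sub>R u\<close>
    and \<open>h *\<^sub>R v\<close> within distance d of x; the summand 1 covers u = v = 0.\<close>
  define h where "h = d / (2 * (norm u + norm v + 1))"
  have n: "norm u + norm v + 1 > 0" by (smt (verit) norm_ge_zero)
  have h: "h > 0" using d n by (simp add: h_def)
  have hd: "h * (norm u + norm v) < d"
  proof -
    have "h * (norm u + norm v + 1) = d / 2" using n by (simp add: h_def field_simps)
    then show ?thesis using h d by (simp add: distrib_left)
  qed
  have near: "dist (x + s *\<^sub>R a + t *\<^sub>R b) x < d"
    if "0 \<le> s" "s \<le> h" "0 \<le> t" "t \<le> h" "{a, b} = {u, v}" for s t a b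
  proof -
    have "dist (x + s *\<^sub>R a + t *\<^sub>R b) x = norm (s *\<^sub>R a + t *\<^sub>R b)"
      by (simp add: dist_norm add.assoc)
    also have "\<dots> \<le> s * norm a + t * norm b"
      using that norm_triangle_ineq[of "s *\<^sub>R a" "t *\<^sub>R b"] by simp
    also have "\<dots> \<le> h * norm a + h * norm b"
      using that by (intro add_mono mult_right_mono) auto
    also have "\<dots> = h * (norm u + norm v)"
      using that(5) by (auto simp: doubleton_eq_iff algebra_simps)
    finally show ?thesis using hd by simp
  qed
  have inS: "x + s *\<^sub>R a + t *\<^sub>R b \<in> S"
    if "0 \<le> s" "s \<le> h" "0 \<le> t" "t \<le> h" "{a, b} = {u, v}" for s t a b
    using near[OF that] d3(2) by (simp add: d_def)
  obtain s t where st: "0 < s" "s < h" "0 < t" "t < h"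
    "f (x + h *\<^sub>R u + h *\<^sub>R v) - f (x + h *\<^sub>R u) - f (x + h *\<^sub>R v) + f x =
      h * h * ?P (x + s *\<^sub>R u + t *\<^sub>R v)"
    using second_difference_mean_value[OF f h, of x u v] inS by blast
  obtain s' t' where st': "0 < s'" "s' < h" "0 < t'" "t' < h"
    "f (x + h *\<^sub>R v + h *\<^sub>R u) - f (x + h *\<^sub>R v) - f (x + h *\<^sub>R u) + f x =
      h * h * ?Q (x + s' *\<^sub>R v + t' *\<^sub>R u)"
    using second_difference_mean_value[OF f h, of x v u] inS by blast
  have "h * h * ?P (x + s *\<^sub>R u + t *\<^sub>R v) = h * h * ?Q (x + s' *\<^sub>R v + t' *\<^sub>R u)"
    using st(5) st'(5) by (simp add: algebra_simps)
  then have eq: "?P (x + s *\<^sub>R u + t *\<^sub>R v) = ?Q (x + s' *\<^sub>R v + t' *\<^sub>R u)"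
    using h by simp
  have "\<bar>?P (x + s *\<^sub>R u + t *\<^sub>R v) - ?P x\<bar> < e"
    using near[of s t u v] st d1(2) by (simp add: d_def)
  moreover have "\<bar>?Q (x + s' *\<^sub>R v + t' *\<^sub>R u) - ?Q x\<bar> < e"
    using near[of s' t' v u] st' d2(2) by (simp add: d_def insert_commute)
  ultimately have "\<bar>?P x - ?Q x\<bar> < 2 * e" using eq by linarith
  then show False by (simp add: e_def)
qed

section \<open>Smooth maps between manifolds\<close>

definition manifold :: "('a::topological_space, 'v::real_inner) atlas \<Rightarrow> bool" where
  "manifold A \<longleftrightarrow> smooth_atlas A \<and> (\<exists>B::'v set. finite_frame B)"

text \<open>The germ version of \<open>smooth_map_on\<close>: composition, pairing and change of
  representative become rules at a point, with no open sets to carry along.\<close>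

definition smooth_at ::
  "('a::topological_space, 'v::real_inner) atlas \<Rightarrow> ('b::topological_space, 'w::real_inner) atlas
     \<Rightarrow> 'a \<Rightarrow> ('a \<Rightarrow> 'b) \<Rightarrow> bool" where
  "smooth_at A B p F \<longleftrightarrow> (\<exists>S. open S \<and> p \<in> S \<and> smooth_map_on A B S F)"

lemma smooth_near_iff_smooth_at: "smooth_near A p f \<longleftrightarrow> smooth_at A model_atlas p f"
  by (simp add: smooth_near_def smooth_at_def smooth_fun_on_def)

lemma manifold_chart:
  assumes "manifold A" "(U, \<phi>) \<in> A"
  shows "open U" "open (\<phi> ` U)" "inj_on \<phi> U" "continuous_on U \<phi>" "continuous_on (\<phi> ` U) (inv_into U \<phi>)"
proof -
  have h: "open U \<and> open (\<phi> ` U) \<and> homeomorphism U (\<phi> ` U) \<phi> (inv_into U \<phi>)"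
    using assms unfolding manifold_def smooth_atlas_def by blast
  then show "open U" "open (\<phi> ` U)" "continuous_on U \<phi>" "continuous_on (\<phi> ` U) (inv_into U \<phi>)"
    by (auto simp: homeomorphism_def)
  show "inj_on \<phi> U"
    using h by (metis homeomorphism_apply1 inj_on_inverseI)
qed

lemma manifold_chart_at:
  assumes "manifold A"
  obtains U \<phi> where "(U, \<phi>) \<in> A" "p \<in> U"
proof -
  have "p \<in> (\<Union>(U, \<phi>)\<in>A. U)"
    using assms by (auto simp: manifold_def smooth_atlas_def)
  then show ?thesis using that by auto
qed

lemma manifold_transition:
  "manifold A \<Longrightarrow> (U, \<phi>) \<in> A \<Longrightarrow> (V, \<psi>) \<in> A \<Longrightarrow> smooth_on (\<phi> ` (U \<inter> V)) (\<psi> \<circ> inv_into U \<phi>)"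
  unfolding manifold_def smooth_atlas_def by blast

lemma manifold_frame:
  fixes A :: "('a::topological_space, 'v::real_inner) atlas"
  assumes "manifold A"
  obtains B :: "'v set" where "finite_frame B"
  using assms unfolding manifold_def by blast

lemma open_chart_image:
  assumes "manifold A" "(U, \<phi>) \<in> A" "open W" "W \<subseteq> U"
  shows "open (\<phi> ` W)"
proof -
  note c = manifold_chart[OF assms(1,2)]
  have "\<phi> ` W = \<phi> ` U \<inter> inv_into U \<phi> -` W"
    using assms(4) c(3) by (auto simp: inv_into_f_f subset_iff)
  then show ?thesis
    using continuous_openin_preimage_gen[OF c(5) assms(3)] c(2)
    by (metis openin_open_eq)
qed

lemma smooth_at_chart_imp:
  fixes A :: "('a::topological_space, 'v::real_inner) atlas" and B :: "('b::topological_space, 'w::real_inner) atlas"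
  assumes "manifold A" "manifold B" and chA: "(U, \<phi>) \<in> A" "p \<in> U"
    and chB: "(V, \<psi>) \<in> B" "F p \<in> V" and "smooth_at A B p F"
  obtains W where "open W" "p \<in> W" "W \<subseteq> U" "F ` W \<subseteq> V" "continuous_on W F"
    "smooth_on (\<phi> ` W) (\<psi> \<circ> F \<circ> inv_into U \<phi>)"
proof -
  obtain S where S: "open S" "p \<in> S" "smooth_map_on A B S F"
    using assms(7) unfolding smooth_at_def by blast
  have c: "continuous_on S F" using S(3) by (simp add: smooth_map_on_def)
  have "open (U \<inter> S \<inter> F -` V)"
    using continuous_open_preimage[OF c S(1) manifold_chart(1)[OF assms(2) chB(1)]]
      manifold_chart(1)[OF assms(1) chA(1)] by (simp add: Int_assoc open_Int)
  moreover have "smooth_on (\<phi> ` (U \<inter> S \<inter> F -` V)) (\<psi> \<circ> F \<circ> inv_into U \<phi>)"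
    using S(3) chA(1) chB(1) unfolding smooth_map_on_def by blast
  ultimately show ?thesis
    by (intro that[of "U \<inter> S \<inter> F -` V"] continuous_on_subset[OF c]) (use S(2) chA(2) chB(2) in auto)
qed

text \<open>One pair of charts suffices: every other local expression is the given one composed with
  transition maps on both sides. Continuity, which \<open>smooth_map_on\<close> demands separately,
  is recovered by applying the inverse chart to the local expression.\<close>

lemma smooth_at_chartI:
  fixes A :: "('a::topological_space, 'v::real_inner) atlas" and B :: "('b::topological_space, 'w::real_inner) atlas"
  assumes "manifold A" "manifold B" and chA: "(U, \<phi>) \<in> A" and chB: "(V, \<psi>) \<in> B"
    and W: "open W" "p \<in> W" "W \<subseteq> U" "F ` W \<subseteq> V"
    and sm: "smooth_on (\<phi> ` W) (\<psi> \<circ> F \<circ> inv_into U \<phi>)"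
  shows "smooth_at A B p F"
proof -
  note cA = manifold_chart[OF assms(1) chA] and cB = manifold_chart[OF assms(2) chB]
  have cont: "continuous_on W F"
  proof -
    have "continuous_on W (\<lambda>q. inv_into V \<psi> ((\<psi> \<circ> F \<circ> inv_into U \<phi>) (\<phi> q)))"
      using W(3,4) cA(3)
      by (intro continuous_on_compose2[OF cB(5)] continuous_on_compose2[OF smooth_on_imp_continuous_on[OF sm]]
          continuous_on_subset[OF cA(4)]) (auto simp: inv_into_f_f subset_iff)
    then show ?thesis
      by (rule continuous_on_eq) (use W(3,4) cA(3) cB(3) in \<open>auto simp: inv_into_f_f subset_iff image_subset_iff\<close>)
  qed
  obtain BA where BA: "finite_frame (BA::'v set)" using manifold_frame[OF assms(1)] .
  obtain BB where BB: "finite_frame (BB::'w set)" using manifold_frame[OF assms(2)] .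
  have "smooth_on (\<phi>' ` (U' \<inter> W \<inter> F -` V')) (\<psi>' \<circ> F \<circ> inv_into U' \<phi>')"
    if ch': "(U', \<phi>') \<in> A" "(V', \<psi>') \<in> B" for U' \<phi>' V' \<psi>'
  proof -
    note cA' = manifold_chart[OF assms(1) ch'(1)] and cB' = manifold_chart[OF assms(2) ch'(2)]
    let ?W = "U' \<inter> W \<inter> F -` V'"
    have "open (W \<inter> F -` V')" using continuous_open_preimage[OF cont W(1) cB'(1)] .
    then have oW: "open ?W" using cA'(1) by (simp add: Int_assoc open_Int)
    have o1: "open (\<phi>' ` ?W)" by (rule open_chart_image[OF assms(1) ch'(1) oW]) auto
    have o2: "open (\<phi> ` W)" by (rule open_chart_image[OF assms(1) chA W(1,3)])
    have o3: "open (\<psi> ` (V \<inter> V'))"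
      by (rule open_chart_image[OF assms(2) chB]) (use cB(1) cB'(1) in auto)
    have oW2: "open (\<phi> ` ?W)" by (rule open_chart_image[OF assms(1) chA oW]) (use W(3) in auto)
    have 1: "smooth_on (\<phi> ` ?W) (\<lambda>x. (\<psi>' \<circ> inv_into V \<psi>) ((\<psi> \<circ> F \<circ> inv_into U \<phi>) x))"
    proof (rule smooth_on_comp[OF BB oW2 o3 _ manifold_transition[OF assms(2) chB ch'(2)]])
      show "smooth_on (\<phi> ` ?W) (\<psi> \<circ> F \<circ> inv_into U \<phi>)"
        by (rule smooth_on_subset[OF sm]) auto
      show "(\<psi> \<circ> F \<circ> inv_into U \<phi>) ` \<phi> ` ?W \<subseteq> \<psi> ` (V \<inter> V')"
        using W(3,4) cA(3) by (force simp: inv_into_f_f subset_iff image_subset_iff)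
    qed
    have 2: "smooth_on (\<phi>' ` ?W) (\<lambda>x. (\<psi>' \<circ> inv_into V \<psi>) ((\<psi> \<circ> F \<circ> inv_into U \<phi>) ((\<phi> \<circ> inv_into U' \<phi>') x)))"
    proof (rule smooth_on_comp[OF BA o1 oW2 _ 1])
      show "smooth_on (\<phi>' ` ?W) (\<phi> \<circ> inv_into U' \<phi>')"
        by (rule smooth_on_subset[OF manifold_transition[OF assms(1) ch'(1) chA]]) (use W(3) in auto)
      show "(\<phi> \<circ> inv_into U' \<phi>') ` \<phi>' ` ?W \<subseteq> \<phi> ` ?W"
        using cA'(3) by (auto simp: inv_into_f_f)
    qed
    show ?thesis
      by (rule smooth_on_cong[OF o1 _ 2])
        (use W(3,4) cA(3) cA'(3) cB(3) in \<open>auto simp: inv_into_f_f subset_iff image_subset_iff\<close>)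
  qed
  then have "smooth_map_on A B W F"
    using cont unfolding smooth_map_on_def by blast
  then show ?thesis using W(1,2) unfolding smooth_at_def by blast
qed

lemma smooth_map_on_iff_smooth_at:
  assumes "manifold A" "manifold B" "open S"
  shows "smooth_map_on A B S F \<longleftrightarrow> (\<forall>p\<in>S. smooth_at A B p F)"
proof
  assume "smooth_map_on A B S F"
  then show "\<forall>p\<in>S. smooth_at A B p F" using assms(3) unfolding smooth_at_def by blast
next
  assume *: "\<forall>p\<in>S. smooth_at A B p F"
  have "\<exists>T. open T \<and> p \<in> T \<and> continuous_on T F" if "p \<in> S" for p
    using * that unfolding smooth_at_def smooth_map_on_def by blast
  then obtain T where T: "\<And>p. p \<in> S \<Longrightarrow> open (T p) \<and> p \<in> T p \<and> continuous_on (T p) F"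
    by metis
  have "continuous_on (\<Union>p\<in>S. T p) F"
    by (rule continuous_on_open_UN) (use T in auto)
  then have "continuous_on S F"
    by (rule continuous_on_subset) (use T in auto)
  moreover have "smooth_on (\<phi> ` (U \<inter> S \<inter> F -` V)) (\<psi> \<circ> F \<circ> inv_into U \<phi>)"
    if ch: "(U, \<phi>) \<in> A" "(V, \<psi>) \<in> B" for U \<phi> V \<psi>
  proof (rule smooth_on_local)
    fix x assume "x \<in> \<phi> ` (U \<inter> S \<inter> F -` V)"
    then obtain q where q: "x = \<phi> q" "q \<in> U" "q \<in> S" "F q \<in> V" by auto
    obtain W where W: "open W" "q \<in> W" "W \<subseteq> U" "smooth_on (\<phi> ` W) (\<psi> \<circ> F \<circ> inv_into U \<phi>)"
      using smooth_at_chart_imp[OF assms(1,2) ch(1) q(2) ch(2), of F] * q(3,4) by metis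
    then show "\<exists>T. open T \<and> x \<in> T \<and> smooth_on T (\<psi> \<circ> F \<circ> inv_into U \<phi>)"
      using q(1) open_chart_image[OF assms(1) ch(1) W(1,3)] by blast
  qed
  ultimately show "smooth_map_on A B S F" unfolding smooth_map_on_def by blast
qed

lemma smooth_map_onD:
  "manifold A \<Longrightarrow> manifold B \<Longrightarrow> open S \<Longrightarrow> smooth_map_on A B S F \<Longrightarrow> p \<in> S \<Longrightarrow> smooth_at A B p F"
  using smooth_map_on_iff_smooth_at by blast

lemma smooth_at_cong:
  assumes "manifold A" "manifold B" "smooth_at A B p F" "open S" "p \<in> S" "\<And>q. q \<in> S \<Longrightarrow> F q = G q"
  shows "smooth_at A B p G"
proof -
  obtain U \<phi> where ch: "(U, \<phi>) \<in> A" "p \<in> U" using manifold_chart_at[OF assms(1)] .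
  obtain V \<psi> where ch': "(V, \<psi>) \<in> B" "F p \<in> V" using manifold_chart_at[OF assms(2)] .
  obtain W where W: "open W" "p \<in> W" "W \<subseteq> U" "F ` W \<subseteq> V" "smooth_on (\<phi> ` W) (\<psi> \<circ> F \<circ> inv_into U \<phi>)"
    using smooth_at_chart_imp[OF assms(1,2) ch ch' assms(3)] .
  have o: "open (\<phi> ` (W \<inter> S))"
    by (rule open_chart_image[OF assms(1) ch(1)]) (use W assms(4) in auto)
  have sm: "smooth_on (\<phi> ` (W \<inter> S)) (\<psi> \<circ> G \<circ> inv_into U \<phi>)"
    by (rule smooth_on_cong[OF o _ smooth_on_subset[OF W(5)]])
      (use W(3) assms(6) manifold_chart(3)[OF assms(1) ch(1)] in \<open>auto simp: inv_into_f_f subset_iff\<close>)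
  show ?thesis
    by (rule smooth_at_chartI[OF assms(1,2) ch(1) ch'(1) _ _ _ _ sm])
      (use W assms(4-6) in \<open>auto simp: image_subset_iff\<close>)
qed

lemma smooth_at_comp:
  fixes A :: "('a::topological_space, 'v::real_inner) atlas" and B :: "('b::topological_space, 'w::real_inner) atlas"
    and C :: "('c::topological_space, 'u::real_inner) atlas"
  assumes "manifold A" "manifold B" "manifold C" "smooth_at A B p F" "smooth_at B C (F p) G"
  shows "smooth_at A C p (\<lambda>q. G (F q))"
proof -
  obtain U \<phi> where ch: "(U, \<phi>) \<in> A" "p \<in> U" using manifold_chart_at[OF assms(1)] .
  obtain V \<psi> where ch': "(V, \<psi>) \<in> B" "F p \<in> V" using manifold_chart_at[OF assms(2)] .
  obtain T \<theta> where ch'': "(T, \<theta>) \<in> C" "G (F p) \<in> T" using manifold_chart_at[OF assms(3)] .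
  obtain W where W: "open W" "p \<in> W" "W \<subseteq> U" "F ` W \<subseteq> V" "continuous_on W F"
      "smooth_on (\<phi> ` W) (\<psi> \<circ> F \<circ> inv_into U \<phi>)"
    using smooth_at_chart_imp[OF assms(1,2) ch ch' assms(4)] .
  obtain W' where W': "open W'" "F p \<in> W'" "W' \<subseteq> V" "G ` W' \<subseteq> T"
      "smooth_on (\<psi> ` W') (\<theta> \<circ> G \<circ> inv_into V \<psi>)"
    using smooth_at_chart_imp[OF assms(2,3) ch' ch'' assms(5)] .
  obtain BB where BB: "finite_frame (BB::'w set)" using manifold_frame[OF assms(2)] .
  let ?W = "W \<inter> F -` W'"
  have oW: "open ?W" using continuous_open_preimage[OF W(5,1) W'(1)] .
  have o: "open (\<phi> ` ?W)" by (rule open_chart_image[OF assms(1) ch(1) oW]) (use W in auto)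
  have o': "open (\<psi> ` W')" by (rule open_chart_image[OF assms(2) ch'(1) W'(1,3)])
  note i = manifold_chart(3)[OF assms(1) ch(1)] manifold_chart(3)[OF assms(2) ch'(1)]
  have "smooth_on (\<phi> ` ?W) (\<lambda>x. (\<theta> \<circ> G \<circ> inv_into V \<psi>) ((\<psi> \<circ> F \<circ> inv_into U \<phi>) x))"
    by (rule smooth_on_comp[OF BB o o' smooth_on_subset[OF W(6)] W'(5)])
      (use W(3,4) W'(3) i in \<open>auto simp: inv_into_f_f subset_iff\<close>)
  then have sm: "smooth_on (\<phi> ` ?W) (\<theta> \<circ> (\<lambda>q. G (F q)) \<circ> inv_into U \<phi>)"
    by (rule smooth_on_cong[OF o, rotated])
      (use W(3,4) W'(3) i in \<open>auto simp: inv_into_f_f subset_iff image_subset_iff\<close>)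
  show ?thesis
    by (rule smooth_at_chartI[OF assms(1,3) ch(1) ch''(1) oW _ _ _ sm]) (use W W' in auto)
qed

lemma manifold_model: "finite_frame (B::'v::real_inner set) \<Longrightarrow> manifold (model_atlas::('v,'v) atlas)"
  unfolding manifold_def smooth_atlas_def model_atlas_def homeomorphism_def
  by (auto intro: smooth_on_cong[OF open_UNIV, of id] simp: id_def inv_into_f_f)

lemma manifold_model_real: "manifold (model_atlas::(real, real) atlas)"
  by (rule manifold_model[OF finite_frame_real])

lemma smooth_at_model_iff:
  fixes F :: "'a::topological_space \<Rightarrow> 'w::real_inner"
  assumes "manifold A" "manifold (model_atlas :: ('w, 'w) atlas)" "(U, \<phi>) \<in> A" "p \<in> U"
  shows "smooth_at A model_atlas p F \<longleftrightarrow>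
    (\<exists>W. open W \<and> p \<in> W \<and> W \<subseteq> U \<and> smooth_on (\<phi> ` W) (F \<circ> inv_into U \<phi>))"
proof
  assume "smooth_at A model_atlas p F"
  then obtain W where "open W" "p \<in> W" "W \<subseteq> U" "smooth_on (\<phi> ` W) (id \<circ> F \<circ> inv_into U \<phi>)"
    by (rule smooth_at_chart_imp[OF assms(1,2,3,4), of UNIV id F, rotated 2])
      (simp_all add: model_atlas_def)
  then show "\<exists>W. open W \<and> p \<in> W \<and> W \<subseteq> U \<and> smooth_on (\<phi> ` W) (F \<circ> inv_into U \<phi>)"
    by auto
next
  assume "\<exists>W. open W \<and> p \<in> W \<and> W \<subseteq> U \<and> smooth_on (\<phi> ` W) (F \<circ> inv_into U \<phi>)"
  then obtain W where W: "open W" "p \<in> W" "W \<subseteq> U" "smooth_on (\<phi> ` W) (id \<circ> F \<circ> inv_into U \<phi>)"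
    by auto
  show "smooth_at A model_atlas p F"
    by (rule smooth_at_chartI[OF assms(1-3) _ W(1-3) _ W(4), of UNIV]) (auto simp: model_atlas_def)
qed

lemma smooth_at_model_dom:
  fixes F :: "'w::real_inner \<Rightarrow> 'b::topological_space"
  assumes "manifold A" "manifold (model_atlas :: ('w, 'w) atlas)" "(U, \<phi>) \<in> A"
    "open W" "x \<in> W" "F ` W \<subseteq> U" "smooth_on W (\<phi> \<circ> F)"
  shows "smooth_at model_atlas A x F"
  by (rule smooth_at_chartI[OF assms(2,1) _ assms(3-5), of UNIV id])
    (use assms in \<open>auto simp: model_atlas_def inv_id\<close>)

lemma smooth_at_chart_inv:
  assumes "manifold (A :: ('a::topological_space, 'v::real_inner) atlas)" "(U, \<phi>) \<in> A" "x \<in> \<phi> ` U"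
  shows "smooth_at (model_atlas :: ('v, 'v) atlas) A x (inv_into U \<phi>)"
proof -
  obtain B where "finite_frame (B::'v set)" using manifold_frame[OF assms(1)] .
  note m = manifold_model[OF this]
  note c = manifold_chart[OF assms(1,2)]
  show ?thesis
  proof (rule smooth_at_model_dom[OF assms(1) m assms(2) c(2) assms(3)])
    show "inv_into U \<phi> ` \<phi> ` U \<subseteq> U" by (auto simp: inv_into_into)
    show "smooth_on (\<phi> ` U) (\<phi> \<circ> inv_into U \<phi>)"
      by (rule smooth_on_cong[OF c(2), of id]) (auto simp: f_inv_into_f)
  qed
qed

lemma smooth_at_model_model:
  fixes F :: "'v::real_inner \<Rightarrow> 'w::real_inner"
  assumes "manifold (model_atlas :: ('v, 'v) atlas)" "manifold (model_atlas :: ('w, 'w) atlas)"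
    "open W" "x \<in> W" "smooth_on W F"
  shows "smooth_at model_atlas model_atlas x F"
  by (rule smooth_at_model_dom[OF assms(2,1) _ assms(3,4), of UNIV id])
    (use assms(5) in \<open>auto simp: model_atlas_def\<close>)

lemma smooth_at_const:
  assumes "manifold A" "manifold B"
  shows "smooth_at A B p (\<lambda>q. c)"
proof -
  obtain U \<phi> where ch: "(U, \<phi>) \<in> A" "p \<in> U" using manifold_chart_at[OF assms(1)] .
  obtain V \<psi> where ch': "(V, \<psi>) \<in> B" "c \<in> V" using manifold_chart_at[OF assms(2)] .
  have "(\<psi> \<circ> (\<lambda>q. c) \<circ> inv_into U \<phi>) = (\<lambda>x. \<psi> c)" by auto
  then show ?thesis
    using smooth_at_chartI[OF assms ch(1) ch'(1) manifold_chart(1)[OF assms(1) ch(1)] ch(2), of "\<lambda>q. c"] ch'(2)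
    by auto
qed

lemma smooth_at_id:
  assumes "manifold A"
  shows "smooth_at A A p (\<lambda>q. q)"
proof -
  obtain U \<phi> where ch: "(U, \<phi>) \<in> A" "p \<in> U" using manifold_chart_at[OF assms(1)] .
  note c = manifold_chart[OF assms(1) ch(1)]
  have "smooth_on (\<phi> ` U) (\<phi> \<circ> (\<lambda>q. q) \<circ> inv_into U \<phi>)"
    by (rule smooth_on_cong[OF c(2), of id]) (auto simp: f_inv_into_f)
  then show ?thesis
    using smooth_at_chartI[OF assms assms ch(1) ch(1) c(1) ch(2)] by auto
qed

subsection \<open>Products\<close>

lemma manifold_prod:
  fixes A :: "('a::topological_space, 'v::real_inner) atlas"
    and B :: "('b::topological_space, 'w::real_inner) atlas"
  assumes "manifold A" "manifold B"
  shows "manifold (prod_atlas A B)"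
proof -
  obtain BA where BA: "finite_frame (BA::'v set)" using manifold_frame[OF assms(1)] .
  obtain BB where BB: "finite_frame (BB::'w set)" using manifold_frame[OF assms(2)] .
  have inv: "inv_into (U \<times> V) (map_prod \<phi> \<psi>) (\<phi> p, \<psi> q) = (p, q)"
    if "(U, \<phi>) \<in> A" "(V, \<psi>) \<in> B" "p \<in> U" "q \<in> V" for U \<phi> V \<psi> p q
    using inv_into_f_f[of "map_prod \<phi> \<psi>" "U \<times> V" "(p, q)"]
      map_prod_inj_on[OF manifold_chart(3)[OF assms(1) that(1)] manifold_chart(3)[OF assms(2) that(2)]]
      that by simp
  have "open (U \<times> V) \<and> open (map_prod \<phi> \<psi> ` (U \<times> V)) \<and>
      homeomorphism (U \<times> V) (map_prod \<phi> \<psi> ` (U \<times> V)) (map_prod \<phi> \<psi>) (inv_into (U \<times> V) (map_prod \<phi> \<psi>))"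
    if ch: "(U, \<phi>) \<in> A" "(V, \<psi>) \<in> B" for U \<phi> V \<psi>
  proof (intro conjI)
    note c = manifold_chart[OF assms(1) ch(1)] and d = manifold_chart[OF assms(2) ch(2)]
    show "open (U \<times> V)" using c(1) d(1) by (rule open_Times)
    show "open (map_prod \<phi> \<psi> ` (U \<times> V))"
      using open_Times[OF c(2) d(2)] by (simp add: map_prod_surj_on[OF refl refl])
    have "continuous_on (map_prod \<phi> \<psi> ` (U \<times> V)) (\<lambda>x. (inv_into U \<phi> (fst x), inv_into V \<psi> (snd x)))"
      by (intro continuous_on_Pair continuous_on_compose2[OF c(5)] continuous_on_compose2[OF d(5)]
          continuous_intros) auto
    then have "continuous_on (map_prod \<phi> \<psi> ` (U \<times> V)) (inv_into (U \<times> V) (map_prod \<phi> \<psi>))"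
      by (rule continuous_on_eq) (use c(3) d(3) in \<open>auto simp: inv[OF ch] inv_into_f_f\<close>)
    moreover have "continuous_on (U \<times> V) (map_prod \<phi> \<psi>)"
      unfolding map_prod_def case_prod_beta
      by (intro continuous_on_Pair continuous_on_compose2[OF c(4)] continuous_on_compose2[OF d(4)]
          continuous_intros) auto
    ultimately show "homeomorphism (U \<times> V) (map_prod \<phi> \<psi> ` (U \<times> V)) (map_prod \<phi> \<psi>) (inv_into (U \<times> V) (map_prod \<phi> \<psi>))"
      unfolding homeomorphism_def
      by (auto simp: inv[OF ch]) (metis SigmaI image_eqI inv[OF ch] map_prod_simp)
  qed
  moreover have "(\<Union>(U, \<phi>)\<in>prod_atlas A B. U) = UNIV"
  proof -
    have "(p, q) \<in> (\<Union>(U, \<phi>)\<in>prod_atlas A B. U)" for p q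
    proof -
      obtain U \<phi> where ch: "(U, \<phi>) \<in> A" "p \<in> U" using manifold_chart_at[OF assms(1)] .
      obtain V \<psi> where ch': "(V, \<psi>) \<in> B" "q \<in> V" using manifold_chart_at[OF assms(2)] .
      have "(U \<times> V, map_prod \<phi> \<psi>) \<in> prod_atlas A B"
        using ch(1) ch'(1) by (auto simp: prod_atlas_def)
      then show ?thesis using ch(2) ch'(2) by blast
    qed
    then show ?thesis by auto
  qed
  moreover have "smooth_on (map_prod \<phi> \<psi> ` (U \<times> V \<inter> U' \<times> V'))
      (map_prod \<phi>' \<psi>' \<circ> inv_into (U \<times> V) (map_prod \<phi> \<psi>))"
    if ch: "(U, \<phi>) \<in> A" "(V, \<psi>) \<in> B" and ch': "(U', \<phi>') \<in> A" "(V', \<psi>') \<in> B" for U \<phi> V \<psi> U' \<phi>' V' \<psi>'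
  proof -
    note c = manifold_chart[OF assms(1) ch(1)] and d = manifold_chart[OF assms(2) ch(2)]
    note c' = manifold_chart[OF assms(1) ch'(1)] and d' = manifold_chart[OF assms(2) ch'(2)]
    have o: "open (\<phi> ` (U \<inter> U'))" "open (\<psi> ` (V \<inter> V'))"
      by (rule open_chart_image[OF assms(1) ch(1)] open_chart_image[OF assms(2) ch(2)];
          use c(1) d(1) c'(1) d'(1) in auto)+
    have eq: "map_prod \<phi> \<psi> ` (U \<times> V \<inter> U' \<times> V') = \<phi> ` (U \<inter> U') \<times> \<psi> ` (V \<inter> V')"
      by (force simp: image_iff)
    have o2: "open (map_prod \<phi> \<psi> ` (U \<times> V \<inter> U' \<times> V'))" unfolding eq by (rule open_Times[OF o])
    have "smooth_on (map_prod \<phi> \<psi> ` (U \<times> V \<inter> U' \<times> V'))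
        (\<lambda>x. ((\<phi>' \<circ> inv_into U \<phi>) (fst x), (\<psi>' \<circ> inv_into V \<psi>) (snd x)))"
      by (intro smooth_on_Pair o2 smooth_on_comp[OF BA o2 o(1) _ manifold_transition[OF assms(1) ch(1) ch'(1)]]
          smooth_on_comp[OF BB o2 o(2) _ manifold_transition[OF assms(2) ch(2) ch'(2)]]
          smooth_on_bounded_linear bounded_linear_fst bounded_linear_snd) auto
    then show ?thesis
      by (rule smooth_on_cong[OF o2, rotated])
        (use c(3) d(3) in \<open>auto simp: inv[OF ch] inv_into_f_f\<close>)
  qed
  ultimately show ?thesis
    using finite_frame_prod[OF BA BB] unfolding manifold_def smooth_atlas_def
    by (auto simp: prod_atlas_def)
qed

lemma prod_atlas_inv:
  assumes "manifold A" "manifold B" "(U, \<phi>) \<in> A" "(V, \<psi>) \<in> B" "p \<in> U" "q \<in> V"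
  shows "inv_into (U \<times> V) (map_prod \<phi> \<psi>) (\<phi> p, \<psi> q) = (p, q)"
  using inv_into_f_f[of "map_prod \<phi> \<psi>" "U \<times> V" "(p, q)"]
    map_prod_inj_on[OF manifold_chart(3)[OF assms(1,3)] manifold_chart(3)[OF assms(2,4)]] assms by simp

lemma smooth_at_Pair:
  assumes "manifold A" "manifold B" "manifold C" "smooth_at A B p F" "smooth_at A C p G"
  shows "smooth_at A (prod_atlas B C) p (\<lambda>q. (F q, G q))"
proof -
  obtain U \<phi> where ch: "(U, \<phi>) \<in> A" "p \<in> U" using manifold_chart_at[OF assms(1)] .
  obtain V \<psi> where ch': "(V, \<psi>) \<in> B" "F p \<in> V" using manifold_chart_at[OF assms(2)] .
  obtain T \<theta> where ch'': "(T, \<theta>) \<in> C" "G p \<in> T" using manifold_chart_at[OF assms(3)] .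
  obtain W where W: "open W" "p \<in> W" "W \<subseteq> U" "F ` W \<subseteq> V" "continuous_on W F"
      "smooth_on (\<phi> ` W) (\<psi> \<circ> F \<circ> inv_into U \<phi>)"
    using smooth_at_chart_imp[OF assms(1,2) ch ch' assms(4)] .
  obtain W' where W': "open W'" "p \<in> W'" "W' \<subseteq> U" "G ` W' \<subseteq> T"
      "smooth_on (\<phi> ` W') (\<theta> \<circ> G \<circ> inv_into U \<phi>)"
    using smooth_at_chart_imp[OF assms(1,3) ch ch'' assms(5)] .
  have o: "open (\<phi> ` (W \<inter> W'))"
    by (rule open_chart_image[OF assms(1) ch(1)]) (use W W' in auto)
  have "smooth_on (\<phi> ` (W \<inter> W')) (\<lambda>x. ((\<psi> \<circ> F \<circ> inv_into U \<phi>) x, (\<theta> \<circ> G \<circ> inv_into U \<phi>) x))"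
    by (rule smooth_on_Pair[OF o smooth_on_subset[OF W(6)] smooth_on_subset[OF W'(5)]]) auto
  then have sm: "smooth_on (\<phi> ` (W \<inter> W')) (map_prod \<psi> \<theta> \<circ> (\<lambda>q. (F q, G q)) \<circ> inv_into U \<phi>)"
    by (simp add: comp_def)
  show ?thesis
    by (rule smooth_at_chartI[OF assms(1) manifold_prod[OF assms(2,3)] ch(1) _ _ _ _ _ sm, where V="V \<times> T"])
      (use W W' ch'(1) ch''(1) in \<open>auto simp: prod_atlas_def\<close>)
qed

subsection \<open>Germs of smooth functions\<close>

lemma smooth_near_iff:
  assumes "manifold A" "(U, \<phi>) \<in> A" "p \<in> U"
  shows "smooth_near A p f \<longleftrightarrow>
    (\<exists>W. open W \<and> p \<in> W \<and> W \<subseteq> U \<and> smooth_on (\<phi> ` W) (f \<circ> inv_into U \<phi>))"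
  unfolding smooth_near_iff_smooth_at by (rule smooth_at_model_iff[OF assms(1) manifold_model_real assms(2,3)])

lemma smooth_fun_on_iff:
  "manifold A \<Longrightarrow> open S \<Longrightarrow> smooth_fun_on A S f \<longleftrightarrow> (\<forall>p\<in>S. smooth_near A p f)"
  by (simp add: smooth_fun_on_def smooth_map_on_iff_smooth_at manifold_model_real smooth_near_iff_smooth_at)

lemma smooth_near_nhd:
  assumes "manifold A" "smooth_near A p f"
  shows "\<exists>S. open S \<and> p \<in> S \<and> (\<forall>q\<in>S. smooth_near A q f)"
  using assms smooth_fun_on_iff unfolding smooth_near_def by blast

lemma smooth_near_cong:
  "manifold A \<Longrightarrow> smooth_near A p f \<Longrightarrow> open S \<Longrightarrow> p \<in> S \<Longrightarrow> (\<And>q. q \<in> S \<Longrightarrow> f q = g q) \<Longrightarrow> smooth_near A p g"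
  unfolding smooth_near_iff_smooth_at by (rule smooth_at_cong[OF _ manifold_model_real])

lemma smooth_near_comp:
  "manifold A \<Longrightarrow> manifold B \<Longrightarrow> smooth_at A B p F \<Longrightarrow> smooth_near B (F p) f \<Longrightarrow> smooth_near A p (\<lambda>q. f (F q))"
  unfolding smooth_near_iff_smooth_at by (rule smooth_at_comp[OF _ _ manifold_model_real])

lemma smooth_near_const: "manifold A \<Longrightarrow> smooth_near A p (\<lambda>q. c)"
  unfolding smooth_near_iff_smooth_at by (rule smooth_at_const[OF _ manifold_model_real])

lemma smooth_near_arith:
  assumes "manifold A" "smooth_near A p f" "smooth_near A p g"
  shows smooth_near_add: "smooth_near A p (\<lambda>q. f q + g q)"
    and smooth_near_mult: "smooth_near A p (\<lambda>q. f q * g q)"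
proof -
  obtain U \<phi> where ch: "(U, \<phi>) \<in> A" "p \<in> U" using manifold_chart_at[OF assms(1)] .
  obtain W where W: "open W" "p \<in> W" "W \<subseteq> U" "smooth_on (\<phi> ` W) (f \<circ> inv_into U \<phi>)"
    using assms(2) smooth_near_iff[OF assms(1) ch] by blast
  obtain W' where W': "open W'" "p \<in> W'" "W' \<subseteq> U" "smooth_on (\<phi> ` W') (g \<circ> inv_into U \<phi>)"
    using assms(3) smooth_near_iff[OF assms(1) ch] by blast
  have o: "open (\<phi> ` (W \<inter> W'))"
    by (rule open_chart_image[OF assms(1) ch(1)]) (use W W' in auto)
  have s: "smooth_on (\<phi> ` (W \<inter> W')) (f \<circ> inv_into U \<phi>)" "smooth_on (\<phi> ` (W \<inter> W')) (g \<circ> inv_into U \<phi>)"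
    by (rule smooth_on_subset[OF W(4)] smooth_on_subset[OF W'(4)]; blast)+
  have W2: "open (W \<inter> W')" "p \<in> W \<inter> W'" "W \<inter> W' \<subseteq> U" using W W' by auto
  show "smooth_near A p (\<lambda>q. f q + g q)" "smooth_near A p (\<lambda>q. f q * g q)"
    unfolding smooth_near_iff[OF assms(1) ch]
    using W2 smooth_on_add[OF o s] smooth_on_mult[OF o s] by (auto simp: comp_def)
qed

lemma smooth_near_cmult: "manifold A \<Longrightarrow> smooth_near A p f \<Longrightarrow> smooth_near A p (\<lambda>q. c * f q)"
  by (intro smooth_near_mult smooth_near_const)

lemma smooth_near_minus: "manifold A \<Longrightarrow> smooth_near A p f \<Longrightarrow> smooth_near A p (\<lambda>q. - f q)"
  using smooth_near_cmult[of A p f "-1"] by simp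

lemma smooth_near_diff:
  "manifold A \<Longrightarrow> smooth_near A p f \<Longrightarrow> smooth_near A p g \<Longrightarrow> smooth_near A p (\<lambda>q. f q - g q)"
  using smooth_near_add[of A p f "\<lambda>q. - g q"] smooth_near_minus by auto

lemma smooth_near_sum:
  "manifold A \<Longrightarrow> (\<And>i. i \<in> I \<Longrightarrow> smooth_near A p (f i)) \<Longrightarrow> smooth_near A p (\<lambda>q. \<Sum>i\<in>I. f i q)"
  by (induction I rule: infinite_finite_induct) (auto intro: smooth_near_add smooth_near_const)

section \<open>Tangent vectors\<close>

text \<open>The derivation that belongs to the coordinate vector v. The value 0 on germs that are
  not smooth is the same default as in \<open>velocity\<close>, so that the two can be equal as
  functions.\<close>

definition chart_vector ::
  "('a::topological_space, 'v::real_inner) atlas \<Rightarrow> 'a set \<Rightarrow> ('a \<Rightarrow> 'v) \<Rightarrow> 'a \<Rightarrow> 'v \<Rightarrow> 'a tangent" where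
  "chart_vector A U \<phi> p v =
     (\<lambda>f. if smooth_near A p f then frechet_derivative (f \<circ> inv_into U \<phi>) (at (\<phi> p)) v else 0)"

lemma smooth_near_chart_differentiable:
  assumes "manifold A" "(U, \<phi>) \<in> A" "p \<in> U" "smooth_near A p f"
  shows "(f \<circ> inv_into U \<phi>) differentiable (at (\<phi> p))"
proof -
  obtain W where W: "open W" "p \<in> W" "W \<subseteq> U" "smooth_on (\<phi> ` W) (f \<circ> inv_into U \<phi>)"
    using assms(4) smooth_near_iff[OF assms(1-3)] by blast
  show ?thesis
    by (rule smooth_on_imp_differentiable[OF W(4)]) (use W(2) in auto)
qed

lemma chart_vector_linear:
  assumes "manifold A" "(U, \<phi>) \<in> A" "p \<in> U"
  shows "chart_vector A U \<phi> p (v + w) = chart_vector A U \<phi> p v + chart_vector A U \<phi> p w"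
    and "chart_vector A U \<phi> p (c *\<^sub>R v) = c *\<^sub>R chart_vector A U \<phi> p v"
  using linear_frechet_derivative[OF smooth_near_chart_differentiable[OF assms]]
  by (auto simp: chart_vector_def fun_eq_iff scaleR_fun_def linear_add linear_cmul)

text \<open>It is the velocity of the curve that is the straight line through
  \<open>\<phi> p\<close> with direction v in the chart; as the chart has open image, the line stays
  inside for small times.\<close>

lemma chart_vector_in_tangent_space:
  fixes A :: "('a::topological_space, 'v::real_inner) atlas"
  assumes "manifold A" "(U, \<phi>) \<in> A" "p \<in> U"
  shows "chart_vector A U \<phi> p v \<in> tangent_space A p"
proof -
  obtain B where "finite_frame (B::'v set)" using manifold_frame[OF assms(1)] .
  note m = manifold_model[OF this]
  note ch = manifold_chart[OF assms(1,2)]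
  define l where "l = (\<lambda>t::real. \<phi> p + t *\<^sub>R v)"
  define c where "c = (\<lambda>t. inv_into U \<phi> (l t))"
  have l: "smooth_on UNIV l" unfolding l_def
    by (intro smooth_on_add smooth_on_const smooth_on_bounded_linear bounded_linear_scaleR_left open_UNIV)
  have "open (l -` (\<phi> ` U))"
    using continuous_open_preimage[OF smooth_on_imp_continuous_on[OF l] open_UNIV ch(2)] by simp
  moreover have "0 \<in> l -` (\<phi> ` U)" using assms(3) by (simp add: l_def)
  ultimately obtain e where "e > 0" "\<And>t. dist t 0 < e \<Longrightarrow> t \<in> l -` (\<phi> ` U)"
    unfolding open_dist by blast
  then have e: "e > 0" "\<And>t. \<bar>t\<bar> < e \<Longrightarrow> l t \<in> \<phi> ` U"
    by (auto simp: dist_real_def)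
  have c0: "c 0 = p" using assms(3) ch(3) by (simp add: c_def l_def inv_into_f_f)
  have "smooth_at model_atlas A t c" if "t \<in> {-e<..<e}" for t
    unfolding c_def
    by (rule smooth_at_comp[OF manifold_model_real m assms(1)])
      (use that in \<open>auto intro!: smooth_at_model_model[OF manifold_model_real m open_UNIV _ l]
        smooth_at_chart_inv[OF assms(1,2)] e(2)\<close>)
  then have sm: "smooth_map_on model_atlas A {-e<..<e} c"
    by (simp add: smooth_map_on_iff_smooth_at[OF manifold_model_real assms(1)])
  have "velocity A c = chart_vector A U \<phi> p v"
  proof (rule ext)
    fix f
    show "velocity A c f = chart_vector A U \<phi> p v f"
    proof (cases "smooth_near A p f")
      case True
      let ?D = "frechet_derivative (f \<circ> inv_into U \<phi>) (at (\<phi> p))"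
      have D: "((f \<circ> inv_into U \<phi>) has_derivative ?D) (at (\<phi> p))"
        using smooth_near_chart_differentiable[OF assms True] by (simp add: frechet_derivative_works)
      have l': "(l has_derivative (\<lambda>t. t *\<^sub>R v)) (at 0)"
        unfolding l_def by (auto intro!: derivative_eq_intros)
      have l0: "l 0 = \<phi> p" by (simp add: l_def)
      have "((\<lambda>t. (f \<circ> inv_into U \<phi>) (l t)) has_derivative (\<lambda>t. ?D (t *\<^sub>R v))) (at 0)"
        by (rule has_derivative_compose[OF l']) (unfold l0, rule D)
      moreover have "(\<lambda>t. ?D (t *\<^sub>R v)) = (*) (?D v)"
        using linear_cmul[OF has_derivative_linear[OF D]] by (simp add: fun_eq_iff)
      ultimately have "((\<lambda>t. f (c t)) has_real_derivative ?D v) (at 0)"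
        by (simp add: c_def has_field_derivative_def)
      then show ?thesis
        using True c0 by (simp add: velocity_def chart_vector_def DERIV_imp_deriv)
    qed (simp add: velocity_def chart_vector_def c0)
  qed
  then show ?thesis
    using c0 e(1) sm unfolding tangent_space_def mem_Collect_eq by (intro exI[of _ c]) auto
qed

text \<open>This is the source of the linear structure: a sum of velocities of curves is not visibly
  a velocity, but chart vectors depend linearly on the coordinate vector.\<close>

lemma tangent_space_eq_chart_vectors:
  fixes A :: "('a::topological_space, 'v::real_inner) atlas"
  assumes "manifold A" "(U, \<phi>) \<in> A" "p \<in> U"
  shows "tangent_space A p = range (chart_vector A U \<phi> p)"
proof
  show "range (chart_vector A U \<phi> p) \<subseteq> tangent_space A p"
    using chart_vector_in_tangent_space[OF assms] by auto
  show "tangent_space A p \<subseteq> range (chart_vector A U \<phi> p)"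
  proof
    fix u assume "u \<in> tangent_space A p"
    then obtain c e where c: "u = velocity A c" "c 0 = p" "e > 0" "smooth_map_on model_atlas A {-e<..<e} c"
      by (auto simp: tangent_space_def)
    have id: "(UNIV, id) \<in> (model_atlas::(real, real) atlas)" by (simp add: model_atlas_def)
    have "smooth_at model_atlas A 0 c"
      using smooth_map_onD[OF manifold_model_real assms(1) _ c(4), of 0] c(3) by simp
    then obtain W where "open W" "0 \<in> W" "c ` W \<subseteq> U"
        "smooth_on (id ` W) (\<phi> \<circ> c \<circ> inv_into UNIV id)"
      using c(2) assms(3)
      by (auto elim: smooth_at_chart_imp[OF manifold_model_real assms(1) id UNIV_I assms(2)])
    then have W: "open W" "0 \<in> W" "c ` W \<subseteq> U" "smooth_on W (\<phi> \<circ> c)"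
      by simp_all
    define k where "k = frechet_derivative (\<phi> \<circ> c) (at 0)"
    have k: "((\<phi> \<circ> c) has_derivative k) (at 0)"
      using smooth_on_imp_differentiable[OF W(4,2)] by (simp add: k_def frechet_derivative_works)
    \<comment> \<open>\<open>k 1\<close> is the velocity of the curve read in the chart; the chain
      rule for f in the chart composed with this coordinate curve gives the equality.\<close>
    have "velocity A c = chart_vector A U \<phi> p (k 1)"
    proof (rule ext)
      fix f
      show "velocity A c f = chart_vector A U \<phi> p (k 1) f"
      proof (cases "smooth_near A p f")
        case True
        let ?D = "frechet_derivative (f \<circ> inv_into U \<phi>) (at (\<phi> p))"
        have D: "((f \<circ> inv_into U \<phi>) has_derivative ?D) (at ((\<phi> \<circ> c) 0))"
          using smooth_near_chart_differentiable[OF assms True] c(2) by (simp add: frechet_derivative_works)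
        have "((\<lambda>t. (f \<circ> inv_into U \<phi>) ((\<phi> \<circ> c) t)) has_derivative (\<lambda>t. ?D (k t))) (at 0)"
          by (rule has_derivative_compose[OF k D])
        then have "((\<lambda>t. f (c t)) has_derivative (\<lambda>t. ?D (k t))) (at 0)"
          by (rule has_derivative_transform_within_open[OF _ W(1,2)])
            (use W(3) manifold_chart(3)[OF assms(1,2)] in \<open>auto simp: inv_into_f_f image_subset_iff\<close>)
        moreover have "(\<lambda>t. ?D (k t)) = (*) (?D (k 1))"
        proof
          fix t
          show "?D (k t) = ?D (k 1) * t"
            using linear_cmul[OF has_derivative_linear[OF D], of t "k 1"]
              linear_cmul[OF has_derivative_linear[OF k], of t 1] by (simp add: mult.commute)
        qed
        ultimately have "((\<lambda>t. f (c t)) has_real_derivative ?D (k 1)) (at 0)"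
          by (simp only: has_field_derivative_def)
        then show ?thesis
          using True c(2) by (simp add: velocity_def chart_vector_def DERIV_imp_deriv)
      qed (simp add: velocity_def chart_vector_def c)
    qed
    then show "u \<in> range (chart_vector A U \<phi> p)" using c(1) by simp
  qed
qed

lemma tangent_space_closed:
  assumes "manifold A"
  shows tangent_add: "u \<in> tangent_space A p \<Longrightarrow> v \<in> tangent_space A p \<Longrightarrow> u + v \<in> tangent_space A p"
    and tangent_scaleR: "u \<in> tangent_space A p \<Longrightarrow> c *\<^sub>R u \<in> tangent_space A p"
    and tangent_zero: "0 \<in> tangent_space A p"
proof -
  obtain U \<phi> where ch: "(U, \<phi>) \<in> A" "p \<in> U" using manifold_chart_at[OF assms] .
  note l = chart_vector_linear[OF assms ch] and e = tangent_space_eq_chart_vectors[OF assms ch]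
  show "u \<in> tangent_space A p \<Longrightarrow> v \<in> tangent_space A p \<Longrightarrow> u + v \<in> tangent_space A p"
    unfolding e by (auto simp flip: l)
  show s: "u \<in> tangent_space A p \<Longrightarrow> c *\<^sub>R u \<in> tangent_space A p" for u c
    unfolding e by (auto simp flip: l)
  have "chart_vector A U \<phi> p 0 \<in> tangent_space A p" unfolding e by simp
  from s[OF this, of 0] show "0 \<in> tangent_space A p" by simp
qed

lemma subspace_tangent_space: "manifold A \<Longrightarrow> subspace (tangent_space A p)"
  by (simp add: subspace_def tangent_space_closed)

lemma tangent_not_smooth: "u \<in> tangent_space A p \<Longrightarrow> \<not> smooth_near A p f \<Longrightarrow> u f = 0"
  by (auto simp: tangent_space_def velocity_def)

text \<open>Functions that agree near p have the same derivative in a chart. If one germ is not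
  smooth, neither is the other, and both values are the default 0.\<close>

lemma tangent_local:
  assumes "manifold A" "u \<in> tangent_space A p" "open S" "p \<in> S" "\<And>q. q \<in> S \<Longrightarrow> f q = g q"
  shows "u f = u g"
proof (cases "smooth_near A p f")
  case True
  then have g: "smooth_near A p g" by (rule smooth_near_cong[OF assms(1) _ assms(3-5)])
  obtain U \<phi> where ch: "(U, \<phi>) \<in> A" "p \<in> U" using manifold_chart_at[OF assms(1)] .
  note c = manifold_chart[OF assms(1) ch(1)]
  obtain v where u: "u = chart_vector A U \<phi> p v"
    using assms(2) tangent_space_eq_chart_vectors[OF assms(1) ch] by auto
  have o: "open (\<phi> ` (U \<inter> S))" by (rule open_chart_image[OF assms(1) ch(1)]) (use c assms(3) in auto)
  have "frechet_derivative (f \<circ> inv_into U \<phi>) (at (\<phi> p)) = frechet_derivative (g \<circ> inv_into U \<phi>) (at (\<phi> p))"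
    by (rule frechet_derivative_transform_within_open[OF smooth_near_chart_differentiable[OF assms(1) ch True] o])
      (use ch(2) assms(4,5) c(3) in \<open>auto simp: inv_into_f_f\<close>)
  then show ?thesis using True g by (simp add: u chart_vector_def)
next
  case False
  then have "\<not> smooth_near A p g"
    using smooth_near_cong[OF assms(1) _ assms(3,4), of g f] assms(5) by auto
  then show ?thesis using False assms(2) by (simp add: tangent_not_smooth)
qed

lemma tangent_derivation:
  assumes "manifold A" "u \<in> tangent_space A p" "smooth_near A p f" "smooth_near A p g"
  shows tangent_vector_add: "u (\<lambda>q. f q + g q) = u f + u g"
    and tangent_vector_mult: "u (\<lambda>q. f q * g q) = f p * u g + g p * u f"
proof -
  obtain U \<phi> where ch: "(U, \<phi>) \<in> A" "p \<in> U" using manifold_chart_at[OF assms(1)] .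
  note c = manifold_chart[OF assms(1) ch(1)]
  obtain v where u: "u = chart_vector A U \<phi> p v"
    using assms(2) tangent_space_eq_chart_vectors[OF assms(1) ch] by auto
  let ?f = "f \<circ> inv_into U \<phi>" and ?g = "g \<circ> inv_into U \<phi>"
  have d: "(?f has_derivative frechet_derivative ?f (at (\<phi> p))) (at (\<phi> p))"
    "(?g has_derivative frechet_derivative ?g (at (\<phi> p))) (at (\<phi> p))"
    using smooth_near_chart_differentiable[OF assms(1) ch] assms(3,4) by (auto simp: frechet_derivative_works)
  have p: "inv_into U \<phi> (\<phi> p) = p" using ch(2) c(3) by (simp add: inv_into_f_f)
  show "u (\<lambda>q. f q + g q) = u f + u g"
    using frechet_derivative_at[OF has_derivative_add[OF d]] smooth_near_add[OF assms(1,3,4)] assms(3,4)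
    by (simp add: u chart_vector_def comp_def fun_eq_iff)
  have "frechet_derivative (\<lambda>x. ?f x * ?g x) (at (\<phi> p)) v =
      ?f (\<phi> p) * frechet_derivative ?g (at (\<phi> p)) v + frechet_derivative ?f (at (\<phi> p)) v * ?g (\<phi> p)"
    using frechet_derivative_at[OF has_derivative_mult[OF d]] by (simp add: fun_eq_iff)
  then show "u (\<lambda>q. f q * g q) = f p * u g + g p * u f"
    using smooth_near_mult[OF assms(1,3,4)] assms(3,4) p
    by (simp add: u chart_vector_def comp_def)
qed

lemma tangent_vector_const:
  assumes "manifold A" "u \<in> tangent_space A p"
  shows "u (\<lambda>q. c) = 0"
proof -
  obtain U \<phi> where ch: "(U, \<phi>) \<in> A" "p \<in> U" using manifold_chart_at[OF assms(1)] .
  obtain v where u: "u = chart_vector A U \<phi> p v"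
    using assms(2) tangent_space_eq_chart_vectors[OF assms(1) ch] by auto
  show ?thesis by (simp add: u chart_vector_def comp_def)
qed

lemma tangent_vector_cmult:
  assumes "manifold A" "u \<in> tangent_space A p" "smooth_near A p f"
  shows "u (\<lambda>q. c * f q) = c * u f"
  using tangent_vector_mult[OF assms(1,2) smooth_near_const[OF assms(1)] assms(3), of c]
  by (simp add: tangent_vector_const[OF assms(1,2)])

lemma tangent_vector_minus:
  assumes "manifold A" "u \<in> tangent_space A p" "smooth_near A p f"
  shows "u (\<lambda>q. - f q) = - u f"
  using tangent_vector_cmult[OF assms, of "-1"] by simp

lemma tangent_vector_diff:
  assumes "manifold A" "u \<in> tangent_space A p" "smooth_near A p f" "smooth_near A p g"
  shows "u (\<lambda>q. f q - g q) = u f - u g"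
  using tangent_vector_add[OF assms(1-3) smooth_near_minus[OF assms(1,4)]] tangent_vector_minus[OF assms(1,2,4)]
  by simp

lemma tangent_vector_sum:
  assumes "manifold A" "u \<in> tangent_space A p" "\<And>i. i \<in> I \<Longrightarrow> smooth_near A p (f i)"
  shows "u (\<lambda>q. \<Sum>i\<in>I. f i q) = (\<Sum>i\<in>I. u (f i))"
  using assms(3)
proof (induction I rule: infinite_finite_induct)
  case (insert i I)
  have "smooth_near A p (\<lambda>q. \<Sum>i\<in>I. f i q)"
    by (rule smooth_near_sum[OF assms(1)]) (use insert.prems in auto)
  from tangent_vector_add[OF assms(1,2) _ this, of "f i"] show ?case
    using insert by simp
qed (simp_all add: tangent_vector_const[OF assms(1,2)])

lemma smooth_near_coordinate:
  assumes "manifold A" "(U, \<phi>) \<in> A" "p \<in> U"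
  shows "smooth_near A p (\<lambda>q. \<phi> q \<bullet> b)"
proof -
  note c = manifold_chart[OF assms(1,2)]
  have "smooth_on (\<phi> ` U) ((\<lambda>q. \<phi> q \<bullet> b) \<circ> inv_into U \<phi>)"
    by (rule smooth_on_cong[OF c(2) _ smooth_on_bounded_linear[OF bounded_linear_inner_left]])
      (auto simp: f_inv_into_f)
  then show ?thesis using smooth_near_iff[OF assms] c(1) assms(3) by blast
qed

lemma chart_vector_coordinate:
  assumes "manifold A" "(U, \<phi>) \<in> A" "p \<in> U"
  shows "chart_vector A U \<phi> p v (\<lambda>q. \<phi> q \<bullet> b) = v \<bullet> b"
proof -
  note c = manifold_chart[OF assms(1,2)]
  have "((\<lambda>x. x \<bullet> b) has_derivative (\<lambda>v. v \<bullet> b)) (at (\<phi> p))"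
    by (rule bounded_linear_imp_has_derivative[OF bounded_linear_inner_left])
  then have "(((\<lambda>q. \<phi> q \<bullet> b) \<circ> inv_into U \<phi>) has_derivative (\<lambda>v. v \<bullet> b)) (at (\<phi> p))"
    by (rule has_derivative_transform_within_open[OF _ c(2)]) (use assms(3) in \<open>auto simp: f_inv_into_f\<close>)
  from fun_cong[OF frechet_derivative_at[OF this], of v] show ?thesis
    using smooth_near_coordinate[OF assms, of b] by (simp add: chart_vector_def)
qed

text \<open>The coordinate vector of u is expanded in the frame; its components are the values of u
  on the coordinate functions, so they can be written down, and shown to be smooth for a field,
  without naming the coordinate vector.\<close>

lemma tangent_vector_coordinates:
  fixes A :: "('a::topological_space, 'v::real_inner) atlas"
  assumes "manifold A" "(U, \<phi>) \<in> A" "p \<in> U" "finite_frame (B::'v set)"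
    "u \<in> tangent_space A p" "smooth_near A p f"
  shows "u f = (\<Sum>b\<in>B. u (\<lambda>q. \<phi> q \<bullet> b) * frechet_derivative (f \<circ> inv_into U \<phi>) (at (\<phi> p)) b)"
proof -
  obtain v where u: "u = chart_vector A U \<phi> p v"
    using assms(5) tangent_space_eq_chart_vectors[OF assms(1-3)] by auto
  have "u f = frechet_derivative (f \<circ> inv_into U \<phi>) (at (\<phi> p)) v"
    using assms(6) by (simp add: u chart_vector_def)
  also have "\<dots> = (\<Sum>b\<in>B. (v \<bullet> b) *\<^sub>R frechet_derivative (f \<circ> inv_into U \<phi>) (at (\<phi> p)) b)"
    by (rule linear_frame_expand[OF assms(4) linear_frechet_derivative[OF smooth_near_chart_differentiable[OF assms(1-3,6)]]])
  finally show ?thesis by (simp add: u chart_vector_coordinate[OF assms(1-3)])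
qed

lemma smooth_near_partial_derivative:
  assumes "manifold A" "(U, \<phi>) \<in> A" "p \<in> U" "smooth_near A p f"
  shows "smooth_near A p (\<lambda>q. frechet_derivative (f \<circ> inv_into U \<phi>) (at (\<phi> q)) b)"
proof -
  obtain W where W: "open W" "p \<in> W" "W \<subseteq> U" "smooth_on (\<phi> ` W) (f \<circ> inv_into U \<phi>)"
    using assms(4) smooth_near_iff[OF assms(1-3)] by blast
  have "smooth_on (\<phi> ` W) ((\<lambda>q. frechet_derivative (f \<circ> inv_into U \<phi>) (at (\<phi> q)) b) \<circ> inv_into U \<phi>)"
    by (rule smooth_on_cong[OF open_chart_image[OF assms(1,2) W(1,3)] _ smooth_on_frechet_derivative[OF W(4)]])
      (use W(3) manifold_chart(3)[OF assms(1,2)] in \<open>auto simp: inv_into_f_f subset_iff\<close>)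
  then show ?thesis using smooth_near_iff[OF assms(1-3)] W(1-3) by blast
qed

subsection \<open>The differential of a map\<close>

lemma tangent_map_add: "tangent_map B F p (u + v) = tangent_map B F p u + tangent_map B F p v"
  by (auto simp: tangent_map_def)

lemma tangent_map_scaleR: "tangent_map B F p (c *\<^sub>R u) = c *\<^sub>R tangent_map B F p u"
  by (auto simp: tangent_map_def scaleR_fun_def)

text \<open>The differential carries the velocity of a curve to the velocity of its image curve; the
  interval shrinks because F is smooth only near p.\<close>

lemma tangent_map_in_tangent_space:
  assumes "manifold A" "manifold B" "smooth_at A B p F" "u \<in> tangent_space A p"
  shows "tangent_map B F p u \<in> tangent_space B (F p)"
proof -
  obtain c e where c: "u = velocity A c" "c 0 = p" "e > 0" "smooth_map_on model_atlas A {-e<..<e} c"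
    using assms(4) by (auto simp: tangent_space_def)
  have "smooth_at model_atlas A 0 c"
    using smooth_map_onD[OF manifold_model_real assms(1) _ c(4), of 0] c(3) by simp
  then have "smooth_at model_atlas B 0 (\<lambda>t. F (c t))"
    using assms(3) c(2) by (intro smooth_at_comp[OF manifold_model_real assms(1,2)]) auto
  then obtain S where S: "open S" "0 \<in> S" "smooth_map_on model_atlas B S (\<lambda>t. F (c t))"
    unfolding smooth_at_def by blast
  obtain d where d: "d > 0" "{-d<..<d} \<subseteq> S"
    using S(1,2) unfolding open_dist by (force simp: dist_real_def)
  have sm: "smooth_map_on model_atlas B {-d<..<d} (\<lambda>t. F (c t))"
    using smooth_map_onD[OF manifold_model_real assms(2) S(1,3)] d(2)
    by (auto simp: smooth_map_on_iff_smooth_at[OF manifold_model_real assms(2)])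
  have "tangent_map B F p u = velocity B (\<lambda>t. F (c t))"
    using smooth_near_comp[OF assms(1-3)]
    by (auto simp: tangent_map_def c velocity_def fun_eq_iff comp_def)
  then show ?thesis using sm d(1) c(2) unfolding tangent_space_def by auto
qed

lemma tangent_map_comp:
  assumes "manifold B" "manifold C" "smooth_at B C (F p) G"
  shows "tangent_map C G (F p) (tangent_map B F p u) = tangent_map C (\<lambda>q. G (F q)) p u"
  using smooth_near_comp[OF assms] by (auto simp: tangent_map_def comp_def fun_eq_iff)

lemma tangent_map_id: "u \<in> tangent_space A p \<Longrightarrow> tangent_map A (\<lambda>q. q) p u = u"
  by (auto simp: tangent_map_def comp_def fun_eq_iff tangent_not_smooth)

subsection \<open>Derivatives depending smoothly on a parameter\<close>

text \<open>Here \<open>X q\<close> differentiates F in the second variable, at the moving base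
  point \<open>s q\<close>, while q is also the parameter. In product charts the result is a sum of
  components of X times partial derivatives of F along the second factor, evaluated on the graph of
  s. With s constant this yields smoothness of left-invariant fields, with s the identity smoothness
  of the translation of a field to the identity.\<close>

lemma smooth_near_parametric:
  fixes A :: "('a::topological_space, 'v::real_inner) atlas"
    and B :: "('b::topological_space, 'w::real_inner) atlas"
  assumes mA: "manifold A" and mB: "manifold B" and s: "smooth_at A B p s"
    and X: "\<And>q. X q \<in> tangent_space B (s q)"
      "\<And>f. smooth_near B (s p) f \<Longrightarrow> smooth_near A p (\<lambda>q. X q f)"
    and F: "smooth_near (prod_atlas A B) (p, s p) F"
  shows "smooth_near A p (\<lambda>q. X q (\<lambda>r. F (q, r)))"
proof -
  note mAB = manifold_prod[OF mA mB]
  obtain C where C: "finite_frame (C::'w set)" using manifold_frame[OF mB] .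
  obtain U \<phi> where ch: "(U, \<phi>) \<in> A" "p \<in> U" using manifold_chart_at[OF mA] .
  obtain V \<psi> where ch': "(V, \<psi>) \<in> B" "s p \<in> V" using manifold_chart_at[OF mB] .
  define \<Theta> where "\<Theta> = map_prod \<phi> \<psi>"
  have chp: "(U \<times> V, \<Theta>) \<in> prod_atlas A B" "(p, s p) \<in> U \<times> V"
    using ch ch' by (auto simp: prod_atlas_def \<Theta>_def)
  note inv = prod_atlas_inv[OF mA mB ch(1) ch'(1), folded \<Theta>_def]
  define G where "G = F \<circ> inv_into (U \<times> V) \<Theta>"
  obtain W where W: "open W" "(p, s p) \<in> W" "W \<subseteq> U \<times> V" "smooth_on (\<Theta> ` W) G"
    using F smooth_near_iff[OF mAB chp] unfolding G_def by blast
  have Fnear: "smooth_near (prod_atlas A B) x F" if "x \<in> W" for x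
    using smooth_near_iff[OF mAB chp(1), of x F] that W unfolding G_def by blast
  obtain S where S: "open S" "p \<in> S" "continuous_on S s"
    using s unfolding smooth_at_def smooth_map_on_def by blast
  define N where "N = S \<inter> (\<lambda>q. (q, s q)) -` W"
  have N: "open N" "p \<in> N"
    using continuous_open_preimage[OF continuous_on_Pair[OF continuous_on_id S(3)] S(1) W(1)] S(2) W(2)
    by (auto simp: N_def)
  have eq: "X q (\<lambda>r. F (q, r)) =
      (\<Sum>b\<in>C. X q (\<lambda>r. \<psi> r \<bullet> b) * frechet_derivative G (at (\<Theta> (q, s q))) (0, b))" if q: "q \<in> N" for q
  proof -
    have qW: "(q, s q) \<in> W" using q by (simp add: N_def)
    then have qUV: "q \<in> U" "s q \<in> V" using W(3) by auto
    have near: "smooth_near B (s q) (\<lambda>r. F (q, r))"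
      by (rule smooth_near_comp[OF mB mAB smooth_at_Pair[OF mB mA mB smooth_at_const[OF mB mA] smooth_at_id[OF mB]] Fnear[OF qW]])
    have dG: "(G has_derivative frechet_derivative G (at (\<Theta> (q, s q)))) (at (\<phi> q, \<psi> (s q)))"
      using smooth_on_imp_differentiable[OF W(4)] qW by (auto simp: frechet_derivative_works \<Theta>_def)
    have "((\<lambda>y. G (\<phi> q, y)) has_derivative (\<lambda>b. frechet_derivative G (at (\<Theta> (q, s q))) (0, b))) (at (\<psi> (s q)))"
      by (rule has_derivative_compose[where f="\<lambda>y. (\<phi> q, y)" and x="\<psi> (s q)", OF _ dG]) (auto intro!: derivative_eq_intros)
    then have "(((\<lambda>r. F (q, r)) \<circ> inv_into V \<psi>) has_derivative (\<lambda>b. frechet_derivative G (at (\<Theta> (q, s q))) (0, b))) (at (\<psi> (s q)))"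
      by (rule has_derivative_transform_within_open[OF _ manifold_chart(2)[OF mB ch'(1)]])
        (use qUV inv manifold_chart(3)[OF mB ch'(1)] in \<open>auto simp: G_def inv_into_f_f\<close>)
    from frechet_derivative_at[OF this] show ?thesis
      using tangent_vector_coordinates[OF mB ch'(1) qUV(2) C X(1) near] by (simp add: fun_eq_iff)
  qed
  have G': "smooth_near (prod_atlas A B) (p, s p) (\<lambda>x. frechet_derivative G (at (\<Theta> x)) v)" for v
    unfolding G_def by (rule smooth_near_partial_derivative[OF mAB chp F])
  have "smooth_near A p (\<lambda>q. \<Sum>b\<in>C. X q (\<lambda>r. \<psi> r \<bullet> b) * frechet_derivative G (at (\<Theta> (q, s q))) (0, b))"
    by (intro smooth_near_sum[OF mA] smooth_near_mult[OF mA] X(2) smooth_near_coordinate[OF mB ch']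
        smooth_near_comp[where F="\<lambda>q. (q, s q)", OF mA mAB _ G'] smooth_at_Pair mA mB s smooth_at_id)
  then show ?thesis by (rule smooth_near_cong[OF mA _ N]) (simp add: eq)
qed

section \<open>Vector fields\<close>

lemma vector_field_iff:
  assumes "manifold A"
  shows "vector_field A X \<longleftrightarrow> (\<forall>p. X p \<in> tangent_space A p) \<and>
    (\<forall>p f. smooth_near A p f \<longrightarrow> smooth_near A p (\<lambda>q. X q f))"
proof -
  have "(\<forall>p f. smooth_near A p f \<longrightarrow> smooth_near A p (\<lambda>q. X q f)) \<longleftrightarrow>
      (\<forall>S f. open S \<and> smooth_fun_on A S f \<longrightarrow> smooth_fun_on A S (\<lambda>p. X p f))" (is "?l \<longleftrightarrow> ?r")
  proof
    show "?l \<Longrightarrow> ?r" using smooth_fun_on_iff[OF assms] by blast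
    show "?r \<Longrightarrow> ?l" unfolding smooth_near_def by blast
  qed
  then show ?thesis by (simp only: vector_field_def)
qed

lemma vector_field_tangent: "vector_field A X \<Longrightarrow> X p \<in> tangent_space A p"
  by (simp add: vector_field_def)

lemma vector_field_smooth:
  "manifold A \<Longrightarrow> vector_field A X \<Longrightarrow> smooth_near A p f \<Longrightarrow> smooth_near A p (\<lambda>q. X q f)"
  by (simp add: vector_field_iff)

lemma vector_field_add:
  assumes "manifold A" "vector_field A X" "vector_field A Y"
  shows "vector_field A (\<lambda>p. X p + Y p)"
  using assms by (simp add: vector_field_iff tangent_add smooth_near_add)

lemma vector_field_scaleR:
  assumes "manifold A" "\<And>p. smooth_near A p h" "vector_field A X"
  shows "vector_field A (\<lambda>p. h p *\<^sub>R X p)"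
  unfolding vector_field_iff[OF assms(1)]
proof (intro conjI allI impI)
  show "h p *\<^sub>R X p \<in> tangent_space A p" for p
    by (rule tangent_scaleR[OF assms(1) vector_field_tangent[OF assms(3)]])
  show "smooth_near A p (\<lambda>q. (h q *\<^sub>R X q) f)" if "smooth_near A p f" for p f
    using smooth_near_mult[OF assms(1,2) vector_field_smooth[OF assms(1,3) that]]
    by (simp add: scaleR_fun_def)
qed

lemma vector_field_zero: "manifold A \<Longrightarrow> vector_field A (\<lambda>p. 0)"
  by (simp add: vector_field_iff tangent_zero smooth_near_const)

lemma vector_field_sum:
  assumes "manifold A" "\<And>i. i \<in> I \<Longrightarrow> vector_field A (X i)"
  shows "vector_field A (\<lambda>p. \<Sum>i\<in>I. X i p)"
  using assms(2)
  by (induction I rule: infinite_finite_induct) (auto intro: vector_field_add vector_field_zero assms(1))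

text \<open>Tangent vectors are velocities, so being a derivation is not enough: the bracket has to
  be exhibited as a chart vector. Writing both compositions in coordinates gives first-order terms
  and terms with second derivatives of f; the latter cancel because second derivatives are
  symmetric.\<close>

lemma lie_bracket_in_tangent_space:
  fixes A :: "('a::topological_space, 'v::real_inner) atlas"
  assumes m: "manifold A" and X: "vector_field A X" and Y: "vector_field A Y"
  shows "lie_bracket A X Y p \<in> tangent_space A p"
proof -
  obtain B where B: "finite_frame (B::'v set)" using manifold_frame[OF m] .
  obtain U \<phi> where ch: "(U, \<phi>) \<in> A" "p \<in> U" using manifold_chart_at[OF m] .
  note c = manifold_chart[OF m ch(1)]
  define k where "k b = (\<lambda>q. \<phi> q \<bullet> b)" for b
  have k: "smooth_near A p (k b)" for b unfolding k_def by (rule smooth_near_coordinate[OF m ch])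
  \<comment> \<open>The components are the bracket evaluated on the coordinate functions, the
    classical formula for the bracket in coordinates.\<close>
  define w where "w = (\<Sum>b\<in>B. (X p (\<lambda>q. Y q (k b)) - Y p (\<lambda>q. X q (k b))) *\<^sub>R b)"
  have "lie_bracket A X Y p = chart_vector A U \<phi> p w"
  proof (rule ext)
    fix f
    show "lie_bracket A X Y p f = chart_vector A U \<phi> p w f"
    proof (cases "smooth_near A p f")
      case True
      define D where "D = (\<lambda>b q. frechet_derivative (f \<circ> inv_into U \<phi>) (at (\<phi> q)) b)"
      have D: "smooth_near A p (D b)" for b
        unfolding D_def by (rule smooth_near_partial_derivative[OF m ch True])
      obtain W where W: "open W" "p \<in> W" "W \<subseteq> U" "smooth_on (\<phi> ` W) (f \<circ> inv_into U \<phi>)"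
        using True smooth_near_iff[OF m ch] by blast
      have oW: "open (\<phi> ` W)" by (rule open_chart_image[OF m ch(1) W(1,3)])
      define H where "H = (\<lambda>b d. frechet_derivative (\<lambda>x. frechet_derivative (f \<circ> inv_into U \<phi>) (at x) b) (at (\<phi> p)) d)"
      have Hsym: "H b d = H d b" for b d
        unfolding H_def by (rule second_derivative_symmetric[OF oW _ W(4)]) (use W(2) in auto)
      have DH: "Z p (D b) = (\<Sum>d\<in>B. Z p (k d) * H b d)" if Z: "vector_field A Z" for Z b
      proof -
        have "frechet_derivative (D b \<circ> inv_into U \<phi>) (at (\<phi> p)) =
            frechet_derivative (\<lambda>x. frechet_derivative (f \<circ> inv_into U \<phi>) (at x) b) (at (\<phi> p))"
          by (rule frechet_derivative_transform_within_open[OF smooth_near_chart_differentiable[OF m ch D] oW])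
            (use W(2,3) c(3) in \<open>auto simp: D_def inv_into_f_f subset_iff\<close>)
        then show ?thesis
          using tangent_vector_coordinates[OF m ch B vector_field_tangent[OF Z] D]
          by (simp add: k_def H_def)
      qed
      have expand: "Z p (\<lambda>q. Z' q f) =
          (\<Sum>b\<in>B. Z p (\<lambda>q. Z' q (k b)) * D b p) + (\<Sum>b\<in>B. \<Sum>d\<in>B. Z' p (k b) * Z p (k d) * H b d)"
        if Z: "vector_field A Z" "vector_field A Z'" for Z Z'
      proof -
        note t = vector_field_tangent[OF Z(1)]
        have "Z' q f = (\<Sum>b\<in>B. Z' q (k b) * D b q)" if "q \<in> W" for q
        proof -
          have "q \<in> U" "smooth_near A q f"
            using that W smooth_near_iff[OF m ch(1), of q f] by blast+
          then show ?thesis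
            using tangent_vector_coordinates[OF m ch(1) _ B vector_field_tangent[OF Z(2)], of q f]
            by (simp add: k_def D_def)
        qed
        then have "Z p (\<lambda>q. Z' q f) = Z p (\<lambda>q. \<Sum>b\<in>B. Z' q (k b) * D b q)"
          by (rule tangent_local[OF m t W(1,2)])
        also have "\<dots> = (\<Sum>b\<in>B. Z p (\<lambda>q. Z' q (k b) * D b q))"
          by (rule tangent_vector_sum[OF m t]) (intro smooth_near_mult[OF m] vector_field_smooth[OF m Z(2)] k D)
        also have "\<dots> = (\<Sum>b\<in>B. Z' p (k b) * Z p (D b) + D b p * Z p (\<lambda>q. Z' q (k b)))"
          by (intro sum.cong refl tangent_vector_mult[OF m t] vector_field_smooth[OF m Z(2)] k D)
        finally show ?thesis
          by (simp add: sum.distrib DH[OF Z(1)] sum_distrib_left mult.commute mult.left_commute)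
      qed
      \<comment> \<open>The second-order parts of the two compositions coincide, by exchanging the
        summation indices and the symmetry \<open>Hsym\<close>.\<close>
      have swap: "(\<Sum>b\<in>B. \<Sum>d\<in>B. X p (k b) * Y p (k d) * H b d) =
          (\<Sum>b\<in>B. \<Sum>d\<in>B. Y p (k b) * X p (k d) * H b d)"
        by (subst sum.swap) (simp add: Hsym mult.commute mult.left_commute)
      have lin: "linear (frechet_derivative (f \<circ> inv_into U \<phi>) (at (\<phi> p)))"
        by (rule linear_frechet_derivative[OF smooth_near_chart_differentiable[OF m ch True]])
      have "lie_bracket A X Y p f = X p (\<lambda>q. Y q f) - Y p (\<lambda>q. X q f)"
        using True by (simp add: lie_bracket_def)
      also have "\<dots> = (\<Sum>b\<in>B. (X p (\<lambda>q. Y q (k b)) - Y p (\<lambda>q. X q (k b))) * D b p)"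
        by (simp add: expand X Y swap left_diff_distrib sum_subtractf)
      also have "\<dots> = chart_vector A U \<phi> p w f"
        using True lin by (simp add: chart_vector_def w_def D_def linear_sum linear_cmul)
      finally show ?thesis .
    qed (simp add: lie_bracket_def chart_vector_def)
  qed
  then show ?thesis by (simp add: chart_vector_in_tangent_space[OF m ch])
qed

lemma vector_field_lie_bracket:
  assumes m: "manifold A" and X: "vector_field A X" and Y: "vector_field A Y"
  shows "vector_field A (lie_bracket A X Y)"
  unfolding vector_field_iff[OF m]
proof (intro conjI allI impI)
  show "lie_bracket A X Y p \<in> tangent_space A p" for p
    by (rule lie_bracket_in_tangent_space[OF m X Y])
  fix p f assume f: "smooth_near A p f"
  obtain S where S: "open S" "p \<in> S" "\<And>q. q \<in> S \<Longrightarrow> smooth_near A q f"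
    using smooth_near_nhd[OF m f] by blast
  have "smooth_near A p (\<lambda>q. X q (\<lambda>r. Y r f) - Y q (\<lambda>r. X r f))"
    by (intro smooth_near_diff[OF m] vector_field_smooth[OF m X] vector_field_smooth[OF m Y] f)
  then show "smooth_near A p (\<lambda>q. lie_bracket A X Y q f)"
    by (rule smooth_near_cong[OF m _ S(1,2)]) (simp add: lie_bracket_def S(3))
qed

section \<open>Linear algebra on subspaces\<close>

lemma dual_spaceD:
  assumes "\<alpha> \<in> dual_space V"
  shows "u \<in> V \<Longrightarrow> v \<in> V \<Longrightarrow> \<alpha> (u + v) = \<alpha> u + \<alpha> v"
    and "u \<in> V \<Longrightarrow> \<alpha> (c *\<^sub>R u) = c * \<alpha> u"
    and "u \<notin> V \<Longrightarrow> \<alpha> u = 0"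
  using assms by (auto simp: dual_space_def)

lemma linear_on_subspace_sum:
  fixes F :: "'b::real_vector \<Rightarrow> real"
  assumes "subspace V" "\<And>u v. u \<in> V \<Longrightarrow> v \<in> V \<Longrightarrow> F (u + v) = F u + F v"
    "\<And>c u. u \<in> V \<Longrightarrow> F (c *\<^sub>R u) = c * F u" "\<And>i. i \<in> I \<Longrightarrow> e i \<in> V"
  shows "F (\<Sum>i\<in>I. c i *\<^sub>R e i) = (\<Sum>i\<in>I. c i * F (e i))"
  using assms(4)
proof (induction I rule: infinite_finite_induct)
  case (insert i I)
  have "(\<Sum>i\<in>I. c i *\<^sub>R e i) \<in> V"
    by (intro subspace_sum[OF assms(1)] subspace_scale[OF assms(1)]) (use insert.prems in auto)
  then show ?case
    using insert by (simp add: assms(2,3) subspace_scale[OF assms(1)])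
qed (use assms(3)[OF subspace_0[OF assms(1)], of 0] in simp_all)

lemma dual_space_sum:
  assumes "subspace V" "\<alpha> \<in> dual_space V" "\<And>i. i \<in> I \<Longrightarrow> e i \<in> V"
  shows "\<alpha> (\<Sum>i\<in>I. c i *\<^sub>R e i) = (\<Sum>i\<in>I. c i * \<alpha> (e i))"
  by (rule linear_on_subspace_sum[OF assms(1)]) (use assms(2,3) in \<open>auto simp: dual_space_def\<close>)

lemma subspace_dual_space: "subspace (dual_space V)"
  unfolding subspace_def dual_space_def scaleR_fun_def by (auto simp: algebra_simps)

lemma zero_dual_space: "(\<lambda>u. 0) \<in> dual_space V"
  by (simp add: dual_space_def)

lemma dual_eqI:
  assumes "\<xi> \<in> dual_space V" "\<eta> \<in> dual_space V" "\<And>u. u \<in> V \<Longrightarrow> \<xi> u = \<eta> u"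
  shows "\<xi> = \<eta>"
  using assms dual_spaceD(3) by (metis ext)

lemma sum_fun_apply: "(\<Sum>i\<in>I. f i) x = (\<Sum>i\<in>I. f i x)"
  by (induction I rule: infinite_finite_induct) auto

text \<open>Dimension count: the image of C is independent and has as many members as C, so a vector
  of \<open>span C\<close> outside its span would give an independent set that is too large.\<close>

lemma linear_injective_surj_on_span:
  fixes f :: "'b::real_vector \<Rightarrow> 'b"
  assumes f: "linear f" and C: "independent C" "finite C" and inj: "inj_on f (span C)" and into: "f ` C \<subseteq> span C"
  shows "f ` span C = span C"
proof -
  have ind: "independent (f ` C)"
    by (rule linear_independent_injective_image[OF f C(1) inj])
  have card: "card (f ` C) = card C"
    by (rule card_image) (rule inj_on_subset[OF inj span_superset])
  have "span C \<subseteq> span (f ` C)"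
  proof
    fix y assume y: "y \<in> span C"
    show "y \<in> span (f ` C)"
    proof (rule ccontr)
      assume ny: "y \<notin> span (f ` C)"
      then have "independent (insert y (f ` C))" using ind by (simp add: independent_insert)
      then have "card (insert y (f ` C)) \<le> card C"
        using independent_span_bound[OF C(2)] y into by auto
      moreover have "y \<notin> f ` C" by (rule contra_subsetD[OF span_superset ny])
      ultimately show False using card C(2) by (simp add: card_insert_disjoint)
    qed
  qed
  moreover have "span (f ` C) \<subseteq> span C"
    using into by (simp add: span_minimal subspace_span)
  ultimately show ?thesis unfolding linear_span_image[OF f] by blast
qed

text \<open>In a basis of V the form becomes a linear endomorphism; non-degeneracy makes it
  injective, hence surjective, and a preimage of the coordinates of F is the representing vector.
  Stated for an abstract V because it serves both for a metric on the Lie algebra and for \<G> on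
  the dual space.\<close>

lemma nondegenerate_representation:
  fixes V :: "'b::real_vector set"
  assumes V: "subspace V" "V \<subseteq> span S" "finite S"
    and l: "\<And>x y z. x \<in> V \<Longrightarrow> y \<in> V \<Longrightarrow> z \<in> V \<Longrightarrow> \<beta> (x + y) z = \<beta> x z + \<beta> y z"
      "\<And>c x z. x \<in> V \<Longrightarrow> z \<in> V \<Longrightarrow> \<beta> (c *\<^sub>R x) z = c * \<beta> x z"
    and r: "\<And>x y z. x \<in> V \<Longrightarrow> y \<in> V \<Longrightarrow> z \<in> V \<Longrightarrow> \<beta> z (x + y) = \<beta> z x + \<beta> z y"
      "\<And>c x z. x \<in> V \<Longrightarrow> z \<in> V \<Longrightarrow> \<beta> z (c *\<^sub>R x) = c * \<beta> z x"
    and nd: "nondegenerate_on V \<beta>"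
    and F: "\<And>x y. x \<in> V \<Longrightarrow> y \<in> V \<Longrightarrow> F (x + y) = F x + F y"
      "\<And>c x. x \<in> V \<Longrightarrow> F (c *\<^sub>R x) = c * F x"
  shows "\<exists>x\<in>V. \<forall>y\<in>V. \<beta> x y = F y"
proof -
  obtain C where C: "C \<subseteq> V" "independent C" "V \<subseteq> span C"
    using maximal_independent_subset[of V] by blast
  have VC: "V = span C"
    using C(1,3) span_minimal[OF C(1) V(1)] by blast
  have fC: "finite C"
    using independent_span_bound[OF V(3) C(2)] C(1) V(2) by blast
  have expand: "\<exists>k. x = (\<Sum>c\<in>C. k c *\<^sub>R c)" if "x \<in> V" for x
    using that C(3) span_finite[OF fC] by auto
  have ext: "P x = Q x"
    if "x \<in> V" "\<And>c. c \<in> C \<Longrightarrow> P c = Q c"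
      "\<And>x y. x \<in> V \<Longrightarrow> y \<in> V \<Longrightarrow> P (x + y) = P x + P y" "\<And>c x. x \<in> V \<Longrightarrow> P (c *\<^sub>R x) = c * P x"
      "\<And>x y. x \<in> V \<Longrightarrow> y \<in> V \<Longrightarrow> Q (x + y) = Q x + Q y" "\<And>c x. x \<in> V \<Longrightarrow> Q (c *\<^sub>R x) = c * Q x"
    for P Q :: "'b \<Rightarrow> real" and x
  proof -
    obtain k where x: "x = (\<Sum>c\<in>C. k c *\<^sub>R c)" using expand[OF \<open>x \<in> V\<close>] by blast
    have "P x = (\<Sum>c\<in>C. k c * P c)" "Q x = (\<Sum>c\<in>C. k c * Q c)"
      unfolding x by (rule linear_on_subspace_sum[OF V(1)]; use that C(1) in auto)+
    then show ?thesis using that(2) by simp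
  qed
  \<comment> \<open>h x has the numbers \<open>\<beta> x c\<close> as coordinates. It is known to be
    linear on V only, so a globally linear f that agrees with it there is used for the dimension
    count.\<close>
  define h where "h = (\<lambda>x. \<Sum>c\<in>C. \<beta> x c *\<^sub>R c)"
  obtain f where f: "linear f" "\<And>c. c \<in> C \<Longrightarrow> f c = h c"
    using linear_independent_extend[OF C(2)] by blast
  have fh: "f x = h x" if x: "x \<in> V" for x
  proof -
    obtain k where k: "x = (\<Sum>c\<in>C. k c *\<^sub>R c)" using expand[OF x] by blast
    have b: "\<beta> x d = (\<Sum>c\<in>C. k c * \<beta> c d)" if "d \<in> C" for d
      unfolding k by (rule linear_on_subspace_sum[OF V(1)]) (use l that C(1) in auto)
    have "f x = (\<Sum>c\<in>C. k c *\<^sub>R h c)"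
      unfolding k using f by (simp add: linear_sum linear_cmul)
    also have "\<dots> = (\<Sum>c\<in>C. \<Sum>d\<in>C. (k c * \<beta> c d) *\<^sub>R d)"
      by (simp add: h_def scaleR_sum_right)
    also have "\<dots> = (\<Sum>d\<in>C. \<Sum>c\<in>C. (k c * \<beta> c d) *\<^sub>R d)"
      by (rule sum.swap)
    also have "\<dots> = h x"
      by (simp add: h_def b scaleR_sum_left)
    finally show ?thesis .
  qed
  have hV: "h x \<in> V" for x
    unfolding h_def by (intro subspace_sum[OF V(1)] subspace_scale[OF V(1)]) (use C(1) in auto)
  have "x = 0" if x: "x \<in> V" "f x = 0" for x
  proof -
    have "(\<Sum>c\<in>C. \<beta> x c *\<^sub>R c) = 0" using x fh by (simp add: h_def)
    then have "\<beta> x c = 0" if "c \<in> C" for c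
      by (rule independentD[OF C(2) fC subset_refl _ that])
    then have "\<beta> x y = 0" if "y \<in> V" for y
      using ext[of y "\<beta> x" "\<lambda>y. 0"] that r x(1) by simp
    then show ?thesis using nd x(1) by (auto simp: nondegenerate_on_def)
  qed
  then have "inj_on f (span C)"
    using linear_diff[OF f(1)] subspace_diff[OF V(1)] unfolding VC
    by (metis eq_iff_diff_eq_0 inj_onI)
  then have surj: "f ` span C = span C"
    by (rule linear_injective_surj_on_span[OF f(1) C(2) fC]) (use hV VC f(2) in auto)
  have "(\<Sum>c\<in>C. F c *\<^sub>R c) \<in> span C"
    by (intro span_sum span_scale span_base)
  then have "(\<Sum>c\<in>C. F c *\<^sub>R c) \<in> f ` V" by (simp only: surj VC)
  then obtain x where x: "x \<in> V" "h x = (\<Sum>c\<in>C. F c *\<^sub>R c)"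
    using fh by auto
  have "(\<Sum>c\<in>C. (\<beta> x c - F c) *\<^sub>R c) = 0"
    using x(2) by (simp add: h_def scaleR_diff_left sum_subtractf)
  then have "\<beta> x c = F c" if "c \<in> C" for c
    using independentD[OF C(2) fC subset_refl _ that, of "\<lambda>c. \<beta> x c - F c"] by simp
  then have "\<beta> x y = F y" if "y \<in> V" for y
    using ext[of y "\<beta> x" F] that r x(1) F by simp
  then show ?thesis using x(1) by blast
qed

section \<open>Tensorial expressions and Lie brackets\<close>

text \<open>Linearity over smooth functions for a functional of global fields that is evaluated at
  p. The coefficients h are smooth everywhere, as are the components in a global frame.\<close>

definition tensorial_at ::
  "('a::topological_space, 'v::real_inner) atlas \<Rightarrow> 'a \<Rightarrow> (('a \<Rightarrow> 'a tangent) \<Rightarrow> real) \<Rightarrow> bool" where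
  "tensorial_at A p T \<longleftrightarrow>
     (\<forall>X Y. vector_field A X \<and> vector_field A Y \<longrightarrow> T (\<lambda>q. X q + Y q) = T X + T Y) \<and>
     (\<forall>h X. (\<forall>q. smooth_near A q h) \<and> vector_field A X \<longrightarrow> T (\<lambda>q. h q *\<^sub>R X q) = h p * T X)"

lemma tensorial_atD:
  assumes "tensorial_at A p T"
  shows "vector_field A X \<Longrightarrow> vector_field A Y \<Longrightarrow> T (\<lambda>q. X q + Y q) = T X + T Y"
    and "(\<And>q. smooth_near A q h) \<Longrightarrow> vector_field A X \<Longrightarrow> T (\<lambda>q. h q *\<^sub>R X q) = h p * T X"
  using assms unfolding tensorial_at_def by blast+

lemma tensorial_at_sum:
  assumes "manifold A" "tensorial_at A p T" "\<And>i q. i \<in> I \<Longrightarrow> smooth_near A q (c i)"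
    "\<And>i. i \<in> I \<Longrightarrow> vector_field A (E i)"
  shows "T (\<lambda>q. \<Sum>i\<in>I. c i q *\<^sub>R E i q) = (\<Sum>i\<in>I. c i p * T (E i))"
  using assms(3,4)
proof (induction I rule: infinite_finite_induct)
  case (insert i I)
  have "vector_field A (\<lambda>q. \<Sum>i\<in>I. c i q *\<^sub>R E i q)" "vector_field A (\<lambda>q. c i q *\<^sub>R E i q)"
    using insert.prems by (auto intro!: vector_field_sum vector_field_scaleR assms(1))
  then show ?case
    using insert
    by (simp only: sum.insert[OF insert.hyps] tensorial_atD[OF assms(2)] insert_iff simp_thms)
qed (use tensorial_atD(2)[OF assms(2) smooth_near_const[OF assms(1)] vector_field_zero[OF assms(1)], of 0] in simp_all)

lemma lie_bracket_skew: "lie_bracket A X Y p = - lie_bracket A Y X p"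
  by (auto simp: lie_bracket_def)

lemma lie_bracket_add:
  assumes m: "manifold A" and X: "vector_field A X" and Y: "vector_field A Y" and Z: "vector_field A Z"
  shows "lie_bracket A X (\<lambda>q. Y q + Z q) p = lie_bracket A X Y p + lie_bracket A X Z p"
proof
  fix f
  show "lie_bracket A X (\<lambda>q. Y q + Z q) p f = (lie_bracket A X Y p + lie_bracket A X Z p) f"
    using tangent_vector_add[OF m vector_field_tangent[OF X], of p "\<lambda>q. Y q f" "\<lambda>q. Z q f"]
      vector_field_smooth[OF m Y] vector_field_smooth[OF m Z]
    by (simp add: lie_bracket_def)
qed

lemma lie_bracket_scaleR:
  assumes m: "manifold A" and X: "vector_field A X" and Y: "vector_field A Y" and h: "smooth_near A p h"
  shows "lie_bracket A X (\<lambda>q. h q *\<^sub>R Y q) p = h p *\<^sub>R lie_bracket A X Y p + X p h *\<^sub>R Y p"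
proof
  fix f
  show "lie_bracket A X (\<lambda>q. h q *\<^sub>R Y q) p f = (h p *\<^sub>R lie_bracket A X Y p + X p h *\<^sub>R Y p) f"
  proof (cases "smooth_near A p f")
    case True
    then show ?thesis
      using tangent_vector_mult[OF m vector_field_tangent[OF X] h vector_field_smooth[OF m Y True]]
      by (simp add: lie_bracket_def scaleR_fun_def algebra_simps)
  qed (simp add: lie_bracket_def scaleR_fun_def tangent_not_smooth[OF vector_field_tangent[OF Y]])
qed

lemma lie_bracket_apply:
  assumes m: "manifold A" and f: "smooth_near A p f"
  obtains S where "open S" "p \<in> S"
    "\<And>q. q \<in> S \<Longrightarrow> lie_bracket A X Y q f = X q (\<lambda>r. Y r f) - Y q (\<lambda>r. X r f)"
proof -
  obtain S where "open S" "p \<in> S" "\<And>q. q \<in> S \<Longrightarrow> smooth_near A q f"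
    using smooth_near_nhd[OF m f] by blast
  then show ?thesis by (intro that[of S]) (auto simp: lie_bracket_def)
qed

text \<open>On a smooth germ each double bracket expands into four threefold derivatives, and all of
  them cancel. The order of the entries is the one in which the double brackets occur in
  \<open>ext_d2_ext_d2\<close>.\<close>

lemma lie_bracket_jacobi:
  assumes m: "manifold A" and X: "vector_field A X" and Y: "vector_field A Y" and Z: "vector_field A Z"
  shows "lie_bracket A (lie_bracket A X Y) Z p - lie_bracket A (lie_bracket A X Z) Y p +
    lie_bracket A (lie_bracket A Y Z) X p = 0"
proof
  fix f
  show "(lie_bracket A (lie_bracket A X Y) Z p - lie_bracket A (lie_bracket A X Z) Y p +
    lie_bracket A (lie_bracket A Y Z) X p) f = 0 f"
  proof (cases "smooth_near A p f")
    case f: True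
    have *: "W p (\<lambda>q. lie_bracket A V V' q f) = W p (\<lambda>q. V q (\<lambda>r. V' r f)) - W p (\<lambda>q. V' q (\<lambda>r. V r f))"
      if V: "vector_field A V" "vector_field A V'" and W: "vector_field A W" for V V' W
    proof -
      note t = vector_field_tangent[OF W]
      obtain S where S: "open S" "p \<in> S"
        "\<And>q. q \<in> S \<Longrightarrow> lie_bracket A V V' q f = V q (\<lambda>r. V' r f) - V' q (\<lambda>r. V r f)"
        using lie_bracket_apply[OF m f] by blast
      have "W p (\<lambda>q. lie_bracket A V V' q f) = W p (\<lambda>q. V q (\<lambda>r. V' r f) - V' q (\<lambda>r. V r f))"
        by (rule tangent_local[OF m t S])
      also have "\<dots> = W p (\<lambda>q. V q (\<lambda>r. V' r f)) - W p (\<lambda>q. V' q (\<lambda>r. V r f))"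
        by (intro tangent_vector_diff[OF m t] vector_field_smooth[OF m V(1)] vector_field_smooth[OF m V(2)] f)
      finally show ?thesis .
    qed
    have br: "lie_bracket A V V' p g = V p (\<lambda>r. V' r g) - V' p (\<lambda>r. V r g)" if "smooth_near A p g" for V V' g
      using that by (simp add: lie_bracket_def)
    show ?thesis
      by (simp add: br[OF f] * X Y Z br vector_field_smooth[OF m] f)
  qed (simp add: lie_bracket_def)
qed

section \<open>One-forms, and tensoriality of the Lie derivative and the exterior derivative\<close>

lemma one_form_dual: "one_form A \<xi> \<Longrightarrow> \<xi> p \<in> cotangent_space A p"
  by (simp add: one_form_def)

lemma one_form_smooth:
  "manifold A \<Longrightarrow> one_form A \<xi> \<Longrightarrow> vector_field A X \<Longrightarrow> smooth_near A p (\<lambda>q. \<xi> q (X q))"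
  by (simp add: one_form_def smooth_fun_on_iff)

lemma one_form_add:
  assumes "manifold A" "one_form A \<xi>" "one_form A \<eta>"
  shows "one_form A (\<lambda>p. \<xi> p + \<eta> p)"
  using assms by (simp add: one_form_def smooth_fun_on_iff smooth_near_add subspace_add[OF subspace_dual_space])

text \<open>For a product h Z the Leibniz rule contributes the derivative of h along X times
  \<eta>(Z), once from differentiating the function \<eta>(h Z) and once from the bracket; the two
  cancel.\<close>

lemma tensorial_lie_derivative:
  assumes m: "manifold A" and X: "vector_field A X" and \<eta>: "one_form A \<eta>"
  shows "tensorial_at A p (\<lambda>Z. X p (\<lambda>q. \<eta> q (Z q)) - \<eta> p (lie_bracket A X Z p))"
  unfolding tensorial_at_def
proof (intro conjI allI impI; elim conjE)
  note t = vector_field_tangent and s = one_form_smooth[OF m \<eta>] and d = dual_spaceD[OF one_form_dual[OF \<eta>]]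
  note b = lie_bracket_in_tangent_space[OF m X]
  show "X p (\<lambda>q. \<eta> q (Y q + Z q)) - \<eta> p (lie_bracket A X (\<lambda>q. Y q + Z q) p) =
      X p (\<lambda>q. \<eta> q (Y q)) - \<eta> p (lie_bracket A X Y p) + (X p (\<lambda>q. \<eta> q (Z q)) - \<eta> p (lie_bracket A X Z p))"
    if Y: "vector_field A Y" and Z: "vector_field A Z" for Y Z
    using tangent_vector_add[OF m t[OF X] s[OF Y] s[OF Z]]
    by (simp add: d t[OF Y] t[OF Z] lie_bracket_add[OF m X Y Z] b[OF Y] b[OF Z])
  show "X p (\<lambda>q. \<eta> q (h q *\<^sub>R Y q)) - \<eta> p (lie_bracket A X (\<lambda>q. h q *\<^sub>R Y q) p) =
      h p * (X p (\<lambda>q. \<eta> q (Y q)) - \<eta> p (lie_bracket A X Y p))"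
    if h: "\<forall>q. smooth_near A q h" and Y: "vector_field A Y" for h Y
    using tangent_vector_mult[OF m t[OF X] h[rule_format] s[OF Y]]
    by (simp add: d t[OF Y] lie_bracket_scaleR[OF m X Y h[rule_format]] b[OF Y] tangent_scaleR[OF m] algebra_simps)
qed

text \<open>Cartan's formula: the contraction of d\<xi> with Y is the Lie derivative of \<xi> along
  Y minus the differential of the function \<xi>(Y), and the differential of a function depends on Z
  only through its value at p.\<close>

lemma tensorial_ext_d1:
  assumes m: "manifold A" and Y: "vector_field A Y" and \<xi>: "one_form A \<xi>"
  shows "tensorial_at A p (\<lambda>Z. ext_d1 A \<xi> Y Z p)"
proof -
  note l = tensorial_lie_derivative[OF m Y \<xi>, of p]
  note t = vector_field_tangent and s = one_form_smooth[OF m \<xi> Y]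
  have e: "ext_d1 A \<xi> Y Z p = (Y p (\<lambda>q. \<xi> q (Z q)) - \<xi> p (lie_bracket A Y Z p)) - Z p (\<lambda>q. \<xi> q (Y q))" for Z
    by (simp add: ext_d1_def)
  show ?thesis
    unfolding tensorial_at_def e
    using tensorial_atD[OF l]
    by (auto simp: scaleR_fun_def algebra_simps)
qed

section \<open>Left-invariant frames on a Lie group\<close>

text \<open>The left Maurer-Cartan form at p.\<close>

definition to_lie_algebra ::
  "('a::topological_space, 'v::real_normed_vector) lie_group_data \<Rightarrow> 'a \<Rightarrow> 'a tangent \<Rightarrow> 'a tangent" where
  "to_lie_algebra G p = left_translate G (inv\<^bsub>G\<^esub> p) p"

lemma smooth_at_projections:
  fixes A :: "('a::topological_space, 'v::real_inner) atlas" and B :: "('b::topological_space, 'w::real_inner) atlas"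
  assumes "manifold A" "manifold B"
  shows "smooth_at (prod_atlas A B) A x fst" and "smooth_at (prod_atlas A B) B x snd"
proof -
  note mAB = manifold_prod[OF assms]
  obtain p q where x: "x = (p, q)" by (cases x)
  obtain U \<phi> where ch: "(U, \<phi>) \<in> A" "p \<in> U" using manifold_chart_at[OF assms(1)] .
  obtain V \<psi> where ch': "(V, \<psi>) \<in> B" "q \<in> V" using manifold_chart_at[OF assms(2)] .
  note inv = prod_atlas_inv[OF assms ch(1) ch'(1)]
  have chp: "(U \<times> V, map_prod \<phi> \<psi>) \<in> prod_atlas A B" "x \<in> U \<times> V"
    using ch ch' by (auto simp: prod_atlas_def x)
  note c = manifold_chart[OF mAB chp(1)]
  have 1: "smooth_on (map_prod \<phi> \<psi> ` (U \<times> V)) (\<phi> \<circ> fst \<circ> inv_into (U \<times> V) (map_prod \<phi> \<psi>))"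
    by (rule smooth_on_cong[OF c(2) _ smooth_on_bounded_linear[OF bounded_linear_fst]]) (auto simp: inv)
  have 2: "smooth_on (map_prod \<phi> \<psi> ` (U \<times> V)) (\<psi> \<circ> snd \<circ> inv_into (U \<times> V) (map_prod \<phi> \<psi>))"
    by (rule smooth_on_cong[OF c(2) _ smooth_on_bounded_linear[OF bounded_linear_snd]]) (auto simp: inv)
  show "smooth_at (prod_atlas A B) A x fst"
    by (rule smooth_at_chartI[OF mAB assms(1) chp(1) ch(1) c(1) chp(2) _ _ 1]) auto
  show "smooth_at (prod_atlas A B) B x snd"
    by (rule smooth_at_chartI[OF mAB assms(2) chp(1) ch'(1) c(1) chp(2) _ _ 2]) auto
qed

context lie_group
begin

section \<open>Left translation and the trivialisation of the tangent bundle\<close>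

lemma manifold_atlas: "manifold (atlas G)"
  using smooth_atlas finite_dimensional finite_frame_exists unfolding manifold_def by blast

lemmas manifold_atlas_prod = manifold_prod[OF manifold_atlas manifold_atlas]

lemma in_carrier [simp]: "a \<in> carrier G"
  by (simp add: carrier_UNIV)

lemma smooth_at_mult:
  assumes "manifold A" "smooth_at A (atlas G) p F" "smooth_at A (atlas G) p F'"
  shows "smooth_at A (atlas G) p (\<lambda>q. F q \<otimes> F' q)"
proof -
  have "smooth_at (prod_atlas (atlas G) (atlas G)) (atlas G) (F p, F' p) (\<lambda>(a, b). a \<otimes> b)"
    using smooth_map_onD[OF manifold_atlas_prod manifold_atlas open_UNIV smooth_mult] by simp
  from smooth_at_comp[OF assms(1) manifold_atlas_prod manifold_atlas
      smooth_at_Pair[OF assms(1) manifold_atlas manifold_atlas assms(2,3)] this]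
  show ?thesis by simp
qed

lemma smooth_at_inv:
  assumes "manifold A" "smooth_at A (atlas G) p F"
  shows "smooth_at A (atlas G) p (\<lambda>q. inv F q)"
  by (rule smooth_at_comp[OF assms(1) manifold_atlas manifold_atlas assms(2)
        smooth_map_onD[OF manifold_atlas manifold_atlas open_UNIV smooth_inv UNIV_I]])

lemma smooth_at_left_mult: "smooth_at (atlas G) (atlas G) p (\<lambda>q. a \<otimes> q)"
  by (intro smooth_at_mult smooth_at_const smooth_at_id manifold_atlas)

lemma smooth_near_left_mult:
  "smooth_near (atlas G) (a \<otimes> p) f \<Longrightarrow> smooth_near (atlas G) p (\<lambda>q. f (a \<otimes> q))"
  by (rule smooth_near_comp[OF manifold_atlas manifold_atlas smooth_at_left_mult])

lemma left_translate_in: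
  "u \<in> tangent_space (atlas G) p \<Longrightarrow> left_translate G a p u \<in> tangent_space (atlas G) (a \<otimes> p)"
  unfolding left_translate_def
  by (rule tangent_map_in_tangent_space[OF manifold_atlas manifold_atlas smooth_at_left_mult])

lemma left_translate_add: "left_translate G a p (u + v) = left_translate G a p u + left_translate G a p v"
  by (simp add: left_translate_def tangent_map_add)

lemma left_translate_scaleR: "left_translate G a p (c *\<^sub>R u) = c *\<^sub>R left_translate G a p u"
  by (simp add: left_translate_def tangent_map_scaleR)

lemma left_translate_comp:
  "left_translate G a (b \<otimes> p) (left_translate G b p u) = left_translate G (a \<otimes> b) p u"
proof -
  have "(\<lambda>q. a \<otimes> (b \<otimes> q)) = (\<lambda>q. a \<otimes> b \<otimes> q)" by (simp add: m_assoc)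
  then show ?thesis
    unfolding left_translate_def tangent_map_comp[OF manifold_atlas manifold_atlas smooth_at_left_mult]
    by (simp only:)
qed

lemma left_translate_one: "u \<in> tangent_space (atlas G) p \<Longrightarrow> left_translate G \<one> p u = u"
  by (simp add: left_translate_def tangent_map_id)

lemma left_translate_apply:
  "smooth_near (atlas G) (a \<otimes> p) f \<Longrightarrow> left_translate G a p u f = u (\<lambda>q. f (a \<otimes> q))"
  by (simp add: left_translate_def tangent_map_def comp_def)

lemma to_lie_algebra_in:
  "u \<in> tangent_space (atlas G) p \<Longrightarrow> to_lie_algebra G p u \<in> lie_algebra G"
  using left_translate_in[of u p "inv p"] by (simp add: to_lie_algebra_def)

lemma to_lie_algebra_add: "to_lie_algebra G p (u + v) = to_lie_algebra G p u + to_lie_algebra G p v"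
  by (simp add: to_lie_algebra_def left_translate_add)

lemma to_lie_algebra_scaleR: "to_lie_algebra G p (c *\<^sub>R u) = c *\<^sub>R to_lie_algebra G p u"
  by (simp add: to_lie_algebra_def left_translate_scaleR)

lemma to_lie_algebra_one: "u \<in> lie_algebra G \<Longrightarrow> to_lie_algebra G \<one> u = u"
  by (simp add: to_lie_algebra_def left_translate_one)

lemma left_translate_to_lie_algebra:
  "u \<in> tangent_space (atlas G) p \<Longrightarrow> left_translate G p \<one> (to_lie_algebra G p u) = u"
  using left_translate_comp[of p "inv p" p u] by (simp add: to_lie_algebra_def left_translate_one)

lemma to_lie_algebra_left_translate:
  "u \<in> tangent_space (atlas G) p \<Longrightarrow> to_lie_algebra G (a \<otimes> p) (left_translate G a p u) = to_lie_algebra G p u"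
  using left_translate_comp[of "inv (a \<otimes> p)" a p u] by (simp add: to_lie_algebra_def inv_mult_group m_assoc)

lemma to_lie_algebra_left_field: "u \<in> lie_algebra G \<Longrightarrow> to_lie_algebra G p (left_field G u p) = u"
  using to_lie_algebra_left_translate[of u \<one> p] by (simp add: left_field_def to_lie_algebra_one)

lemma left_field_to_lie_algebra:
  "u \<in> tangent_space (atlas G) p \<Longrightarrow> left_field G (to_lie_algebra G p u) p = u"
  by (simp add: left_field_def left_translate_to_lie_algebra)

lemma left_field_one: "u \<in> lie_algebra G \<Longrightarrow> left_field G u \<one> = u"
  by (simp add: left_field_def left_translate_one)

lemma left_field_add: "left_field G (u + v) p = left_field G u p + left_field G v p"
  by (simp add: left_field_def left_translate_add)

lemma left_field_scaleR: "left_field G (c *\<^sub>R u) p = c *\<^sub>R left_field G u p"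
  by (simp add: left_field_def left_translate_scaleR)

lemma left_field_mult: "left_field G u (a \<otimes> p) = left_translate G a p (left_field G u p)"
  using left_translate_comp[of a p \<one> u] by (simp add: left_field_def)

text \<open>On f the field has at q the value u applied to r \<mapsto> f(q r): the derivative at the
  identity, in a fixed direction, of a function that depends smoothly on the pair (q, r).\<close>

lemma vector_field_left_field:
  assumes u: "u \<in> lie_algebra G"
  shows "vector_field (atlas G) (left_field G u)"
  unfolding vector_field_iff[OF manifold_atlas]
proof (intro conjI allI impI)
  note m = manifold_atlas
  show "left_field G u p \<in> tangent_space (atlas G) p" for p
    using left_translate_in[OF u, of p] by (simp add: left_field_def)
  fix p f assume f: "smooth_near (atlas G) p f"
  obtain S where S: "open S" "p \<in> S" "\<forall>q\<in>S. smooth_near (atlas G) q f"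
    using smooth_near_nhd[OF m f] by blast
  have F: "smooth_near (prod_atlas (atlas G) (atlas G)) (p, \<one>) (\<lambda>x. f (fst x \<otimes> snd x))"
    by (rule smooth_near_comp[OF manifold_atlas_prod m])
      (use f in \<open>auto intro!: smooth_at_mult smooth_at_projections manifold_atlas_prod m\<close>)
  have "smooth_near (atlas G) p (\<lambda>q. u (\<lambda>r. f (q \<otimes> r)))"
    using smooth_near_parametric[OF m m smooth_at_const[OF m m] u smooth_near_const[OF m] F] by simp
  then show "smooth_near (atlas G) p (\<lambda>q. left_field G u q f)"
    by (rule smooth_near_cong[OF m _ S(1,2)]) (use S(3) in \<open>simp add: left_field_def left_translate_apply\<close>)
qed

text \<open>The value on f is \<open>X q\<close> applied to r \<mapsto> f(q^{-1} r), so q is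
  parameter and base point at once. With coordinates at the identity for f, this is the smoothness
  of the components of X in the left-invariant frame.\<close>

lemma smooth_near_to_lie_algebra:
  assumes X: "vector_field (atlas G) X" and f: "smooth_near (atlas G) \<one> f"
  shows "smooth_near (atlas G) p (\<lambda>q. to_lie_algebra G q (X q) f)"
proof -
  note m = manifold_atlas
  have F: "smooth_near (prod_atlas (atlas G) (atlas G)) (p, p) (\<lambda>x. f (inv (fst x) \<otimes> snd x))"
    by (rule smooth_near_comp[OF manifold_atlas_prod m])
      (use f in \<open>auto intro!: smooth_at_mult smooth_at_inv smooth_at_projections manifold_atlas_prod m\<close>)
  have "smooth_near (atlas G) p (\<lambda>q. X q (\<lambda>r. f (inv q \<otimes> r)))"
    using smooth_near_parametric[OF m m smooth_at_id[OF m] vector_field_tangent[OF X] vector_field_smooth[OF m X] F]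
    by simp
  then show ?thesis
    using f by (simp add: to_lie_algebra_def left_translate_apply)
qed

text \<open>The functions \<open>h b\<close> are coordinates of a chart at the identity, so that the components of a
  vector field in the frame of left-invariant fields are smooth.\<close>

lemma lie_algebra_frame:
  obtains I :: "'v set" and e h where "finite I" "\<And>b. e b \<in> lie_algebra G" "\<And>b. smooth_near (atlas G) \<one> (h b)"
    "\<And>u. u \<in> lie_algebra G \<Longrightarrow> u = (\<Sum>b\<in>I. u (h b) *\<^sub>R e b)"
proof -
  note m = manifold_atlas
  obtain B where B: "finite_frame (B::'v set)" using manifold_frame[OF m] .
  obtain U \<phi> where ch: "(U, \<phi>) \<in> atlas G" "\<one> \<in> U" using manifold_chart_at[OF m] .
  have "u = (\<Sum>b\<in>B. u (\<lambda>q. \<phi> q \<bullet> b) *\<^sub>R chart_vector (atlas G) U \<phi> \<one> b)" if u: "u \<in> lie_algebra G" for u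
  proof
    fix f
    show "u f = (\<Sum>b\<in>B. u (\<lambda>q. \<phi> q \<bullet> b) *\<^sub>R chart_vector (atlas G) U \<phi> \<one> b) f"
    proof (cases "smooth_near (atlas G) \<one> f")
      case True
      then show ?thesis
        using tangent_vector_coordinates[OF m ch B u]
        by (simp add: sum_fun_apply scaleR_fun_def chart_vector_def)
    qed (simp add: sum_fun_apply scaleR_fun_def chart_vector_def tangent_not_smooth[OF u])
  qed
  then show ?thesis
    using that[of B "chart_vector (atlas G) U \<phi> \<one>" "\<lambda>b q. \<phi> q \<bullet> b"] B
      chart_vector_in_tangent_space[OF m ch] smooth_near_coordinate[OF m ch]
    by (simp add: finite_frame_def)
qed

lemma vector_field_expand:
  assumes X: "vector_field (atlas G) X" and I: "finite I"
    and e: "\<And>u. u \<in> lie_algebra G \<Longrightarrow> u = (\<Sum>b\<in>I. u (h b) *\<^sub>R e b)"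
  shows "X = (\<lambda>q. \<Sum>b\<in>I. to_lie_algebra G q (X q) (h b) *\<^sub>R left_field G (e b) q)"
proof
  fix q
  let ?u = "to_lie_algebra G q (X q)"
  have lf: "left_field G (\<Sum>b\<in>I. c b *\<^sub>R e b) q = (\<Sum>b\<in>I. c b *\<^sub>R left_field G (e b) q)" for c
    using I
  proof (induction I)
    case (insert i I)
    then show ?case
      by (simp only: sum.insert[OF insert.hyps] left_field_add left_field_scaleR)
  qed (use left_field_scaleR[of 0 0 q] in \<open>simp only: sum.empty scaleR_zero_left\<close>)
  have "X q = left_field G ?u q"
    by (simp add: left_field_to_lie_algebra vector_field_tangent[OF X])
  also have "\<dots> = left_field G (\<Sum>b\<in>I. ?u (h b) *\<^sub>R e b) q"
    using e[OF to_lie_algebra_in[OF vector_field_tangent[OF X]]] by simp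
  finally show "X q = (\<Sum>b\<in>I. ?u (h b) *\<^sub>R left_field G (e b) q)" by (simp add: lf)
qed

section \<open>Tensorial functionals and the one-forms that they define\<close>

lemma tensorial_at_cong:
  assumes T: "tensorial_at (atlas G) p T" and X: "vector_field (atlas G) X" and Y: "vector_field (atlas G) Y"
    and "X p = Y p"
  shows "T X = T Y"
proof -
  obtain I :: "'v set" and e h where f: "finite I" "\<And>b. e b \<in> lie_algebra G" "\<And>b. smooth_near (atlas G) \<one> (h b)"
    "\<And>u. u \<in> lie_algebra G \<Longrightarrow> u = (\<Sum>b\<in>I. u (h b) *\<^sub>R e b)" using lie_algebra_frame by blast
  have "T Z = (\<Sum>b\<in>I. to_lie_algebra G p (Z p) (h b) * T (left_field G (e b)))" if Z: "vector_field (atlas G) Z" for Z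
    by (subst vector_field_expand[OF Z f(1,4)], assumption)
      (intro tensorial_at_sum[OF manifold_atlas T] smooth_near_to_lie_algebra[OF Z f(3)] vector_field_left_field f(2))
  from this[OF X] this[OF Y] show ?thesis using assms(4) by simp
qed

text \<open>Both functionals see X only through its vector at p, which is also the vector at p of a
  left-invariant field.\<close>

lemma tensorial_at_eq:
  assumes T: "tensorial_at (atlas G) p T" and T': "tensorial_at (atlas G) p T'"
    and "\<And>u. u \<in> lie_algebra G \<Longrightarrow> T (left_field G u) = T' (left_field G u)" and X: "vector_field (atlas G) X"
  shows "T X = T' X"
proof -
  let ?u = "to_lie_algebra G p (X p)"
  have u: "?u \<in> lie_algebra G" by (rule to_lie_algebra_in[OF vector_field_tangent[OF X]])
  have eq: "X p = left_field G ?u p"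
    by (simp add: left_field_to_lie_algebra vector_field_tangent[OF X])
  show ?thesis
    using tensorial_at_cong[OF T X vector_field_left_field[OF u] eq]
      tensorial_at_cong[OF T' X vector_field_left_field[OF u] eq] assms(3)[OF u] by simp
qed

text \<open>This discharges the definite description. For existence, a tangent vector w at p is
  extended to the left-invariant field through w and \<psi> is evaluated there; tensoriality makes
  this linear in w and correct on all fields. For uniqueness, every tangent vector is a value of
  such a field, and off the tangent spaces every one-form vanishes.\<close>

lemma one_form_of:
  assumes s: "\<And>Z p. vector_field (atlas G) Z \<Longrightarrow> smooth_near (atlas G) p (\<psi> Z)"
    and t: "\<And>p. tensorial_at (atlas G) p (\<lambda>Z. \<psi> Z p)"
  shows "one_form (atlas G) (one_form_of (atlas G) \<psi>)"
    and "vector_field (atlas G) Z \<Longrightarrow> one_form_of (atlas G) \<psi> p (Z p) = \<psi> Z p"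
proof -
  let ?A = "atlas G"
  note m = manifold_atlas and lf = vector_field_left_field[OF to_lie_algebra_in]
  define \<zeta> where "\<zeta> = (\<lambda>p w. if w \<in> tangent_space ?A p then \<psi> (left_field G (to_lie_algebra G p w)) p else 0)"
  have val: "\<zeta> p (Z p) = \<psi> Z p" if Z: "vector_field ?A Z" for Z p
  proof -
    note w = vector_field_tangent[OF Z, of p]
    have "\<psi> (left_field G (to_lie_algebra G p (Z p))) p = \<psi> Z p"
      by (rule tensorial_at_cong[OF t lf[OF w] Z]) (simp add: left_field_to_lie_algebra w)
    then show ?thesis using w by (simp add: \<zeta>_def)
  qed
  have dual: "\<zeta> p \<in> cotangent_space ?A p" for p
    unfolding dual_space_def
  proof (intro CollectI conjI ballI allI impI)
    show "\<zeta> p (u + v) = \<zeta> p u + \<zeta> p v" if u: "u \<in> tangent_space ?A p" and v: "v \<in> tangent_space ?A p" for u v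
    proof -
      have "\<psi> (left_field G (to_lie_algebra G p (u + v))) p =
          \<psi> (\<lambda>q. left_field G (to_lie_algebra G p u) q + left_field G (to_lie_algebra G p v) q) p"
        by (simp add: to_lie_algebra_add left_field_add[abs_def])
      also have "\<dots> = \<psi> (left_field G (to_lie_algebra G p u)) p + \<psi> (left_field G (to_lie_algebra G p v)) p"
        by (rule tensorial_atD(1)[OF t lf[OF u] lf[OF v]])
      finally show ?thesis using u v by (simp add: \<zeta>_def tangent_add[OF m])
    qed
    show "\<zeta> p (c *\<^sub>R u) = c * \<zeta> p u" if u: "u \<in> tangent_space ?A p" for c u
    proof -
      have "\<psi> (left_field G (to_lie_algebra G p (c *\<^sub>R u))) p =
          \<psi> (\<lambda>q. c *\<^sub>R left_field G (to_lie_algebra G p u) q) p"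
        by (simp add: to_lie_algebra_scaleR left_field_scaleR[abs_def])
      also have "\<dots> = c * \<psi> (left_field G (to_lie_algebra G p u)) p"
        by (rule tensorial_atD(2)[OF t smooth_near_const[OF m] lf[OF u]])
      finally show ?thesis using u by (simp add: \<zeta>_def tangent_scaleR[OF m])
    qed
    show "\<zeta> p u = 0" if "u \<notin> tangent_space ?A p" for u using that by (simp add: \<zeta>_def)
  qed
  have form: "one_form ?A \<zeta>"
    unfolding one_form_def using dual s by (simp add: smooth_fun_on_iff[OF m] val)
  have unique: "\<zeta>' = \<zeta>" if \<zeta>': "one_form ?A \<zeta>'" "\<forall>Z p. vector_field ?A Z \<longrightarrow> \<zeta>' p (Z p) = \<psi> Z p" for \<zeta>'
  proof (intro ext)
    fix p w
    show "\<zeta>' p w = \<zeta> p w"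
    proof (cases "w \<in> tangent_space ?A p")
      case True
      then show ?thesis
        using \<zeta>'(2)[rule_format, OF lf[OF True], of p] by (simp add: \<zeta>_def left_field_to_lie_algebra)
    next
      case False
      then show ?thesis using dual_spaceD(3)[OF one_form_dual[OF \<zeta>'(1)]] by (simp add: \<zeta>_def)
    qed
  qed
  have "one_form_of ?A \<psi> = \<zeta>"
    unfolding one_form_of_def
  proof (rule the_equality)
    show "one_form ?A \<zeta> \<and> (\<forall>Z p. vector_field ?A Z \<longrightarrow> \<zeta> p (Z p) = \<psi> Z p)" using form val by blast
    show "\<zeta>' = \<zeta>" if "one_form ?A \<zeta>' \<and> (\<forall>Z p. vector_field ?A Z \<longrightarrow> \<zeta>' p (Z p) = \<psi> Z p)" for \<zeta>'
      using unique that by blast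
  qed
  then show "one_form ?A (one_form_of ?A \<psi>)" "vector_field ?A Z \<Longrightarrow> one_form_of ?A \<psi> p (Z p) = \<psi> Z p"
    using form val by auto
qed

lemma lie_derivative_form:
  assumes X: "vector_field (atlas G) X" and \<eta>: "one_form (atlas G) \<eta>"
  shows "one_form (atlas G) (lie_derivative_form (atlas G) X \<eta>)"
    and "vector_field (atlas G) Z \<Longrightarrow> lie_derivative_form (atlas G) X \<eta> p (Z p) =
      X p (\<lambda>q. \<eta> q (Z q)) - \<eta> p (lie_bracket (atlas G) X Z p)"
proof -
  have s: "smooth_near (atlas G) p (\<lambda>p. X p (\<lambda>q. \<eta> q (Z q)) - \<eta> p (lie_bracket (atlas G) X Z p))"
    if Z: "vector_field (atlas G) Z" for Z p
    by (intro smooth_near_diff[OF manifold_atlas] vector_field_smooth[OF manifold_atlas X]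
        one_form_smooth[OF manifold_atlas \<eta>] vector_field_lie_bracket[OF manifold_atlas X] Z)
  show "one_form (atlas G) (lie_derivative_form (atlas G) X \<eta>)"
    "vector_field (atlas G) Z \<Longrightarrow> lie_derivative_form (atlas G) X \<eta> p (Z p) =
      X p (\<lambda>q. \<eta> q (Z q)) - \<eta> p (lie_bracket (atlas G) X Z p)"
    unfolding lie_derivative_form_def
    by (rule one_form_of[OF s tensorial_lie_derivative[OF manifold_atlas X \<eta>]]; assumption)+
qed

lemma contract_d1:
  assumes Y: "vector_field (atlas G) Y" and \<xi>: "one_form (atlas G) \<xi>"
  shows "one_form (atlas G) (contract_d1 (atlas G) Y \<xi>)"
    and "vector_field (atlas G) Z \<Longrightarrow> contract_d1 (atlas G) Y \<xi> p (Z p) = ext_d1 (atlas G) \<xi> Y Z p"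
proof -
  have s: "smooth_near (atlas G) p (ext_d1 (atlas G) \<xi> Y Z)" if Z: "vector_field (atlas G) Z" for Z p
    unfolding ext_d1_def[abs_def]
    by (intro smooth_near_diff[OF manifold_atlas] vector_field_smooth[OF manifold_atlas Y]
        vector_field_smooth[OF manifold_atlas Z] one_form_smooth[OF manifold_atlas \<xi>]
        vector_field_lie_bracket[OF manifold_atlas Y Z] Y Z)
  show "one_form (atlas G) (contract_d1 (atlas G) Y \<xi>)"
    "vector_field (atlas G) Z \<Longrightarrow> contract_d1 (atlas G) Y \<xi> p (Z p) = ext_d1 (atlas G) \<xi> Y Z p"
    unfolding contract_d1_def
    by (rule one_form_of[OF s tensorial_ext_d1[OF manifold_atlas Y \<xi>]]; assumption)+
qed

text \<open>Left-invariant fields commute with composition by left translation, so the bracket at a,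
  applied to f, is the bracket at the identity applied to q \<mapsto> f(a q).\<close>

lemma lie_bracket_left_field:
  assumes u: "u \<in> lie_algebra G" and v: "v \<in> lie_algebra G"
  shows "lie_bracket (atlas G) (left_field G u) (left_field G v) a = left_field G (lie_algebra_bracket G u v) a"
proof
  fix f
  let ?A = "atlas G"
  note m = manifold_atlas
  show "lie_bracket ?A (left_field G u) (left_field G v) a f = left_field G (lie_algebra_bracket G u v) a f"
  proof (cases "smooth_near ?A a f")
    case f: True
    define g where "g = (\<lambda>q. f (a \<otimes> q))"
    have g: "smooth_near ?A \<one> g" unfolding g_def by (rule smooth_near_left_mult) (simp add: f)
    obtain S where S: "open S" "a \<in> S" "\<forall>q\<in>S. smooth_near ?A q f"
      using smooth_near_nhd[OF m f] by blast
    obtain S' where S': "open S'" "\<one> \<in> S'" "continuous_on S' (\<lambda>q. a \<otimes> q)"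
      using smooth_at_left_mult[of \<one> a] unfolding smooth_at_def smooth_map_on_def by blast
    \<comment> \<open>A field acts on f composed with translation in the expected way only where f
      is smooth, so the comparison is restricted to a neighbourhood of the identity that translation
      by a maps into S.\<close>
    have N: "open (S' \<inter> (\<lambda>q. a \<otimes> q) -` S)" "\<one> \<in> S' \<inter> (\<lambda>q. a \<otimes> q) -` S"
      using continuous_open_preimage[OF S'(3,1) S(1)] S'(2) S(2) by auto
    have *: "left_field G x a (\<lambda>q. left_field G y q f) = left_field G x \<one> (\<lambda>q. left_field G y q g)"
      if x: "x \<in> lie_algebra G" and y: "y \<in> lie_algebra G" for x y
    proof -
      have "left_field G x a (\<lambda>q. left_field G y q f) = x (\<lambda>q. left_field G y (a \<otimes> q) f)"
        using vector_field_smooth[OF m vector_field_left_field[OF y] f]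
        by (simp add: left_field_def[of G x] left_translate_apply)
      also have "\<dots> = x (\<lambda>q. left_field G y q g)"
        by (rule tangent_local[OF m x N])
          (use S(3) in \<open>simp add: left_field_mult left_translate_apply g_def\<close>)
      finally show ?thesis by (simp add: left_field_one[OF x])
    qed
    have "left_field G (lie_algebra_bracket G u v) a f = lie_algebra_bracket G u v g"
      using f by (simp add: left_field_def left_translate_apply g_def)
    also have "\<dots> = lie_bracket ?A (left_field G u) (left_field G v) a f"
      using f g by (simp add: lie_algebra_bracket_def lie_bracket_def *[OF u v] *[OF v u])
    finally show ?thesis by simp
  qed (simp add: lie_bracket_def left_field_def left_translate_def tangent_map_def)
qed

lemma lie_algebra_bracket_in:
  "u \<in> lie_algebra G \<Longrightarrow> v \<in> lie_algebra G \<Longrightarrow> lie_algebra_bracket G u v \<in> lie_algebra G"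
  unfolding lie_algebra_bracket_def
  by (intro lie_bracket_in_tangent_space manifold_atlas vector_field_left_field)

lemma lie_algebra_bracket_skew: "lie_algebra_bracket G u v = - lie_algebra_bracket G v u"
  unfolding lie_algebra_bracket_def by (rule lie_bracket_skew)

lemma lie_algebra_bracket_add:
  assumes "u \<in> lie_algebra G" "v \<in> lie_algebra G" "w \<in> lie_algebra G"
  shows "lie_algebra_bracket G u (v + w) = lie_algebra_bracket G u v + lie_algebra_bracket G u w"
  using lie_bracket_add[OF manifold_atlas assms[THEN vector_field_left_field]]
  by (simp add: lie_algebra_bracket_def left_field_add[abs_def])

lemma lie_algebra_bracket_scaleR:
  assumes "u \<in> lie_algebra G" "v \<in> lie_algebra G"
  shows "lie_algebra_bracket G u (c *\<^sub>R v) = c *\<^sub>R lie_algebra_bracket G u v"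
  using lie_bracket_scaleR[OF manifold_atlas assms[THEN vector_field_left_field] smooth_near_const[OF manifold_atlas]]
    tangent_vector_const[OF manifold_atlas vector_field_tangent[OF vector_field_left_field[OF assms(1)]]]
  by (simp add: lie_algebra_bracket_def left_field_scaleR[abs_def])

end

section \<open>Two-forms\<close>

lemma bilinear_formsD:
  assumes "\<beta> \<in> bilinear_forms V"
  shows "\<beta> u \<in> dual_space V" and "(\<lambda>u. \<beta> u v) \<in> dual_space V"
    and "u \<in> V \<Longrightarrow> v \<in> V \<Longrightarrow> \<beta> (u + v) w = \<beta> u w + \<beta> v w" and "u \<in> V \<Longrightarrow> \<beta> (c *\<^sub>R u) w = c * \<beta> u w"
    and "u \<in> V \<Longrightarrow> v \<in> V \<Longrightarrow> \<beta> w (u + v) = \<beta> w u + \<beta> w v" and "u \<in> V \<Longrightarrow> \<beta> w (c *\<^sub>R u) = c * \<beta> w u"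
    and "u \<notin> V \<Longrightarrow> \<beta> u w = 0" and "u \<notin> V \<Longrightarrow> \<beta> w u = 0"
  using assms dual_spaceD[of "\<lambda>u. \<beta> u w" V] dual_spaceD[of "\<beta> w" V]
  unfolding bilinear_forms_def by simp_all

lemma alternating_forms2_skew:
  assumes "subspace V" "\<beta> \<in> alternating_forms2 V"
  shows "\<beta> u v = - \<beta> v u"
proof -
  have b: "\<beta> \<in> bilinear_forms V" and z: "\<beta> w w = 0" for w
    using assms(2) by (auto simp: alternating_forms2_def)
  note l = bilinear_formsD[OF b]
  show ?thesis
  proof (cases "u \<in> V \<and> v \<in> V")
    case True
    then have "\<beta> (u + v) (u + v) = \<beta> u u + \<beta> u v + (\<beta> v u + \<beta> v v)"
      using subspace_add[OF assms(1)] by (simp only: l(3,5))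
    then show ?thesis by (simp add: z)
  qed (auto simp: l(7,8))
qed

definition two_form ::
  "('a::topological_space, 'v::real_inner) atlas \<Rightarrow> ('a \<Rightarrow> 'a tangent \<Rightarrow> 'a tangent \<Rightarrow> real) \<Rightarrow> bool" where
  "two_form A \<beta> \<longleftrightarrow> (\<forall>p. \<beta> p \<in> alternating_forms2 (tangent_space A p)) \<and>
     (\<forall>X Y p. vector_field A X \<and> vector_field A Y \<longrightarrow> smooth_near A p (\<lambda>q. \<beta> q (X q) (Y q)))"

lemma two_formD:
  assumes "manifold A" "two_form A \<beta>"
  shows "\<beta> p \<in> bilinear_forms (tangent_space A p)"
    and "\<beta> p u v = - \<beta> p v u"
    and "vector_field A X \<Longrightarrow> vector_field A Y \<Longrightarrow> smooth_near A p (\<lambda>q. \<beta> q (X q) (Y q))"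
  using assms(2) alternating_forms2_skew[OF subspace_tangent_space[OF assms(1)]]
  unfolding two_form_def alternating_forms2_def by blast+

definition ext_d2 ::
  "('a::topological_space, 'v::real_inner) atlas \<Rightarrow> ('a \<Rightarrow> 'a tangent \<Rightarrow> 'a tangent \<Rightarrow> real)
     \<Rightarrow> ('a \<Rightarrow> 'a tangent) \<Rightarrow> ('a \<Rightarrow> 'a tangent) \<Rightarrow> ('a \<Rightarrow> 'a tangent) \<Rightarrow> 'a \<Rightarrow> real" where
  "ext_d2 A \<beta> X Y Z p =
       X p (\<lambda>q. \<beta> q (Y q) (Z q)) - Y p (\<lambda>q. \<beta> q (X q) (Z q)) + Z p (\<lambda>q. \<beta> q (X q) (Y q))
     - \<beta> p (lie_bracket A X Y p) (Z p) + \<beta> p (lie_bracket A X Z p) (Y p) - \<beta> p (lie_bracket A Y Z p) (X p)"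

lemma two_form_neg_field:
  assumes m: "manifold A" and \<beta>: "two_form A \<beta>" and X: "vector_field A X" and Y: "vector_field A Y"
    and W: "vector_field A W"
  shows "W p (\<lambda>q. \<beta> q (Y q) (X q)) = - W p (\<lambda>q. \<beta> q (X q) (Y q))"
proof -
  have "(\<lambda>q. \<beta> q (Y q) (X q)) = (\<lambda>q. - \<beta> q (X q) (Y q))"
    using two_formD(2)[OF m \<beta>] by blast
  then show ?thesis
    using tangent_vector_minus[OF m vector_field_tangent[OF W] two_formD(3)[OF m \<beta> X Y]] by simp
qed

text \<open>Tensoriality is proved in the last argument alone; rotating the arguments transfers it
  to the other two.\<close>

lemma ext_d2_cyclic:
  assumes m: "manifold A" and \<beta>: "two_form A \<beta>" and v: "vector_field A X" "vector_field A Y" "vector_field A Z"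
  shows "ext_d2 A \<beta> X Y Z p = ext_d2 A \<beta> Y Z X p"
proof -
  have b: "\<beta> p (lie_bracket A V W p) U = - \<beta> p (lie_bracket A W V p) U"
    if "vector_field A V" "vector_field A W" for U V W
  proof -
    note t = lie_bracket_in_tangent_space[OF m that(2,1), of p]
    have "\<beta> p ((-1) *\<^sub>R lie_bracket A W V p) U = -1 * \<beta> p (lie_bracket A W V p) U"
      by (rule bilinear_formsD(4)[OF two_formD(1)[OF m \<beta>] t])
    moreover have "(-1) *\<^sub>R lie_bracket A W V p = lie_bracket A V W p"
      by (subst lie_bracket_skew) (simp only: scaleR_minus_left scaleR_one minus_minus)
    ultimately show ?thesis by simp
  qed
  show ?thesis
    unfolding ext_d2_def
    using two_form_neg_field[OF m \<beta> v(1,2,3), of p] two_form_neg_field[OF m \<beta> v(1,3,2), of p]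
      b[OF v(1,2), of "Z p"] b[OF v(1,3), of "Y p"] by linarith
qed

text \<open>For h Z the derivatives of h along X and Y appear with the factors \<beta>(Y, Z) and
  \<beta>(X, Z) from the functions and with \<beta>(Z, Y) and \<beta>(Z, X) from the brackets;
  skewness of \<beta> cancels them.\<close>

lemma tensorial_ext_d2:
  assumes m: "manifold A" and \<beta>: "two_form A \<beta>" and X: "vector_field A X" and Y: "vector_field A Y"
  shows "tensorial_at A p (\<lambda>Z. ext_d2 A \<beta> X Y Z p)"
  unfolding tensorial_at_def
proof (intro conjI allI impI; elim conjE)
  note t = vector_field_tangent and b = bilinear_formsD[OF two_formD(1)[OF m \<beta>]] and s = two_formD(3)[OF m \<beta>]
  note br = lie_bracket_in_tangent_space[OF m]
  show "ext_d2 A \<beta> X Y (\<lambda>q. Z q + W q) p = ext_d2 A \<beta> X Y Z p + ext_d2 A \<beta> X Y W p"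
    if Z: "vector_field A Z" and W: "vector_field A W" for Z W
  proof -
    have 1: "X p (\<lambda>q. \<beta> q (Y q) (Z q + W q)) = X p (\<lambda>q. \<beta> q (Y q) (Z q)) + X p (\<lambda>q. \<beta> q (Y q) (W q))"
      using tangent_vector_add[OF m t[OF X] s[OF Y Z] s[OF Y W]] by (simp only: b(5) t[OF Z] t[OF W])
    have 2: "Y p (\<lambda>q. \<beta> q (X q) (Z q + W q)) = Y p (\<lambda>q. \<beta> q (X q) (Z q)) + Y p (\<lambda>q. \<beta> q (X q) (W q))"
      using tangent_vector_add[OF m t[OF Y] s[OF X Z] s[OF X W]] by (simp only: b(5) t[OF Z] t[OF W])
    have 3: "\<beta> p U (Z p + W p) = \<beta> p U (Z p) + \<beta> p U (W p)" for U
      by (rule b(5)[OF t[OF Z] t[OF W]])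
    have 4: "\<beta> p (lie_bracket A V (\<lambda>q. Z q + W q) p) U = \<beta> p (lie_bracket A V Z p) U + \<beta> p (lie_bracket A V W p) U"
      if V: "vector_field A V" for V U
      by (simp only: lie_bracket_add[OF m V Z W] b(3)[OF br[OF V Z] br[OF V W]])
    show ?thesis
      unfolding ext_d2_def 1 2 3 4[OF X] 4[OF Y] by simp
  qed
  show "ext_d2 A \<beta> X Y (\<lambda>q. h q *\<^sub>R Z q) p = h p * ext_d2 A \<beta> X Y Z p"
    if h: "\<forall>q. smooth_near A q h" and Z: "vector_field A Z" for h Z
  proof -
    have 1: "X p (\<lambda>q. \<beta> q (Y q) (h q *\<^sub>R Z q)) = h p * X p (\<lambda>q. \<beta> q (Y q) (Z q)) + \<beta> p (Y p) (Z p) * X p h"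
      using tangent_vector_mult[OF m t[OF X] h[rule_format] s[OF Y Z]] by (simp only: b(6) t[OF Z])
    have 2: "Y p (\<lambda>q. \<beta> q (X q) (h q *\<^sub>R Z q)) = h p * Y p (\<lambda>q. \<beta> q (X q) (Z q)) + \<beta> p (X p) (Z p) * Y p h"
      using tangent_vector_mult[OF m t[OF Y] h[rule_format] s[OF X Z]] by (simp only: b(6) t[OF Z])
    have 3: "\<beta> p U (h p *\<^sub>R Z p) = h p * \<beta> p U (Z p)" for U
      by (rule b(6)[OF t[OF Z]])
    have 4: "\<beta> p (lie_bracket A V (\<lambda>q. h q *\<^sub>R Z q) p) U = h p * \<beta> p (lie_bracket A V Z p) U + V p h * \<beta> p (Z p) U"
      if V: "vector_field A V" for V U
      by (simp only: lie_bracket_scaleR[OF m V Z h[rule_format]] b(3)[OF tangent_scaleR[OF m br[OF V Z]] tangent_scaleR[OF m t[OF Z]]]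
          b(4)[OF br[OF V Z]] b(4)[OF t[OF Z]])
    have 5: "(h p *\<^sub>R Z p) k = h p * Z p k" for k by (simp add: scaleR_fun_def)
    show ?thesis
      unfolding ext_d2_def 1 2 3 4[OF X] 4[OF Y] 5
      using two_formD(2)[OF m \<beta>, of p "Z p" "X p"] two_formD(2)[OF m \<beta>, of p "Z p" "Y p"]
      by (simp add: algebra_simps)
  qed
qed

text \<open>The square of the exterior derivative vanishes: iterated derivatives combine to
  derivatives along brackets, double brackets drop out by the Jacobi identity, and values of \<beta>
  on two brackets cancel in pairs by skewness. The tensor field \<omega> is introduced because
  \<open>ext_d3\<close> acts on tensor fields, whereas \<open>ext_d2\<close> yields a function of
  vector fields.\<close>

lemma ext_d2_ext_d2:
  assumes m: "manifold A" and \<beta>: "two_form A \<beta>"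
    and \<omega>: "\<And>X Y Z q. vector_field A X \<Longrightarrow> vector_field A Y \<Longrightarrow> vector_field A Z \<Longrightarrow>
      \<omega> q (X q) (Y q) (Z q) = ext_d2 A \<beta> X Y Z q"
    and v: "vector_field A X" "vector_field A Y" "vector_field A Z" "vector_field A W"
  shows "ext_d3 A \<omega> X Y Z W p = 0"
proof -
  note t = vector_field_tangent and b = bilinear_formsD[OF two_formD(1)[OF m \<beta>]] and s = two_formD(3)[OF m \<beta>]
  note brf = vector_field_lie_bracket[OF m]
  have sm: "smooth_near A p (\<lambda>q. V q (\<lambda>q. \<beta> q (V1 q) (V2 q)))" if "vector_field A V" "vector_field A V1" "vector_field A V2" for V V1 V2
    by (rule vector_field_smooth[OF m that(1) s[OF that(2,3)]])
  have D: "V p (\<lambda>q. \<omega> q (V1 q) (V2 q) (V3 q)) =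
       V p (\<lambda>q. V1 q (\<lambda>q. \<beta> q (V2 q) (V3 q))) - V p (\<lambda>q. V2 q (\<lambda>q. \<beta> q (V1 q) (V3 q)))
     + V p (\<lambda>q. V3 q (\<lambda>q. \<beta> q (V1 q) (V2 q)))
     - V p (\<lambda>q. \<beta> q (lie_bracket A V1 V2 q) (V3 q)) + V p (\<lambda>q. \<beta> q (lie_bracket A V1 V3 q) (V2 q))
     - V p (\<lambda>q. \<beta> q (lie_bracket A V2 V3 q) (V1 q))"
    if V: "vector_field A V" "vector_field A V1" "vector_field A V2" "vector_field A V3" for V V1 V2 V3
  proof -
    note sm' = sm[OF V(2,3,4)] sm[OF V(3,2,4)] sm[OF V(4,2,3)]
      s[OF brf[OF V(2,3)] V(4)] s[OF brf[OF V(2,4)] V(3)] s[OF brf[OF V(3,4)] V(2)]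
    show ?thesis
      unfolding \<omega>[OF V(2,3,4)] ext_d2_def
      by (simp add: tangent_vector_diff[OF m t[OF V(1)]] tangent_vector_add[OF m t[OF V(1)]]
          smooth_near_diff[OF m] smooth_near_add[OF m] sm')
  qed
  have br: "lie_bracket A V1 V2 p (\<lambda>q. \<beta> q (V q) (V' q)) =
      V1 p (\<lambda>q. V2 q (\<lambda>q. \<beta> q (V q) (V' q))) - V2 p (\<lambda>q. V1 q (\<lambda>q. \<beta> q (V q) (V' q)))"
    if "vector_field A V" "vector_field A V'" for V1 V2 V V'
    using s[OF that] by (simp add: lie_bracket_def)
  have jac: "\<beta> p (lie_bracket A (lie_bracket A V1 V2) V3 p) (V p) - \<beta> p (lie_bracket A (lie_bracket A V1 V3) V2 p) (V p)
      + \<beta> p (lie_bracket A (lie_bracket A V2 V3) V1 p) (V p) = 0"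
    if V: "vector_field A V1" "vector_field A V2" "vector_field A V3" for V1 V2 V3 V
  proof -
    let ?a = "lie_bracket A (lie_bracket A V1 V2) V3 p" and ?b = "lie_bracket A (lie_bracket A V1 V3) V2 p"
      and ?c = "lie_bracket A (lie_bracket A V2 V3) V1 p"
    have in_T: "?a \<in> tangent_space A p" "?b \<in> tangent_space A p" "?c \<in> tangent_space A p"
      by (intro lie_bracket_in_tangent_space[OF m] brf V)+
    \<comment> \<open>The Jacobi identity is put in a form with sums only, since \<beta> is known to
      be additive on the tangent space.\<close>
    have "?a + ?c = ?b" using lie_bracket_jacobi[OF m V, of p] by (simp only: diff_add_eq eq_iff_diff_eq_0[of "?a + ?c"])
    then have "\<beta> p (?a + ?c) (V p) = \<beta> p ?b (V p)" by (simp only:)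
    then show ?thesis using b(3)[OF in_T(1,3), of "V p"] by linarith
  qed
  have om: "\<omega> p (lie_bracket A V1 V2 p) (V3 p) (V4 p) = ext_d2 A \<beta> (lie_bracket A V1 V2) V3 V4 p"
    if "vector_field A V1" "vector_field A V2" "vector_field A V3" "vector_field A V4" for V1 V2 V3 V4
    by (rule \<omega>[OF brf[OF that(1,2)] that(3,4)])
  have sk: "\<beta> p (lie_bracket A V1 V2 p) (lie_bracket A V3 V4 p) = - \<beta> p (lie_bracket A V3 V4 p) (lie_bracket A V1 V2 p)" for V1 V2 V3 V4
    by (rule two_formD(2)[OF m \<beta>])
  show ?thesis
    unfolding ext_d3_def D[OF v(1,2,3,4)] D[OF v(2,1,3,4)] D[OF v(3,1,2,4)] D[OF v(4,1,2,3)]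
      om[OF v(1,2,3,4)] om[OF v(1,3,2,4)] om[OF v(1,4,2,3)] om[OF v(2,3,1,4)] om[OF v(2,4,1,3)] om[OF v(3,4,1,2)]
      ext_d2_def
      br[OF v(3,4)] br[OF v(2,4)] br[OF v(2,3)] br[OF v(1,4)] br[OF v(1,3)] br[OF v(1,2)]
    using jac[OF v(1,2,3), of W] jac[OF v(1,2,4), of Z] jac[OF v(1,3,4), of Y] jac[OF v(2,3,4), of X]
      sk[of X Y Z W] sk[of X Z Y W] sk[of X W Y Z]
    by linarith
qed

section \<open>Left-invariant tensor fields\<close>

definition left_tensor2 ::
  "('a::topological_space, 'v::real_normed_vector) lie_group_data
     \<Rightarrow> ('a tangent \<Rightarrow> 'a tangent \<Rightarrow> real) \<Rightarrow> 'a \<Rightarrow> 'a tangent \<Rightarrow> 'a tangent \<Rightarrow> real" where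
  "left_tensor2 G \<beta> p u v =
     (if u \<in> tangent_space (atlas G) p \<and> v \<in> tangent_space (atlas G) p
      then \<beta> (to_lie_algebra G p u) (to_lie_algebra G p v) else 0)"

definition left_tensor3 ::
  "('a::topological_space, 'v::real_normed_vector) lie_group_data
     \<Rightarrow> ('a tangent \<Rightarrow> 'a tangent \<Rightarrow> 'a tangent \<Rightarrow> real)
     \<Rightarrow> 'a \<Rightarrow> 'a tangent \<Rightarrow> 'a tangent \<Rightarrow> 'a tangent \<Rightarrow> real" where
  "left_tensor3 G \<omega> p u v w =
     (if u \<in> tangent_space (atlas G) p \<and> v \<in> tangent_space (atlas G) p \<and> w \<in> tangent_space (atlas G) p
      then \<omega> (to_lie_algebra G p u) (to_lie_algebra G p v) (to_lie_algebra G p w) else 0)"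

lemma trilinear_formsD:
  assumes "\<omega> \<in> trilinear_forms V"
  shows "\<omega> u v \<in> dual_space V" and "(\<lambda>v. \<omega> u v w) \<in> dual_space V" and "(\<lambda>u. \<omega> u v w) \<in> dual_space V"
    and "\<omega> u \<in> bilinear_forms V"
  using assms by (auto simp: trilinear_forms_def bilinear_forms_def)

context lie_group
begin

lemma left_tensor2_one: "\<beta> \<in> bilinear_forms (lie_algebra G) \<Longrightarrow> left_tensor2 G \<beta> \<one> = \<beta>"
  by (auto simp: left_tensor2_def fun_eq_iff to_lie_algebra_one bilinear_formsD)

lemma left_tensor2_left_translate:
  "u \<in> tangent_space (atlas G) p \<Longrightarrow> v \<in> tangent_space (atlas G) p \<Longrightarrow>
    left_tensor2 G \<beta> (a \<otimes> p) (left_translate G a p u) (left_translate G a p v) = left_tensor2 G \<beta> p u v"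
  by (simp add: left_tensor2_def left_translate_in to_lie_algebra_left_translate)

lemma left_tensor3_left_translate:
  "u \<in> tangent_space (atlas G) p \<Longrightarrow> v \<in> tangent_space (atlas G) p \<Longrightarrow> w \<in> tangent_space (atlas G) p \<Longrightarrow>
    left_tensor3 G \<omega> (a \<otimes> p) (left_translate G a p u) (left_translate G a p v) (left_translate G a p w) =
    left_tensor3 G \<omega> p u v w"
  by (simp add: left_tensor3_def left_translate_in to_lie_algebra_left_translate)

lemma left_tensor2_left_field:
  "u \<in> lie_algebra G \<Longrightarrow> v \<in> lie_algebra G \<Longrightarrow> left_tensor2 G \<beta> p (left_field G u p) (left_field G v p) = \<beta> u v"
  by (simp add: left_tensor2_def to_lie_algebra_left_field vector_field_tangent[OF vector_field_left_field])

lemma left_tensor3_left_field: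
  "u \<in> lie_algebra G \<Longrightarrow> v \<in> lie_algebra G \<Longrightarrow> w \<in> lie_algebra G \<Longrightarrow>
    left_tensor3 G \<omega> p (left_field G u p) (left_field G v p) (left_field G w p) = \<omega> u v w"
  by (simp add: left_tensor3_def to_lie_algebra_left_field vector_field_tangent[OF vector_field_left_field])

lemma dual_space_to_lie_algebra:
  assumes "\<alpha> \<in> dual_space (lie_algebra G)"
  shows "(\<lambda>u. if u \<in> tangent_space (atlas G) p then \<alpha> (to_lie_algebra G p u) else 0) \<in> cotangent_space (atlas G) p"
  using dual_spaceD[OF assms] to_lie_algebra_in[of _ p]
  unfolding dual_space_def[of "tangent_space (atlas G) p"]
  by (simp add: to_lie_algebra_add to_lie_algebra_scaleR tangent_add[OF manifold_atlas] tangent_scaleR[OF manifold_atlas])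

lemma left_tensor2_bilinear:
  assumes "\<beta> \<in> bilinear_forms (lie_algebra G)"
  shows "left_tensor2 G \<beta> p \<in> bilinear_forms (tangent_space (atlas G) p)"
proof -
  let ?T = "tangent_space (atlas G) p"
  have "(\<lambda>u. left_tensor2 G \<beta> p u v) \<in> dual_space ?T" for v
  proof (cases "v \<in> ?T")
    case True
    then show ?thesis
      using dual_space_to_lie_algebra[OF bilinear_formsD(2)[OF assms], of p "to_lie_algebra G p v"]
      by (simp add: left_tensor2_def)
  qed (simp add: left_tensor2_def zero_dual_space)
  moreover have "left_tensor2 G \<beta> p u \<in> dual_space ?T" for u
  proof (cases "u \<in> ?T")
    case True
    then have "left_tensor2 G \<beta> p u = (\<lambda>v. if v \<in> ?T then \<beta> (to_lie_algebra G p u) (to_lie_algebra G p v) else 0)"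
      by (auto simp: left_tensor2_def fun_eq_iff)
    then show ?thesis
      using dual_space_to_lie_algebra[OF bilinear_formsD(1)[OF assms], of p "to_lie_algebra G p u"] by (simp only:)
  next
    case False
    then have "left_tensor2 G \<beta> p u = (\<lambda>v. 0)"
      by (auto simp: left_tensor2_def fun_eq_iff)
    then show ?thesis using zero_dual_space by (simp only:)
  qed
  ultimately show ?thesis unfolding bilinear_forms_def by blast
qed

lemma left_tensor3_trilinear:
  assumes "\<omega> \<in> trilinear_forms (lie_algebra G)"
  shows "left_tensor3 G \<omega> p \<in> trilinear_forms (tangent_space (atlas G) p)"
proof -
  let ?T = "tangent_space (atlas G) p" and ?\<tau> = "to_lie_algebra G p"
  have e: "(\<lambda>u. left_tensor3 G \<omega> p u v w) = (if v \<in> ?T \<and> w \<in> ?T then (\<lambda>u. if u \<in> ?T then \<omega> (?\<tau> u) (?\<tau> v) (?\<tau> w) else 0) else (\<lambda>u. 0))"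
    "(\<lambda>v. left_tensor3 G \<omega> p u v w) = (if u \<in> ?T \<and> w \<in> ?T then (\<lambda>v. if v \<in> ?T then \<omega> (?\<tau> u) (?\<tau> v) (?\<tau> w) else 0) else (\<lambda>u. 0))"
    "left_tensor3 G \<omega> p u v = (if u \<in> ?T \<and> v \<in> ?T then (\<lambda>w. if w \<in> ?T then \<omega> (?\<tau> u) (?\<tau> v) (?\<tau> w) else 0) else (\<lambda>u. 0))"
    for u v w
    by (auto simp: left_tensor3_def fun_eq_iff)
  show ?thesis
    unfolding trilinear_forms_def
  proof (intro CollectI conjI allI)
    show "(\<lambda>u. left_tensor3 G \<omega> p u v w) \<in> dual_space ?T" for v w
      unfolding e(1) by (simp add: zero_dual_space dual_space_to_lie_algebra[OF trilinear_formsD(3)[OF assms]])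
    show "(\<lambda>v. left_tensor3 G \<omega> p u v w) \<in> dual_space ?T" for u w
      unfolding e(2) by (simp add: zero_dual_space dual_space_to_lie_algebra[OF trilinear_formsD(2)[OF assms]])
    show "left_tensor3 G \<omega> p u v \<in> dual_space ?T" for u v
      unfolding e(3) by (simp add: zero_dual_space dual_space_to_lie_algebra[OF trilinear_formsD(1)[OF assms]])
  qed
qed

lemma left_tensor3_alternating:
  assumes "\<omega> \<in> alternating_forms3 (lie_algebra G)"
  shows "left_tensor3 G \<omega> p \<in> alternating_forms3 (tangent_space (atlas G) p)"
  using assms left_tensor3_trilinear[of \<omega> p] unfolding alternating_forms3_def by (simp add: left_tensor3_def)

lemma smooth_left_tensor1:
  assumes \<alpha>: "\<alpha> \<in> dual_space (lie_algebra G)" and X: "vector_field (atlas G) X"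
  shows "smooth_near (atlas G) p (\<lambda>q. \<alpha> (to_lie_algebra G q (X q)))"
proof -
  note m = manifold_atlas
  obtain I :: "'v set" and e h where f: "finite I" "\<And>b. e b \<in> lie_algebra G" "\<And>b. smooth_near (atlas G) \<one> (h b)"
    "\<And>u. u \<in> lie_algebra G \<Longrightarrow> u = (\<Sum>b\<in>I. u (h b) *\<^sub>R e b)" using lie_algebra_frame by blast
  have "\<alpha> (to_lie_algebra G q (X q)) = (\<Sum>b\<in>I. to_lie_algebra G q (X q) (h b) * \<alpha> (e b))" for q
    by (subst f(4)[OF to_lie_algebra_in[OF vector_field_tangent[OF X]]])
      (rule dual_space_sum[OF subspace_tangent_space[OF m] \<alpha> f(2)])
  then show ?thesis
    by (simp only:) (intro smooth_near_sum[OF m] smooth_near_mult[OF m] smooth_near_const[OF m] smooth_near_to_lie_algebra X f(3))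
qed

text \<open>Expanding the first argument in the frame leaves smooth components times tensors with
  one argument less; the case of three arguments repeats this step.\<close>

lemma smooth_left_tensor2:
  assumes \<beta>: "\<beta> \<in> bilinear_forms (lie_algebra G)" and X: "vector_field (atlas G) X" and Y: "vector_field (atlas G) Y"
  shows "smooth_near (atlas G) p (\<lambda>q. \<beta> (to_lie_algebra G q (X q)) (to_lie_algebra G q (Y q)))"
proof -
  note m = manifold_atlas
  obtain I :: "'v set" and e h where f: "finite I" "\<And>b. e b \<in> lie_algebra G" "\<And>b. smooth_near (atlas G) \<one> (h b)"
    "\<And>u. u \<in> lie_algebra G \<Longrightarrow> u = (\<Sum>b\<in>I. u (h b) *\<^sub>R e b)" using lie_algebra_frame by blast
  have "\<beta> (to_lie_algebra G q (X q)) v = (\<Sum>b\<in>I. to_lie_algebra G q (X q) (h b) * \<beta> (e b) v)" for q v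
    by (subst f(4)[OF to_lie_algebra_in[OF vector_field_tangent[OF X]]])
      (rule dual_space_sum[OF subspace_tangent_space[OF m] bilinear_formsD(2)[OF \<beta>] f(2)])
  then show ?thesis
    by (simp only:) (intro smooth_near_sum[OF m] smooth_near_mult[OF m] smooth_left_tensor1 bilinear_formsD(1)[OF \<beta>]
        smooth_near_to_lie_algebra X Y f(3))
qed

lemma smooth_left_tensor3:
  assumes \<omega>: "\<omega> \<in> trilinear_forms (lie_algebra G)" and X: "vector_field (atlas G) X" and Y: "vector_field (atlas G) Y"
    and Z: "vector_field (atlas G) Z"
  shows "smooth_near (atlas G) p (\<lambda>q. \<omega> (to_lie_algebra G q (X q)) (to_lie_algebra G q (Y q)) (to_lie_algebra G q (Z q)))"
proof -
  note m = manifold_atlas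
  obtain I :: "'v set" and e h where f: "finite I" "\<And>b. e b \<in> lie_algebra G" "\<And>b. smooth_near (atlas G) \<one> (h b)"
    "\<And>u. u \<in> lie_algebra G \<Longrightarrow> u = (\<Sum>b\<in>I. u (h b) *\<^sub>R e b)" using lie_algebra_frame by blast
  have "\<omega> (to_lie_algebra G q (X q)) v w = (\<Sum>b\<in>I. to_lie_algebra G q (X q) (h b) * \<omega> (e b) v w)" for q v w
    by (subst f(4)[OF to_lie_algebra_in[OF vector_field_tangent[OF X]]])
      (rule dual_space_sum[OF subspace_tangent_space[OF m] trilinear_formsD(3)[OF \<omega>] f(2)])
  then show ?thesis
    by (simp only:) (intro smooth_near_sum[OF m] smooth_near_mult[OF m] smooth_left_tensor2 trilinear_formsD(4)[OF \<omega>]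
        smooth_near_to_lie_algebra X Y Z f(3))
qed

lemma two_form_left_tensor2:
  assumes \<beta>: "\<beta> \<in> alternating_forms2 (lie_algebra G)"
  shows "two_form (atlas G) (left_tensor2 G \<beta>)"
proof -
  have b: "\<beta> \<in> bilinear_forms (lie_algebra G)" using \<beta> by (simp add: alternating_forms2_def)
  have "left_tensor2 G \<beta> p u u = 0" for p u
    using \<beta> by (simp add: left_tensor2_def alternating_forms2_def)
  then show ?thesis
    unfolding two_form_def alternating_forms2_def
    using left_tensor2_bilinear[OF b] smooth_left_tensor2[OF b]
    by (simp add: left_tensor2_def vector_field_tangent)
qed

text \<open>The Chevalley-Eilenberg differential, set to zero off the Lie algebra so that it belongs
  to \<open>alternating_forms3\<close>.\<close>

definition bracket_d2 ::
  "('a tangent \<Rightarrow> 'a tangent \<Rightarrow> real) \<Rightarrow> 'a tangent \<Rightarrow> 'a tangent \<Rightarrow> 'a tangent \<Rightarrow> real" where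
  "bracket_d2 \<beta> u v w =
     (if u \<in> lie_algebra G \<and> v \<in> lie_algebra G \<and> w \<in> lie_algebra G
      then ce_d2 (lie_algebra_bracket G) \<beta> u v w else 0)"

lemma bilinear_bracket_skew:
  assumes \<beta>: "\<beta> \<in> bilinear_forms (lie_algebra G)" and "u \<in> lie_algebra G" "v \<in> lie_algebra G"
  shows "\<beta> (lie_algebra_bracket G u v) w = - \<beta> (lie_algebra_bracket G v u) w"
proof -
  have "\<beta> ((-1) *\<^sub>R lie_algebra_bracket G v u) w = -1 * \<beta> (lie_algebra_bracket G v u) w"
    by (rule bilinear_formsD(4)[OF \<beta> lie_algebra_bracket_in[OF assms(3,2)]])
  moreover have "(-1) *\<^sub>R lie_algebra_bracket G v u = lie_algebra_bracket G u v"
    by (subst lie_algebra_bracket_skew) (simp only: scaleR_minus_left scaleR_one minus_minus)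
  ultimately show ?thesis by simp
qed

lemma bracket_d2_alternating:
  assumes \<beta>: "\<beta> \<in> alternating_forms2 (lie_algebra G)"
  shows "bracket_d2 \<beta> \<in> alternating_forms3 (lie_algebra G)"
proof -
  let ?g = "lie_algebra G"
  have b: "\<beta> \<in> bilinear_forms ?g" using \<beta> by (simp add: alternating_forms2_def)
  note l = bilinear_formsD[OF b] and sk = bilinear_bracket_skew[OF b] and br = lie_algebra_bracket_in
  \<comment> \<open>Linearity is verified in the last argument; the other arguments are reached by
    rotation.\<close>
  have cyc: "bracket_d2 \<beta> u v w = bracket_d2 \<beta> v w u" for u v w
    using sk[of u v w] sk[of u w v] by (simp add: bracket_d2_def ce_d2_def)
  have dual: "bracket_d2 \<beta> u v \<in> dual_space ?g" for u v
  proof (cases "u \<in> ?g \<and> v \<in> ?g")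
    case True
    have add: "bracket_d2 \<beta> u v (w + z) = bracket_d2 \<beta> u v w + bracket_d2 \<beta> u v z" if w: "w \<in> ?g" "z \<in> ?g" for w z
    proof -
      have "\<beta> (lie_algebra_bracket G x (w + z)) y = \<beta> (lie_algebra_bracket G x w) y + \<beta> (lie_algebra_bracket G x z) y"
        if x: "x \<in> ?g" for x y
        by (simp only: lie_algebra_bracket_add[OF x w] l(3)[OF br[OF x w(1)] br[OF x w(2)]])
      then show ?thesis
        using True w tangent_add[OF manifold_atlas w]
        by (simp only: bracket_d2_def ce_d2_def l(5)[OF w] if_True simp_thms)
    qed
    have scale: "bracket_d2 \<beta> u v (c *\<^sub>R w) = c * bracket_d2 \<beta> u v w" if w: "w \<in> ?g" for c w
    proof -
      have "\<beta> (lie_algebra_bracket G x (c *\<^sub>R w)) y = c * \<beta> (lie_algebra_bracket G x w) y"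
        if x: "x \<in> ?g" for x y
        by (simp only: lie_algebra_bracket_scaleR[OF x w] l(4)[OF br[OF x w]])
      then show ?thesis
        using True w tangent_scaleR[OF manifold_atlas w, of c]
        by (simp add: bracket_d2_def ce_d2_def l(6)[OF w] algebra_simps del: scaleR_fun_def)
    qed
    show ?thesis
      unfolding dual_space_def using add scale by (simp add: bracket_d2_def)
  next
    case False
    then have "bracket_d2 \<beta> u v = (\<lambda>w. 0)" by (auto simp: bracket_d2_def fun_eq_iff)
    then show ?thesis using zero_dual_space by (simp only:)
  qed
  have "(\<lambda>v. bracket_d2 \<beta> u v w) \<in> dual_space ?g" "(\<lambda>u. bracket_d2 \<beta> u v w) \<in> dual_space ?g" for u v w
  proof -
    have "(\<lambda>v. bracket_d2 \<beta> u v w) = bracket_d2 \<beta> w u" "(\<lambda>u. bracket_d2 \<beta> u v w) = bracket_d2 \<beta> v w"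
      by (auto simp: cyc[of w u] cyc[of _ v w] fun_eq_iff)
    then show "(\<lambda>v. bracket_d2 \<beta> u v w) \<in> dual_space ?g" "(\<lambda>u. bracket_d2 \<beta> u v w) \<in> dual_space ?g"
      by (simp_all only: dual)
  qed
  moreover have z: "bracket_d2 \<beta> u u v = 0" for u v
    using sk[of u u v] by (simp add: bracket_d2_def ce_d2_def)
  moreover have "bracket_d2 \<beta> u v v = 0" "bracket_d2 \<beta> u v u = 0" for u v
    using cyc[of u v v] cyc[of u v u] cyc[of v u u] z[of v u] z[of u v] by simp_all
  ultimately show ?thesis
    unfolding alternating_forms3_def trilinear_forms_def using dual by blast
qed

text \<open>On left-invariant fields the functions \<beta>(Y, Z) are constant, so only the bracket
  terms of the de Rham differential survive, and these are the Chevalley-Eilenberg differential.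
  Both sides being tensorial, this extends to arbitrary fields.\<close>

lemma ext_d2_left_tensor2:
  assumes \<beta>: "\<beta> \<in> alternating_forms2 (lie_algebra G)"
    and v: "vector_field (atlas G) X" "vector_field (atlas G) Y" "vector_field (atlas G) Z"
  shows "left_tensor3 G (bracket_d2 \<beta>) p (X p) (Y p) (Z p) = ext_d2 (atlas G) (left_tensor2 G \<beta>) X Y Z p"
proof -
  let ?A = "atlas G" and ?b = "left_tensor2 G \<beta>" and ?w = "left_tensor3 G (bracket_d2 \<beta>)"
  note m = manifold_atlas and lf = vector_field_left_field and t = vector_field_tangent
  note tf = two_form_left_tensor2[OF \<beta>]
  have tri: "?w p \<in> trilinear_forms (tangent_space ?A p)"
    using left_tensor3_alternating[OF bracket_d2_alternating[OF \<beta>], of p] by (simp add: alternating_forms3_def)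
  have tens: "tensorial_at ?A p (\<lambda>Z. \<alpha> (Z p))" if "\<alpha> \<in> cotangent_space ?A p" for \<alpha>
    unfolding tensorial_at_def by (auto simp: dual_spaceD[OF that] t)
  have base: "?w p (left_field G x p) (left_field G y p) (left_field G z p) =
      ext_d2 ?A ?b (left_field G x) (left_field G y) (left_field G z) p"
    if x: "x \<in> lie_algebra G" and y: "y \<in> lie_algebra G" and z: "z \<in> lie_algebra G" for x y z
    by (simp add: ext_d2_def left_tensor3_left_field left_tensor2_left_field lie_bracket_left_field x y z
        lie_algebra_bracket_in tangent_vector_const[OF m t[OF lf]] bracket_d2_def ce_d2_def)
  \<comment> \<open>The arguments are freed one at a time, starting with the last; on the side of
    \<open>ext_d2\<close> they are rotated so that the one being freed stands last.\<close>
  have 1: "?w p (left_field G x p) (left_field G y p) (Z p) = ext_d2 ?A ?b (left_field G x) (left_field G y) Z p"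
    if x: "x \<in> lie_algebra G" and y: "y \<in> lie_algebra G" for x y
    by (rule tensorial_at_eq[OF tens[OF trilinear_formsD(1)[OF tri]] tensorial_ext_d2[OF m tf lf[OF x] lf[OF y]] base[OF x y] v(3)])
  have 2: "?w p (left_field G x p) (Y p) (Z p) = ext_d2 ?A ?b Z (left_field G x) Y p"
    if x: "x \<in> lie_algebra G" for x
  proof (rule tensorial_at_eq[OF tens[OF trilinear_formsD(2)[OF tri]] tensorial_ext_d2[OF m tf v(3) lf[OF x]] _ v(2)])
    fix y assume y: "y \<in> lie_algebra G"
    show "?w p (left_field G x p) (left_field G y p) (Z p) = ext_d2 ?A ?b Z (left_field G x) (left_field G y) p"
      using 1[OF x y] ext_d2_cyclic[OF m tf v(3) lf[OF x] lf[OF y]] by simp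
  qed
  have "?w p (X p) (Y p) (Z p) = ext_d2 ?A ?b Y Z X p"
  proof (rule tensorial_at_eq[OF tens[OF trilinear_formsD(3)[OF tri]] tensorial_ext_d2[OF m tf v(2,3)] _ v(1)])
    fix x assume x: "x \<in> lie_algebra G"
    show "?w p (left_field G x p) (Y p) (Z p) = ext_d2 ?A ?b Y Z (left_field G x) p"
      using 2[OF x] ext_d2_cyclic[OF m tf lf[OF x] v(2,3)] ext_d2_cyclic[OF m tf v(3) lf[OF x] v(2)] by simp
  qed
  then show ?thesis using ext_d2_cyclic[OF m tf v] by simp
qed

end

lemma alternating_forms3_diff:
  assumes "\<omega> \<in> alternating_forms3 V" "\<omega>' \<in> alternating_forms3 V"
  shows "(\<lambda>u v w. \<omega> u v w - \<omega>' u v w) \<in> alternating_forms3 V"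
proof -
  have d: "(\<lambda>u. f u - g u) \<in> dual_space V" if "f \<in> dual_space V" "g \<in> dual_space V" for f g
    using that unfolding dual_space_def by (simp add: algebra_simps)
  show ?thesis
    using assms unfolding alternating_forms3_def trilinear_forms_def
    by (auto intro: d)
qed

lemma three_form_smooth:
  "manifold A \<Longrightarrow> three_form A H \<Longrightarrow> vector_field A X \<Longrightarrow> vector_field A Y \<Longrightarrow> vector_field A Z \<Longrightarrow>
    smooth_near A p (\<lambda>q. H q (X q) (Y q) (Z q))"
  by (simp add: three_form_def smooth_fun_on_iff)

lemma ext_d3_diff:
  assumes m: "manifold A" and H: "three_form A H" and K: "three_form A K"
    and v: "vector_field A X" "vector_field A Y" "vector_field A Z" "vector_field A W"
  shows "ext_d3 A (\<lambda>p u v w. H p u v w - K p u v w) X Y Z W p = ext_d3 A H X Y Z W p - ext_d3 A K X Y Z W p"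
proof -
  have D: "V p (\<lambda>q. H q (V1 q) (V2 q) (V3 q) - K q (V1 q) (V2 q) (V3 q)) =
      V p (\<lambda>q. H q (V1 q) (V2 q) (V3 q)) - V p (\<lambda>q. K q (V1 q) (V2 q) (V3 q))"
    if "vector_field A V" "vector_field A V1" "vector_field A V2" "vector_field A V3" for V V1 V2 V3
    by (intro tangent_vector_diff[OF m vector_field_tangent] three_form_smooth[OF m H] three_form_smooth[OF m K] that)
  show ?thesis
    unfolding ext_d3_def D[OF v(1,2,3,4)] D[OF v(2,1,3,4)] D[OF v(3,1,2,4)] D[OF v(4,1,2,3)] by simp
qed

context lie_group
begin

section \<open>Left-invariant three-forms\<close>

lemma three_form_left_tensor3:
  assumes "\<omega> \<in> alternating_forms3 (lie_algebra G)"
  shows "three_form (atlas G) (left_tensor3 G \<omega>)"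
proof -
  have t: "\<omega> \<in> trilinear_forms (lie_algebra G)" using assms by (simp add: alternating_forms3_def)
  show ?thesis
    unfolding three_form_def
    using left_tensor3_alternating[OF assms] smooth_left_tensor3[OF t]
    by (simp add: left_tensor3_def vector_field_tangent smooth_fun_on_iff[OF manifold_atlas])
qed

lemma left_invariant_closed_three_form_diff_exact:
  assumes H: "left_invariant_closed_three_form G H" and \<beta>: "\<beta> \<in> alternating_forms2 (lie_algebra G)"
  shows "left_invariant_closed_three_form G (\<lambda>p u v w. H p u v w - left_tensor3 G (bracket_d2 \<beta>) p u v w)"
proof -
  let ?A = "atlas G" and ?K = "left_tensor3 G (bracket_d2 \<beta>)"
  note m = manifold_atlas
  have H3: "three_form ?A H" and cl: "\<And>X Y Z W p. vector_field ?A X \<Longrightarrow> vector_field ?A Y \<Longrightarrow> vector_field ?A Z \<Longrightarrow>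
      vector_field ?A W \<Longrightarrow> ext_d3 ?A H X Y Z W p = 0"
    using H by (auto simp: left_invariant_closed_three_form_def closed_three_form_def)
  have K3: "three_form ?A ?K" by (rule three_form_left_tensor3[OF bracket_d2_alternating[OF \<beta>]])
  have "three_form ?A (\<lambda>p u v w. H p u v w - ?K p u v w)"
    unfolding three_form_def smooth_fun_on_iff[OF m open_UNIV]
  proof (intro conjI allI impI ballI; (elim conjE)?)
    show "(\<lambda>u v w. H p u v w - ?K p u v w) \<in> alternating_forms3 (tangent_space ?A p)" for p
      by (rule alternating_forms3_diff) (use H3 K3 in \<open>simp_all add: three_form_def\<close>)
    show "smooth_near ?A p (\<lambda>p. H p (X p) (Y p) (Z p) - ?K p (X p) (Y p) (Z p))"
      if "vector_field ?A X" "vector_field ?A Y" "vector_field ?A Z" for X Y Z p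
      by (intro smooth_near_diff[OF m] three_form_smooth[OF m H3] three_form_smooth[OF m K3] that)
  qed
  moreover have "ext_d3 ?A (\<lambda>p u v w. H p u v w - ?K p u v w) X Y Z W p = 0"
    if v: "vector_field ?A X" "vector_field ?A Y" "vector_field ?A Z" "vector_field ?A W" for X Y Z W p
  proof -
    have "ext_d3 ?A ?K X Y Z W p = 0"
      by (rule ext_d2_ext_d2[OF m two_form_left_tensor2[OF \<beta>] ext_d2_left_tensor2[OF \<beta>] v])
    then show ?thesis by (simp only: ext_d3_diff[OF m H3 K3 v] cl[OF v] diff_self)
  qed
  ultimately have "closed_three_form ?A (\<lambda>p u v w. H p u v w - ?K p u v w)"
    unfolding closed_three_form_def by blast
  moreover have "H (a \<otimes> p) (left_translate G a p u) (left_translate G a p v) (left_translate G a p w)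
        - ?K (a \<otimes> p) (left_translate G a p u) (left_translate G a p v) (left_translate G a p w)
      = H p u v w - ?K p u v w"
    if u: "u \<in> tangent_space ?A p" "v \<in> tangent_space ?A p" "w \<in> tangent_space ?A p" for a p u v w
  proof -
    have "H (a \<otimes> p) (left_translate G a p u) (left_translate G a p v) (left_translate G a p w) = H p u v w"
      using H u unfolding left_invariant_closed_three_form_def by blast
    then show ?thesis by (simp only: left_tensor3_left_translate[OF u])
  qed
  ultimately show ?thesis
    unfolding left_invariant_closed_three_form_def by blast
qed

text \<open>On left-invariant fields an invariant form takes constant values, so the derivative
  terms in dH vanish and the remaining terms, at the identity, are the Chevalley-Eilenberg
  differential.\<close>

lemma left_invariant_closed_three_form_cocycle:
  assumes H: "left_invariant_closed_three_form G H"
  shows "H \<one> \<in> ce_cocycles3 (lie_algebra G) (lie_algebra_bracket G)"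
proof -
  let ?A = "atlas G"
  note m = manifold_atlas and lf = vector_field_left_field
  have const: "H q (left_field G u q) (left_field G v q) (left_field G w q) = H \<one> u v w"
    if "u \<in> lie_algebra G" "v \<in> lie_algebra G" "w \<in> lie_algebra G" for q u v w
  proof -
    have "H (q \<otimes> \<one>) (left_translate G q \<one> u) (left_translate G q \<one> v) (left_translate G q \<one> w) = H \<one> u v w"
      using H that unfolding left_invariant_closed_three_form_def by blast
    then show ?thesis by (simp add: left_field_def)
  qed
  have "ce_d3 (lie_algebra_bracket G) (H \<one>) u v w z = 0"
    if g: "u \<in> lie_algebra G" "v \<in> lie_algebra G" "w \<in> lie_algebra G" "z \<in> lie_algebra G" for u v w z
  proof -
    have "ext_d3 ?A H (left_field G u) (left_field G v) (left_field G w) (left_field G z) \<one> = 0"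
      using H g lf by (simp add: left_invariant_closed_three_form_def closed_three_form_def)
    then show ?thesis
      using g tangent_vector_const[OF m g(1)] tangent_vector_const[OF m g(2)] tangent_vector_const[OF m g(3)]
        tangent_vector_const[OF m g(4)]
      by (simp add: ext_d3_def ce_d3_def const left_field_one flip: lie_algebra_bracket_def)
  qed
  moreover have "H \<one> \<in> alternating_forms3 (lie_algebra G)"
    using H by (simp add: left_invariant_closed_three_form_def closed_three_form_def three_form_def)
  ultimately show ?thesis by (simp add: ce_cocycles3_def)
qed

lemma diff_exact_cohomologous:
  assumes H: "left_invariant_closed_three_form G H" and \<beta>: "\<beta> \<in> alternating_forms2 (lie_algebra G)"
  shows "(\<lambda>u v w. H \<one> u v w - left_tensor3 G (bracket_d2 \<beta>) \<one> u v w)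
    \<in> cohomology_class3 (lie_algebra G) (lie_algebra_bracket G) (H \<one>)"
proof -
  let ?g = "lie_algebra G"
  \<comment> \<open>The witness is -\<beta>: \<open>cohomology_class3\<close> adds a coboundary,
    while here one is subtracted.\<close>
  have "(\<lambda>u v. - \<beta> u v) \<in> alternating_forms2 ?g"
    using \<beta> by (simp add: alternating_forms2_def bilinear_forms_def dual_space_def)
  moreover have "\<forall>u\<in>?g. \<forall>v\<in>?g. \<forall>w\<in>?g. H \<one> u v w - left_tensor3 G (bracket_d2 \<beta>) \<one> u v w =
      H \<one> u v w + ce_d2 (lie_algebra_bracket G) (\<lambda>u v. - \<beta> u v) u v w"
    by (simp add: left_tensor3_def to_lie_algebra_one bracket_d2_def ce_d2_def)
  ultimately show ?thesis
    unfolding cohomology_class3_def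
    using left_invariant_closed_three_form_cocycle[OF left_invariant_closed_three_form_diff_exact[OF H \<beta>]]
    by blast
qed

end

section \<open>The transformation of the generalized tangent bundle by a two-form\<close>

lemma one_form_contraction:
  assumes m: "manifold A" and b: "two_form A b" and X: "vector_field A X"
  shows "one_form A (\<lambda>q. b q (X q))"
  unfolding one_form_def smooth_fun_on_iff[OF m open_UNIV]
  using bilinear_formsD(1)[OF two_formD(1)[OF m b]] two_formD(3)[OF m b X] by blast

text \<open>The B-field transformation exp(b), where b is read as the map from vectors to covectors
  that contracts the first argument.\<close>

definition shear :: "('a \<Rightarrow> 'a tangent \<Rightarrow> 'a tangent \<Rightarrow> real) \<Rightarrow> 'a \<Rightarrow> 'a gen_tangent \<Rightarrow> 'a gen_tangent" where
  "shear b p x = (fst x, snd x + b p (fst x))"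

lemma push_section_id:
  fixes e :: "'a \<Rightarrow> 'a gen_tangent"
  shows "push_section id \<Phi> e = (\<lambda>q. \<Phi> q (e q))"
proof -
  have "the_inv id q = q" for q :: 'a
    using the_inv_f_f[of id q] by simp
  then show ?thesis by (simp add: push_section_def)
qed

lemma gen_space_shear:
  assumes m: "manifold A" and b: "two_form A b" and x: "x \<in> gen_space A p"
  shows "shear b p x \<in> gen_space A p"
  using x
  by (auto simp: gen_space_def shear_def
      intro!: subspace_add[OF subspace_dual_space] bilinear_formsD(1)[OF two_formD(1)[OF m b]])

text \<open>The inverse is the shear by -b, which is again a two-form; hence one argument shows that
  smooth sections go to smooth sections in both directions.\<close>

lemma gen_bundle_iso_shear:
  fixes A :: "('a::topological_space, 'v::real_inner) atlas"
  assumes m: "manifold A" and b: "two_form A b"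
  shows "gen_bundle_iso A A id (shear b)"
proof -
  have b': "two_form A (\<lambda>p u v. - b p u v)"
    using b smooth_near_minus[OF m]
    by (simp add: two_form_def alternating_forms2_def bilinear_forms_def dual_space_def)
  note in_T = gen_space_shear[OF m b] gen_space_shear[OF m b']
  have inv: "shear (\<lambda>p u v. - b p u v) p (shear b p x) = x" "shear b p (shear (\<lambda>p u v. - b p u v) p x) = x" for p x
    by (simp_all add: shear_def prod_eq_iff fun_eq_iff)
  have "bij_betw (shear b p) (gen_space A p) (gen_space A p)" for p
    by (rule bij_betw_byWitness[where f'="shear (\<lambda>p u v. - b p u v) p"]) (use in_T inv in auto)
  moreover have "shear b p (x + y) = shear b p x + shear b p y"
    if "x \<in> gen_space A p" "y \<in> gen_space A p" for p x y
    using bilinear_formsD(3)[OF two_formD(1)[OF m b], of "fst x" p "fst y"] that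
    by (auto simp: shear_def gen_space_def prod_eq_iff fun_eq_iff)
  moreover have "shear b p (c *\<^sub>R x) = c *\<^sub>R shear b p x" if "x \<in> gen_space A p" for p x c
    using bilinear_formsD(4)[OF two_formD(1)[OF m b], of "fst x" p c] that
    by (auto simp: shear_def gen_space_def prod_eq_iff fun_eq_iff scaleR_fun_def algebra_simps)
  moreover have "gen_section A e \<longleftrightarrow> gen_section A (\<lambda>q. shear b q (e q))" for e
  proof
    have imp: "gen_section A (\<lambda>q. shear c q (e q))" if e: "gen_section A e" and c: "two_form A c" for e c
      using e one_form_add[OF m _ one_form_contraction[OF m c]]
      by (simp add: gen_section_def shear_def)
    show "gen_section A e \<Longrightarrow> gen_section A (\<lambda>q. shear b q (e q))" using imp b by blast
    show "gen_section A (\<lambda>q. shear b q (e q)) \<Longrightarrow> gen_section A e"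
      using imp[OF _ b', of "\<lambda>q. shear b q (e q)"] by (simp add: inv)
  qed
  moreover have "smooth_map_on A A UNIV id"
    by (simp add: smooth_map_on_iff_smooth_at[OF m m] id_def smooth_at_id[OF m])
  moreover have "the_inv id = (id :: 'a \<Rightarrow> 'a)"
    using the_inv_f_f[of "id :: 'a \<Rightarrow> 'a"] by (simp add: fun_eq_iff)
  ultimately show ?thesis
    unfolding gen_bundle_iso_def push_section_id id_apply
    by (intro conjI allI ballI impI) (simp_all only: bij_id bij_id[unfolded id_def])
qed

context lie_group
begin

text \<open>Behind the computation is the Cartan identity L_X(b(Y, .)) - i_Y d(b(X, .)) = b([X, Y],
  .) + db(X, Y, .). The first term on the right is what the shear adds to the old bracket, the
  second is absorbed by passing from H to H'. The covectors are compared on a vector w by writing w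
  as the value of a left-invariant field Z.\<close>

lemma dorfman_shear:
  fixes H :: "'a \<Rightarrow> 'a tangent \<Rightarrow> 'a tangent \<Rightarrow> 'a tangent \<Rightarrow> real"
  assumes H: "three_form (atlas G) H" and H': "three_form (atlas G) H'" and b: "two_form (atlas G) b"
    and d: "\<And>X Y Z q. vector_field (atlas G) X \<Longrightarrow> vector_field (atlas G) Y \<Longrightarrow> vector_field (atlas G) Z \<Longrightarrow>
      H' q (X q) (Y q) (Z q) = H q (X q) (Y q) (Z q) - ext_d2 (atlas G) b X Y Z q"
    and e: "gen_section (atlas G) e" and e': "gen_section (atlas G) e'"
  shows "push_section id (shear b) (dorfman (atlas G) H e e') =
    dorfman (atlas G) H' (push_section id (shear b) e) (push_section id (shear b) e')"
proof (rule ext, rule prod_eqI)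
  fix p
  let ?A = "atlas G" and ?T = "tangent_space (atlas G) p"
  note m = manifold_atlas
  define X where "X = (\<lambda>q. fst (e q))"
  define Y where "Y = (\<lambda>q. fst (e' q))"
  define \<xi> where "\<xi> = (\<lambda>q. snd (e q))"
  define \<eta> where "\<eta> = (\<lambda>q. snd (e' q))"
  define \<xi>' where "\<xi>' = (\<lambda>q. \<xi> q + b q (X q))"
  define \<eta>' where "\<eta>' = (\<lambda>q. \<eta> q + b q (Y q))"
  have X: "vector_field ?A X" and Y: "vector_field ?A Y" and \<xi>: "one_form ?A \<xi>" and \<eta>: "one_form ?A \<eta>"
    using e e' by (simp_all add: gen_section_def X_def Y_def \<xi>_def \<eta>_def)
  have \<xi>': "one_form ?A \<xi>'" and \<eta>': "one_form ?A \<eta>'"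
    unfolding \<xi>'_def \<eta>'_def by (intro one_form_add[OF m] one_form_contraction[OF m b] X Y \<xi> \<eta>)+
  have l: "push_section id (shear b) (dorfman ?A H e e') p =
      (lie_bracket ?A X Y p, lie_derivative_form ?A X \<eta> p - contract_d1 ?A Y \<xi> p + H p (X p) (Y p) + b p (lie_bracket ?A X Y p))"
    by (simp add: push_section_id shear_def dorfman_def Let_def X_def Y_def \<xi>_def \<eta>_def)
  have r: "dorfman ?A H' (push_section id (shear b) e) (push_section id (shear b) e') p =
      (lie_bracket ?A X Y p, lie_derivative_form ?A X \<eta>' p - contract_d1 ?A Y \<xi>' p + H' p (X p) (Y p))"
    by (simp add: push_section_id shear_def dorfman_def Let_def X_def Y_def \<xi>_def \<eta>_def \<xi>'_def \<eta>'_def)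
  show "fst (push_section id (shear b) (dorfman ?A H e e') p) =
      fst (dorfman ?A H' (push_section id (shear b) e) (push_section id (shear b) e') p)"
    by (simp only: l r fst_conv)
  have "lie_derivative_form ?A X \<eta> p w - contract_d1 ?A Y \<xi> p w + H p (X p) (Y p) w + b p (lie_bracket ?A X Y p) w =
      lie_derivative_form ?A X \<eta>' p w - contract_d1 ?A Y \<xi>' p w + H' p (X p) (Y p) w" for w
  proof (cases "w \<in> ?T")
    case True
    define Z where "Z = left_field G (to_lie_algebra G p w)"
    have Z: "vector_field ?A Z" and w: "w = Z p"
      using True by (auto simp: Z_def left_field_to_lie_algebra intro!: vector_field_left_field to_lie_algebra_in)
    have sm: "smooth_near ?A p (\<lambda>q. \<zeta> q (V q))" if "one_form ?A \<zeta>" "vector_field ?A V" for \<zeta> V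
      by (rule one_form_smooth[OF m that])
    note sb = two_formD(3)[OF m b]
    have 1: "X p (\<lambda>q. \<eta>' q (Z q)) = X p (\<lambda>q. \<eta> q (Z q)) + X p (\<lambda>q. b q (Y q) (Z q))"
      using tangent_vector_add[OF m vector_field_tangent[OF X] sm[OF \<eta> Z] sb[OF Y Z]] by (simp add: \<eta>'_def)
    have 2: "Y p (\<lambda>q. \<xi>' q (Z q)) = Y p (\<lambda>q. \<xi> q (Z q)) + Y p (\<lambda>q. b q (X q) (Z q))"
      using tangent_vector_add[OF m vector_field_tangent[OF Y] sm[OF \<xi> Z] sb[OF X Z]] by (simp add: \<xi>'_def)
    have 3: "Z p (\<lambda>q. \<xi>' q (Y q)) = Z p (\<lambda>q. \<xi> q (Y q)) + Z p (\<lambda>q. b q (X q) (Y q))"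
      using tangent_vector_add[OF m vector_field_tangent[OF Z] sm[OF \<xi> Y] sb[OF X Y]] by (simp add: \<xi>'_def)
    show ?thesis
      unfolding w lie_derivative_form(2)[OF X \<eta> Z] lie_derivative_form(2)[OF X \<eta>' Z]
        contract_d1(2)[OF Y \<xi> Z] contract_d1(2)[OF Y \<xi>' Z] ext_d1_def 1 2 3 d[OF X Y Z] ext_d2_def
      using two_formD(2)[OF m b, of p "Y p" "lie_bracket ?A X Z p"] two_formD(2)[OF m b, of p "X p" "lie_bracket ?A Y Z p"]
      by (simp add: \<xi>'_def \<eta>'_def)
  next
    case False
    \<comment> \<open>Off the tangent space every covector involved takes the default value
      0.\<close>
    have d: "H p (X p) (Y p) \<in> cotangent_space ?A p" "H' p (X p) (Y p) \<in> cotangent_space ?A p"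
      using H H' by (simp_all add: three_form_def alternating_forms3_def trilinear_forms_def)
    note z = dual_spaceD(3)[OF _ False]
    show ?thesis
      by (simp only: z[OF d(1)] z[OF d(2)] z[OF one_form_dual[OF lie_derivative_form(1)[OF X \<eta>]]]
          z[OF one_form_dual[OF lie_derivative_form(1)[OF X \<eta>']]] z[OF one_form_dual[OF contract_d1(1)[OF Y \<xi>]]]
          z[OF one_form_dual[OF contract_d1(1)[OF Y \<xi>']]] bilinear_formsD(8)[OF two_formD(1)[OF m b] False])
  qed
  then show "snd (push_section id (shear b) (dorfman ?A H e e') p) =
      snd (dorfman ?A H' (push_section id (shear b) e) (push_section id (shear b) e') p)"
    unfolding l r snd_conv by (intro ext) simp
qed

section \<open>Linear algebra of generalized metrics\<close>

text \<open>The dual frame consists of evaluations on the coordinate functions \<open>h b\<close>,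
  cut off outside the Lie algebra; the expansion of covectors follows by applying them to the
  expansion of vectors. Together they provide finite spanning sets of the Lie algebra and of its
  dual.\<close>

lemma lie_algebra_dual_frame:
  obtains I :: "'v set" and e \<theta> where "finite I" "\<And>b. e b \<in> lie_algebra G" "\<And>b. \<theta> b \<in> dual_space (lie_algebra G)"
    "\<And>u. u \<in> lie_algebra G \<Longrightarrow> u = (\<Sum>b\<in>I. \<theta> b u *\<^sub>R e b)"
    "\<And>\<eta>. \<eta> \<in> dual_space (lie_algebra G) \<Longrightarrow> \<eta> = (\<Sum>b\<in>I. \<eta> (e b) *\<^sub>R \<theta> b)"
proof -
  note m = manifold_atlas
  obtain I :: "'v set" and e h where f: "finite I" "\<And>b. e b \<in> lie_algebra G" "\<And>b. smooth_near (atlas G) \<one> (h b)"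
    "\<And>u. u \<in> lie_algebra G \<Longrightarrow> u = (\<Sum>b\<in>I. u (h b) *\<^sub>R e b)" using lie_algebra_frame by blast
  define \<theta> where "\<theta> = (\<lambda>b u. if u \<in> lie_algebra G then u (h b) else (0::real))"
  have \<theta>: "\<theta> b \<in> dual_space (lie_algebra G)" for b
    unfolding dual_space_def \<theta>_def
    by (simp add: tangent_add[OF m] tangent_scaleR[OF m]) (simp add: scaleR_fun_def)
  have expand: "u = (\<Sum>b\<in>I. \<theta> b u *\<^sub>R e b)" if "u \<in> lie_algebra G" for u
    using f(4)[OF that] that by (simp add: \<theta>_def)
  have "\<eta> = (\<Sum>b\<in>I. \<eta> (e b) *\<^sub>R \<theta> b)" if \<eta>: "\<eta> \<in> dual_space (lie_algebra G)" for \<eta>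
  proof
    fix u
    show "\<eta> u = (\<Sum>b\<in>I. \<eta> (e b) *\<^sub>R \<theta> b) u"
    proof (cases "u \<in> lie_algebra G")
      case True
      have "\<eta> u = \<eta> (\<Sum>b\<in>I. \<theta> b u *\<^sub>R e b)" using expand[OF True] by simp
      also have "\<dots> = (\<Sum>b\<in>I. \<theta> b u * \<eta> (e b))"
        by (rule dual_space_sum[OF subspace_tangent_space[OF m] \<eta> f(2)])
      finally show ?thesis by (simp add: sum_fun_apply scaleR_fun_def mult.commute)
    qed (simp add: sum_fun_apply scaleR_fun_def dual_spaceD(3)[OF \<eta>] dual_spaceD(3)[OF \<theta>])
  qed
  then show ?thesis using that[of I e \<theta>] f(1,2) \<theta> expand by blast
qed

text \<open>Reflexivity of a finite-dimensional space; the vector is assembled from the values of F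
  on the dual frame.\<close>

lemma dual_representation:
  assumes F: "\<And>\<xi> \<eta>. \<xi> \<in> dual_space (lie_algebra G) \<Longrightarrow> \<eta> \<in> dual_space (lie_algebra G) \<Longrightarrow> F (\<xi> + \<eta>) = F \<xi> + F \<eta>"
    "\<And>c \<xi>. \<xi> \<in> dual_space (lie_algebra G) \<Longrightarrow> F (c *\<^sub>R \<xi>) = c * F \<xi>"
  shows "\<exists>Y\<in>lie_algebra G. \<forall>\<eta>\<in>dual_space (lie_algebra G). \<eta> Y = (F \<eta> :: real)"
proof -
  let ?g = "lie_algebra G"
  note sub = subspace_tangent_space[OF manifold_atlas]
  obtain I :: "'v set" and e \<theta> where f: "finite I" "\<And>b. e b \<in> ?g" "\<And>b. \<theta> b \<in> dual_space ?g"
    "\<And>u. u \<in> ?g \<Longrightarrow> u = (\<Sum>b\<in>I. \<theta> b u *\<^sub>R e b)"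
    "\<And>\<eta>. \<eta> \<in> dual_space ?g \<Longrightarrow> \<eta> = (\<Sum>b\<in>I. \<eta> (e b) *\<^sub>R \<theta> b)"
    by (rule lie_algebra_dual_frame) blast
  define Y where "Y = (\<Sum>b\<in>I. F (\<theta> b) *\<^sub>R e b)"
  have Y: "Y \<in> ?g"
    unfolding Y_def by (intro subspace_sum[OF sub] subspace_scale[OF sub] f(2))
  have "\<eta> Y = F \<eta>" if \<eta>: "\<eta> \<in> dual_space ?g" for \<eta>
  proof -
    have "F \<eta> = F (\<Sum>b\<in>I. \<eta> (e b) *\<^sub>R \<theta> b)" using f(5)[OF \<eta>] by simp
    also have "\<dots> = (\<Sum>b\<in>I. \<eta> (e b) * F (\<theta> b))"
      by (rule linear_on_subspace_sum[OF subspace_dual_space[of ?g]]) (erule (1) F(1), erule F(2), rule f(3))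
    also have "\<dots> = \<eta> Y"
      unfolding Y_def dual_space_sum[OF sub \<eta> f(2)] by (simp add: mult.commute)
    finally show ?thesis by simp
  qed
  then show ?thesis using Y by blast
qed

lemma dual_separates:
  assumes "X \<in> lie_algebra G" "Y \<in> lie_algebra G" "\<And>\<eta>. \<eta> \<in> dual_space (lie_algebra G) \<Longrightarrow> \<eta> X = \<eta> Y"
  shows "X = Y"
proof -
  obtain I :: "'v set" and e \<theta> where f: "\<And>b. \<theta> b \<in> dual_space (lie_algebra G)"
    "\<And>u. u \<in> lie_algebra G \<Longrightarrow> u = (\<Sum>b\<in>I. \<theta> b u *\<^sub>R e b)"
    by (rule lie_algebra_dual_frame) blast
  have "X = (\<Sum>b\<in>I. \<theta> b X *\<^sub>R e b)" by (rule f(2)[OF assms(1)])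
  also have "\<dots> = (\<Sum>b\<in>I. \<theta> b Y *\<^sub>R e b)" by (simp only: assms(3)[OF f(1)])
  also have "\<dots> = Y" by (rule f(2)[OF assms(2), symmetric])
  finally show ?thesis .
qed

text \<open>The scalar product is non-degenerate: pairing with covectors (0, \<eta>) determines the
  vector part, pairing with vectors (Z, 0) the covector part. This is the uniqueness half of the
  definite description.\<close>

lemma gen_endomorphism_eqI:
  assumes y: "y \<in> gen_algebra G" "\<And>z. z \<in> gen_algebra G \<Longrightarrow> scalar_product y z = \<G> x z"
  shows "gen_endomorphism G \<G> x = y"
  unfolding gen_endomorphism_def
proof (rule the_equality)
  show "y \<in> gen_algebra G \<and> (\<forall>z\<in>gen_algebra G. scalar_product y z = \<G> x z)" using y by blast
  fix y' assume y': "y' \<in> gen_algebra G \<and> (\<forall>z\<in>gen_algebra G. scalar_product y' z = \<G> x z)"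
  then have eq: "scalar_product y' z = scalar_product y z" if "z \<in> gen_algebra G" for z
    using y(2) that by simp
  have T: "fst y \<in> lie_algebra G" "fst y' \<in> lie_algebra G" "snd y \<in> dual_space (lie_algebra G)" "snd y' \<in> dual_space (lie_algebra G)"
    using y(1) y' by (auto simp: gen_space_def)
  have z: "(0 :: 'a tangent) \<in> lie_algebra G" by (rule tangent_zero[OF manifold_atlas])
  have z': "0 \<in> dual_space (lie_algebra G)" by (rule subspace_0[OF subspace_dual_space])
  show "y' = y"
  proof (rule prod_eqI)
    show "fst y' = fst y"
      by (rule dual_separates[OF T(2,1)])
        (use eq[of "(0, _)"] z dual_spaceD(2)[OF T(3) z, of 0] dual_spaceD(2)[OF T(4) z, of 0] in
          \<open>simp add: scalar_product_def gen_space_def\<close>)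
    show "snd y' = snd y"
      by (rule dual_eqI[OF T(4,3)])
        (use eq[of "(_, 0)"] z' in \<open>simp add: scalar_product_def gen_space_def\<close>)
  qed
qed

lemma gen_algebra_split:
  assumes "\<G> \<in> bilinear_forms (gen_algebra G)" "X \<in> lie_algebra G" "\<xi> \<in> dual_space (lie_algebra G)"
  shows "\<G> x (X, \<xi>) = \<G> x (X, 0) + \<G> x (0, \<xi>)" and "\<G> (X, \<xi>) x = \<G> (X, 0) x + \<G> (0, \<xi>) x"
    and "(X, 0) \<in> gen_algebra G" and "(0, \<xi>) \<in> gen_algebra G"
proof -
  show in_E: "(X, 0) \<in> gen_algebra G" "(0, \<xi>) \<in> gen_algebra G"
    using assms(2,3) tangent_zero[OF manifold_atlas] subspace_0[OF subspace_dual_space]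
    by (simp_all add: gen_space_def)
  have "(X, \<xi>) = (X, 0) + (0, \<xi>)" by (simp add: plus_prod_def)
  then show "\<G> x (X, \<xi>) = \<G> x (X, 0) + \<G> x (0, \<xi>)" "\<G> (X, \<xi>) x = \<G> (X, 0) x + \<G> (0, \<xi>) x"
    using bilinear_formsD(3,5)[OF assms(1) in_E] by simp_all
qed

text \<open>Existence of the described element: its covector part is read off from the values of
  \<G> on vectors, its vector part comes from the values on covectors by reflexivity.\<close>

lemma gen_endomorphism:
  assumes \<G>: "\<G> \<in> bilinear_forms (gen_algebra G)"
  shows "gen_endomorphism G \<G> x \<in> gen_algebra G"
    and "z \<in> gen_algebra G \<Longrightarrow> scalar_product (gen_endomorphism G \<G> x) z = \<G> x z"
proof -
  let ?g = "lie_algebra G"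
  note m = manifold_atlas and l = bilinear_formsD[OF \<G>] and s = gen_algebra_split[OF \<G>]
  have in_E: "(X, 0) \<in> gen_algebra G" if "X \<in> ?g" for X
    using that subspace_0[OF subspace_dual_space] by (simp add: gen_space_def)
  have in_E': "(0, \<xi>) \<in> gen_algebra G" if "\<xi> \<in> dual_space ?g" for \<xi>
    using that tangent_zero[OF m] by (simp add: gen_space_def)
  \<comment> \<open>The factor 2 undoes the division in \<open>scalar_product\<close>.\<close>
  define \<zeta> where "\<zeta> = (\<lambda>Y. if Y \<in> ?g then 2 * \<G> x (Y, 0) else 0)"
  have a1: "(X + Y, 0) = (X, 0) + (Y, 0 :: 'a cotangent)" "(c *\<^sub>R X, 0) = c *\<^sub>R (X, 0 :: 'a cotangent)" for X Y :: "'a tangent" and c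
    by (simp_all add: plus_prod_def scaleR_prod_def)
  have a2: "(0, \<xi> + \<eta>) = (0 :: 'a tangent, \<xi>) + (0, \<eta>)" "(0, c *\<^sub>R \<xi>) = c *\<^sub>R (0 :: 'a tangent, \<xi>)" for \<xi> \<eta> :: "'a cotangent" and c
    by (simp_all add: plus_prod_def scaleR_prod_def)
  have \<zeta>: "\<zeta> \<in> dual_space ?g"
    unfolding dual_space_def \<zeta>_def
    by (auto simp: tangent_add[OF m] tangent_scaleR[OF m] a1 l(5)[OF in_E in_E] l(6)[OF in_E] simp del: scaleR_Pair add_Pair)
  have "\<exists>Y\<in>?g. \<forall>\<eta>\<in>dual_space ?g. \<eta> Y = 2 * \<G> x (0, \<eta>)"
    by (rule dual_representation) (simp_all add: a2 l(5)[OF in_E' in_E'] l(6)[OF in_E'] del: scaleR_Pair add_Pair)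
  then obtain Y where Y: "Y \<in> ?g" "\<And>\<eta>. \<eta> \<in> dual_space ?g \<Longrightarrow> \<eta> Y = 2 * \<G> x (0, \<eta>)" by blast
  have "gen_endomorphism G \<G> x = (Y, \<zeta>)"
  proof (rule gen_endomorphism_eqI)
    show "(Y, \<zeta>) \<in> gen_algebra G" using Y(1) \<zeta> by (simp add: gen_space_def)
    fix z assume "z \<in> gen_algebra G"
    then obtain Z \<eta> where z: "z = (Z, \<eta>)" "Z \<in> ?g" "\<eta> \<in> dual_space ?g" by (auto simp: gen_space_def)
    show "scalar_product (Y, \<zeta>) z = \<G> x z"
      unfolding z(1) s(1)[OF z(2,3)] using z(2) Y(2)[OF z(3)] by (simp add: scalar_product_def \<zeta>_def)
  qed
  moreover have "scalar_product (Y, \<zeta>) z = \<G> x z" if zE: "z \<in> gen_algebra G"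
  proof -
    obtain Z \<eta> where z: "z = (Z, \<eta>)" "Z \<in> ?g" "\<eta> \<in> dual_space ?g" using zE by (auto simp: gen_space_def)
    show ?thesis
      unfolding z(1) s(1)[OF z(2,3)] using z(2) Y(2)[OF z(3)] by (simp add: scalar_product_def \<zeta>_def)
  qed
  ultimately show "gen_endomorphism G \<G> x \<in> gen_algebra G"
    "z \<in> gen_algebra G \<Longrightarrow> scalar_product (gen_endomorphism G \<G> x) z = \<G> x z"
    using Y(1) \<zeta> by (simp_all add: gen_space_def)
qed

section \<open>Raising indices with a metric on the Lie algebra\<close>

lemma sharp_eqI:
  assumes h: "h \<in> symmetric_forms (lie_algebra G)" "nondegenerate_on (lie_algebra G) h"
    and X: "X \<in> lie_algebra G" "\<And>Y. Y \<in> lie_algebra G \<Longrightarrow> h X Y = \<xi> Y"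
  shows "sharp (lie_algebra G) h \<xi> = X"
  unfolding sharp_def
proof (rule the_equality)
  let ?g = "lie_algebra G"
  note sub = subspace_tangent_space[OF manifold_atlas]
  show "X \<in> ?g \<and> (\<forall>Y\<in>?g. h X Y = \<xi> Y)" using X by blast
  fix X' assume X': "X' \<in> ?g \<and> (\<forall>Y\<in>?g. h X' Y = \<xi> Y)"
  have b: "h \<in> bilinear_forms ?g" using h(1) by (simp add: symmetric_forms_def)
  note l = bilinear_formsD[OF b]
  have d: "X' - X \<in> ?g" using X(1) X' subspace_diff[OF sub] by blast
  have "h (X' - X) Y = 0" if Y: "Y \<in> ?g" for Y
  proof -
    have "h ((X' - X) + X) Y = h (X' - X) Y + h X Y" by (rule l(3)[OF d X(1)])
    moreover have "X' - X + X = X'" by (rule diff_add_cancel)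
    ultimately show ?thesis using X(2)[OF Y] X' Y by simp
  qed
  then have "X' - X = 0" using h(2) d unfolding nondegenerate_on_def by blast
  then show "X' = X" by (simp only: right_minus_eq)
qed

lemma sharp:
  assumes h: "h \<in> symmetric_forms (lie_algebra G)" "nondegenerate_on (lie_algebra G) h"
    and \<xi>: "\<xi> \<in> dual_space (lie_algebra G)"
  shows "sharp (lie_algebra G) h \<xi> \<in> lie_algebra G"
    and "Y \<in> lie_algebra G \<Longrightarrow> h (sharp (lie_algebra G) h \<xi>) Y = \<xi> Y"
proof -
  let ?g = "lie_algebra G"
  note sub = subspace_tangent_space[OF manifold_atlas]
  have b: "h \<in> bilinear_forms ?g" using h(1) by (simp add: symmetric_forms_def)
  note l = bilinear_formsD[OF b]
  obtain I :: "'v set" and e \<theta> where f: "finite I" "\<And>b. e b \<in> ?g"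
    "\<And>u. u \<in> ?g \<Longrightarrow> u = (\<Sum>b\<in>I. \<theta> b u *\<^sub>R e b)"
    by (rule lie_algebra_dual_frame) blast
  have "?g \<subseteq> span (e ` I)"
  proof
    fix u assume u: "u \<in> ?g"
    show "u \<in> span (e ` I)"
      by (subst f(3)[OF u]) (intro span_sum span_scale span_base imageI)
  qed
  then have "\<exists>X\<in>?g. \<forall>Y\<in>?g. h X Y = \<xi> Y"
    by (rule nondegenerate_representation[OF sub _ _ l(3) l(4) l(5) l(6) h(2)])
      (use f(1) dual_spaceD[OF \<xi>] in auto)
  then obtain X where X: "X \<in> ?g" "\<And>Y. Y \<in> ?g \<Longrightarrow> h X Y = \<xi> Y" by blast
  have eq: "sharp ?g h \<xi> = X" by (rule sharp_eqI[OF h X(1)]) (rule X(2))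
  show "sharp ?g h \<xi> \<in> ?g" unfolding eq by (rule X(1))
  show "h (sharp ?g h \<xi>) Y = \<xi> Y" if "Y \<in> ?g" unfolding eq by (rule X(2)[OF that])
qed

text \<open>\<sigma>, \<zeta> and A are blocks of the endomorphism N, and g0 is the inverse of
  \<sigma>. The mixed values of \<G> are given by A, those on the dual by \<sigma>, and those on the
  Lie algebra by the involution property; completing the square in the covectors then yields the
  formula, with shift \<open>B0\<close>.\<close>

lemma generalized_metric_decompose:
  assumes \<G>: "generalized_metric G \<G>"
  obtains g0 B0 where "g0 \<in> symmetric_forms (lie_algebra G)" "nondegenerate_on (lie_algebra G) g0"
    "B0 \<in> alternating_forms2 (lie_algebra G)"
    "\<And>X Y \<xi> \<eta>. X \<in> lie_algebra G \<Longrightarrow> Y \<in> lie_algebra G \<Longrightarrow> \<xi> \<in> dual_space (lie_algebra G) \<Longrightarrow>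
      \<eta> \<in> dual_space (lie_algebra G) \<Longrightarrow> \<G> (X, \<xi>) (Y, \<eta>) =
        (g0 X Y + inverse_metric (lie_algebra G) g0 (\<xi> + B0 X) (\<eta> + B0 Y)) / 2"
proof -
  let ?g = "lie_algebra G" and ?d = "dual_space (lie_algebra G)"
  note m = manifold_atlas and sub = subspace_tangent_space[OF manifold_atlas]
  note subd = subspace_dual_space[of ?g]
  have sym: "\<G> x y = \<G> y x" for x y
    using \<G> unfolding generalized_metric_def symmetric_forms_def by blast
  have bil: "\<G> \<in> bilinear_forms (gen_algebra G)"
    using \<G> unfolding generalized_metric_def symmetric_forms_def by blast
  have nd: "nondegenerate_on ?d (\<lambda>\<xi> \<eta>. \<G> (0, \<xi>) (0, \<eta>))"
    using \<G> by (simp add: generalized_metric_def)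
  note l = bilinear_formsD[OF bil] and split = gen_algebra_split[OF bil]
  define N where "N = gen_endomorphism G \<G>"
  have N_in: "N x \<in> gen_algebra G" for x unfolding N_def by (rule gen_endomorphism(1)[OF bil])
  \<comment> \<open>The involution property in weak form: the scalar product of N (N x) with z is
    computed in two ways.\<close>
  have NN: "\<G> (N x) z = scalar_product x z" if "x \<in> gen_algebra G" "z \<in> gen_algebra G" for x z
    using gen_endomorphism(2)[OF bil that(2), of "N x"] that(1) \<G> by (simp add: N_def generalized_metric_def)
  have zg: "0 \<in> ?g" and zd: "0 \<in> ?d" by (rule subspace_0[OF sub], rule subspace_0[OF subd])
  have z0: "\<xi> 0 = 0" if "\<xi> \<in> ?d" for \<xi> using dual_spaceD(2)[OF that zg, of 0] by simp
  have in_E: "(X, \<xi>) \<in> gen_algebra G \<longleftrightarrow> X \<in> ?g \<and> \<xi> \<in> ?d" for X \<xi> by (simp add: gen_space_def)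
  define \<sigma> where "\<sigma> = (\<lambda>\<xi>. fst (N (0, \<xi>)))"
  define \<zeta> where "\<zeta> = (\<lambda>\<xi>. snd (N (0, \<xi>)))"
  define A where "A = (\<lambda>X. fst (N (X, 0)))"
  have \<sigma>_in: "\<sigma> \<xi> \<in> ?g" and \<zeta>_in: "\<zeta> \<xi> \<in> ?d" and A_in: "A X \<in> ?g" for \<xi> X
    using N_in[of "(0, \<xi>)"] N_in[of "(X, 0)"]
    by (simp_all add: \<sigma>_def \<zeta>_def A_def gen_space_def mem_Times_iff)
  have N0: "N (0, \<xi>) = (\<sigma> \<xi>, \<zeta> \<xi>)" for \<xi> by (simp add: \<sigma>_def \<zeta>_def)
  have \<sigma>: "\<eta> (\<sigma> \<xi>) = 2 * \<G> (0, \<xi>) (0, \<eta>)" if "\<eta> \<in> ?d" for \<xi> \<eta>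
    using gen_endomorphism(2)[OF bil, of "(0, \<eta>)" "(0, \<xi>)", folded N_def] that zg z0[OF \<zeta>_in[of \<xi>]]
    by (simp add: in_E N0 scalar_product_def)
  have A: "\<eta> (A X) = 2 * \<G> (X, 0) (0, \<eta>)" if "\<eta> \<in> ?d" for X \<eta>
  proof -
    have "snd (N (X, 0)) \<in> ?d" using N_in[of "(X, 0)"] by (simp add: gen_space_def mem_Times_iff)
    from z0[OF this] show ?thesis
      using gen_endomorphism(2)[OF bil, of "(0, \<eta>)" "(X, 0)", folded N_def] that zg
      by (simp add: in_E A_def scalar_product_def)
  qed
  have \<zeta>: "\<zeta> \<xi> Y = \<xi> (A Y)" if "\<xi> \<in> ?d" "Y \<in> ?g" for \<xi> Y
    using gen_endomorphism(2)[OF bil, of "(Y, 0)" "(0, \<xi>)", folded N_def] that zd A[OF that(1), of Y] sym[of "(Y, 0)" "(0, \<xi>)"]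
    by (simp add: in_E N0 scalar_product_def)
  have \<sigma>sym: "\<eta> (\<sigma> \<xi>) = \<xi> (\<sigma> \<eta>)" if "\<xi> \<in> ?d" "\<eta> \<in> ?d" for \<xi> \<eta>
    using \<sigma>[OF that(1), of \<eta>] \<sigma>[OF that(2), of \<xi>] sym[of "(0, \<xi>)" "(0, \<eta>)"] by simp
  have E0: "(0, \<xi>) \<in> gen_algebra G" if "\<xi> \<in> ?d" for \<xi> using that zg by (simp add: in_E)
  have a2: "(0, \<xi> + \<eta>) = (0 :: 'a tangent, \<xi>) + (0, \<eta>)" "(0, c *\<^sub>R \<xi>) = c *\<^sub>R (0 :: 'a tangent, \<xi>)" for \<xi> \<eta> :: "'a cotangent" and c
    by (simp_all add: plus_prod_def scaleR_prod_def)
  \<comment> \<open>Non-degeneracy of \<G> on the dual enters here: the functional \<eta> \<mapsto>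
    \<eta> X / 2 is represented by some \<xi>, and \<open>\<sigma> \<xi>\<close> pairs with every
    covector as X does.\<close>
  have surj: "\<exists>\<xi>\<in>?d. \<sigma> \<xi> = X" if X: "X \<in> ?g" for X
  proof -
    obtain I :: "'v set" and e \<theta> where f: "finite I" "\<And>b. \<theta> b \<in> ?d"
      "\<And>\<eta>. \<eta> \<in> ?d \<Longrightarrow> \<eta> = (\<Sum>b\<in>I. \<eta> (e b) *\<^sub>R \<theta> b)"
      by (rule lie_algebra_dual_frame) blast
    have "?d \<subseteq> span (\<theta> ` I)"
    proof
      fix \<eta> assume \<eta>: "\<eta> \<in> ?d"
      show "\<eta> \<in> span (\<theta> ` I)"
        by (subst f(3)[OF \<eta>]) (intro span_sum span_scale span_base imageI)
    qed
    then have "\<exists>\<xi>\<in>?d. \<forall>\<eta>\<in>?d. \<G> (0, \<xi>) (0, \<eta>) = \<eta> X / 2"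
    proof (rule nondegenerate_representation[OF subd _ _ _ _ _ _ nd])
      show "finite (\<theta> ` I)" using f(1) by simp
      show "\<G> (0, \<xi> + \<eta>) (0, \<rho>) = \<G> (0, \<xi>) (0, \<rho>) + \<G> (0, \<eta>) (0, \<rho>)" if "\<xi> \<in> ?d" "\<eta> \<in> ?d" for \<xi> \<eta> \<rho>
        by (simp only: a2 l(3)[OF E0[OF that(1)] E0[OF that(2)]])
      show "\<G> (0, \<rho>) (0, \<xi> + \<eta>) = \<G> (0, \<rho>) (0, \<xi>) + \<G> (0, \<rho>) (0, \<eta>)" if "\<xi> \<in> ?d" "\<eta> \<in> ?d" for \<xi> \<eta> \<rho>
        by (simp only: a2 l(5)[OF E0[OF that(1)] E0[OF that(2)]])
      show "\<G> (0, c *\<^sub>R \<xi>) (0, \<rho>) = c * \<G> (0, \<xi>) (0, \<rho>)" if "\<xi> \<in> ?d" for c \<xi> \<rho>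
        by (simp only: a2 l(4)[OF E0[OF that(1)]])
      show "\<G> (0, \<rho>) (0, c *\<^sub>R \<xi>) = c * \<G> (0, \<rho>) (0, \<xi>)" if "\<xi> \<in> ?d" for c \<xi> \<rho>
        by (simp only: a2 l(6)[OF E0[OF that(1)]])
      show "(\<xi> + \<eta>) X / 2 = \<xi> X / 2 + \<eta> X / 2" for \<xi> \<eta> :: "'a cotangent" by (simp add: add_divide_distrib)
      show "(c *\<^sub>R \<xi>) X / 2 = c * (\<xi> X / 2)" for c and \<xi> :: "'a cotangent" by (simp add: scaleR_fun_def)
    qed
    then obtain \<xi> where \<xi>: "\<xi> \<in> ?d" "\<And>\<eta>. \<eta> \<in> ?d \<Longrightarrow> \<G> (0, \<xi>) (0, \<eta>) = \<eta> X / 2" by blast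
    have "\<sigma> \<xi> = X"
    proof (rule dual_separates[OF \<sigma>_in X])
      fix \<eta> assume \<eta>: "\<eta> \<in> ?d"
      show "\<eta> (\<sigma> \<xi>) = \<eta> X" using \<sigma>[OF \<eta>, of \<xi>] \<xi>(2)[OF \<eta>] by simp
    qed
    then show ?thesis using \<xi>(1) by blast
  qed
  obtain fl where fl: "\<And>X. X \<in> ?g \<Longrightarrow> fl X \<in> ?d" "\<And>X. X \<in> ?g \<Longrightarrow> \<sigma> (fl X) = X"
    using surj by metis
  define g0 where "g0 = (\<lambda>X. if X \<in> ?g then fl X else 0)"
  have g0_dual: "g0 X \<in> ?d" for X using fl(1) zd by (simp add: g0_def)
  have \<sigma>g0: "\<sigma> (g0 X) = X" if "X \<in> ?g" for X using fl(2) that by (simp add: g0_def)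
  \<comment> \<open>g0 is chosen as a right inverse of \<sigma>; by the symmetry of \<sigma> it is
    also a left inverse.\<close>
  have g0\<sigma>: "g0 (\<sigma> \<xi>) Y = \<xi> Y" if "\<xi> \<in> ?d" "Y \<in> ?g" for \<xi> Y
  proof -
    have "g0 (\<sigma> \<xi>) (\<sigma> (g0 Y)) = g0 Y (\<sigma> (g0 (\<sigma> \<xi>)))" by (rule \<sigma>sym[OF g0_dual g0_dual])
    also have "\<dots> = g0 Y (\<sigma> \<xi>)" by (simp only: \<sigma>g0[OF \<sigma>_in])
    also have "\<dots> = \<xi> (\<sigma> (g0 Y))" by (rule \<sigma>sym[OF that(1) g0_dual])
    finally show ?thesis by (simp only: \<sigma>g0[OF that(2)])
  qed
  have g0_sym: "g0 X Y = g0 Y X" for X Y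
  proof (cases "X \<in> ?g \<and> Y \<in> ?g")
    case True
    then show ?thesis using \<sigma>sym[OF g0_dual[of Y] g0_dual[of X]] \<sigma>g0 by simp
  next
    case False
    have out: "g0 U W = 0" if "U \<notin> ?g \<or> W \<notin> ?g" for U W
    proof (cases "W \<in> ?g")
      case True
      then show ?thesis using that by (simp add: g0_def)
    next
      case False
      then show ?thesis by (rule dual_spaceD(3)[OF g0_dual])
    qed
    have "g0 X Y = 0" "g0 Y X = 0" by (rule out; use False in blast)+
    then show ?thesis by simp
  qed
  have g0_bil: "g0 \<in> bilinear_forms ?g"
  proof -
    have "(\<lambda>u. g0 u v) = g0 v" for v using g0_sym by blast
    then show ?thesis by (simp only: bilinear_forms_def mem_Collect_eq g0_dual simp_thms)
  qed
  have g0_symf: "g0 \<in> symmetric_forms ?g" using g0_bil g0_sym by (simp add: symmetric_forms_def)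
  \<comment> \<open>Linearity of \<sigma> has not been established; this value follows from its
    symmetry.\<close>
  have \<sigma>0: "\<sigma> 0 = 0"
  proof (rule dual_separates[OF \<sigma>_in zg])
    fix \<eta> assume \<eta>: "\<eta> \<in> ?d"
    show "\<eta> (\<sigma> 0) = \<eta> 0" using \<sigma>sym[OF zd \<eta>] z0[OF \<eta>] by simp
  qed
  have g0_nd: "nondegenerate_on ?g g0"
    unfolding nondegenerate_on_def
  proof (intro ballI impI)
    fix X assume X: "X \<in> ?g" and z: "\<forall>Y\<in>?g. g0 X Y = 0"
    have "g0 X = 0" by (rule dual_eqI[OF g0_dual zd]) (use z in simp)
    then show "X = 0" using \<sigma>g0[OF X] \<sigma>0 by simp
  qed
  have sharp: "sharp ?g g0 \<xi> = \<sigma> \<xi>" if "\<xi> \<in> ?d" for \<xi>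
    by (rule sharp_eqI[OF g0_symf g0_nd \<sigma>_in]) (rule g0\<sigma>[OF that])
  define B0 where "B0 = (\<lambda>X. if X \<in> ?g then g0 (A X) else 0)"
  have B0_dual: "B0 X \<in> ?d" for X using g0_dual zd by (simp add: B0_def)
  \<comment> \<open>The block of N N from the dual to the Lie algebra vanishes. Weakly: covectors
    are mutually orthogonal for the scalar product, so \<G> of N (0, \<xi>) and (0, \<eta>) is
    zero.\<close>
  have A\<sigma>: "A (\<sigma> \<xi>) = \<sigma> ((-1) *\<^sub>R \<zeta> \<xi>)" if \<xi>: "\<xi> \<in> ?d" for \<xi>
  proof (rule dual_separates[OF A_in \<sigma>_in])
    fix \<eta> assume \<eta>: "\<eta> \<in> ?d"
    have mz: "(-1) *\<^sub>R \<zeta> \<xi> \<in> ?d" by (rule subspace_scale[OF subd \<zeta>_in])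
    have "\<G> (\<sigma> \<xi>, \<zeta> \<xi>) (0, \<eta>) = 0"
      using NN[OF E0[OF \<xi>] E0[OF \<eta>]] z0[OF \<xi>] z0[OF \<eta>] by (simp add: N0 scalar_product_def)
    then have "\<G> (\<sigma> \<xi>, 0) (0, \<eta>) + \<G> (0, \<zeta> \<xi>) (0, \<eta>) = 0"
      by (simp only: split(2)[OF \<sigma>_in \<zeta>_in])
    then have "\<eta> (A (\<sigma> \<xi>)) = - \<eta> (\<sigma> (\<zeta> \<xi>))" using A[OF \<eta>] \<sigma>[OF \<eta>] by simp
    also have "\<dots> = - \<zeta> \<xi> (\<sigma> \<eta>)" by (simp only: \<sigma>sym[OF \<zeta>_in \<eta>])
    also have "\<dots> = ((-1) *\<^sub>R \<zeta> \<xi>) (\<sigma> \<eta>)" by (simp add: scaleR_fun_def)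
    also have "\<dots> = \<eta> (\<sigma> ((-1) *\<^sub>R \<zeta> \<xi>))" by (rule \<sigma>sym[OF \<eta> mz])
    finally show "\<eta> (A (\<sigma> \<xi>)) = \<eta> (\<sigma> ((-1) *\<^sub>R \<zeta> \<xi>))" .
  qed
  have A_skew: "g0 (A X) Y = - g0 (A Y) X" if X: "X \<in> ?g" and Y: "Y \<in> ?g" for X Y
  proof -
    have mz: "(-1) *\<^sub>R \<zeta> (g0 X) \<in> ?d" by (rule subspace_scale[OF subd \<zeta>_in])
    have "A X = \<sigma> ((-1) *\<^sub>R \<zeta> (g0 X))" using A\<sigma>[OF g0_dual[of X]] by (simp only: \<sigma>g0[OF X])
    then have "g0 (A X) Y = ((-1) *\<^sub>R \<zeta> (g0 X)) Y" using g0\<sigma>[OF mz Y] by (simp only:)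
    also have "\<dots> = - g0 X (A Y)" using \<zeta>[OF g0_dual Y, of X] by (simp add: scaleR_fun_def)
    finally show ?thesis using g0_sym[of X "A Y"] by simp
  qed
  have B0_skew: "B0 X Y = - B0 Y X" for X Y
  proof (cases "X \<in> ?g \<and> Y \<in> ?g")
    case True
    then show ?thesis using A_skew[of X Y] by (simp add: B0_def)
  next
    case False
    have out: "B0 U W = 0" if "U \<notin> ?g \<or> W \<notin> ?g" for U W
    proof (cases "W \<in> ?g")
      case True
      then show ?thesis using that by (simp add: B0_def)
    next
      case False
      then show ?thesis by (rule dual_spaceD(3)[OF B0_dual])
    qed
    have "B0 X Y = 0" "B0 Y X = 0" by (rule out; use False in blast)+
    then show ?thesis by simp
  qed
  have B0_alt: "B0 \<in> alternating_forms2 ?g"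
  proof -
    have "(\<lambda>u. B0 u v) = (-1) *\<^sub>R B0 v" for v
      by (rule ext) (simp add: scaleR_fun_def B0_skew[of _ v])
    moreover have "(-1) *\<^sub>R B0 v \<in> ?d" for v by (rule subspace_scale[OF subd B0_dual])
    ultimately have "B0 \<in> bilinear_forms ?g"
      by (simp only: bilinear_forms_def mem_Collect_eq B0_dual simp_thms)
    moreover have "B0 u u = 0" for u using B0_skew[of u u] by simp
    ultimately show ?thesis by (simp add: alternating_forms2_def)
  qed
  have \<G>_form: "\<G> (X, \<xi>) (Y, \<eta>) = (g0 X Y + inverse_metric ?g g0 (\<xi> + B0 X) (\<eta> + B0 Y)) / 2"
    if X: "X \<in> ?g" and Y: "Y \<in> ?g" and \<xi>: "\<xi> \<in> ?d" and \<eta>: "\<eta> \<in> ?d" for X Y \<xi> \<eta>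
  proof -
    have s: "\<xi> + B0 X \<in> ?d" "\<eta> + B0 Y \<in> ?d"
      by (rule subspace_add[OF subd \<xi> B0_dual], rule subspace_add[OF subd \<eta> B0_dual])
    have B0': "B0 X = g0 (A X)" "B0 Y = g0 (A Y)" using X Y by (simp_all add: B0_def)
    have "inverse_metric ?g g0 (\<xi> + B0 X) (\<eta> + B0 Y) = g0 (\<sigma> (\<xi> + B0 X)) (\<sigma> (\<eta> + B0 Y))"
      by (simp only: inverse_metric_def sharp[OF s(1)] sharp[OF s(2)])
    also have "\<dots> = (\<xi> + B0 X) (\<sigma> (\<eta> + B0 Y))" by (rule g0\<sigma>[OF s(1) \<sigma>_in])
    also have "\<dots> = \<xi> (\<sigma> (\<eta> + B0 Y)) + g0 (A X) (\<sigma> (\<eta> + B0 Y))" by (simp add: B0')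
    also have "\<xi> (\<sigma> (\<eta> + B0 Y)) = (\<eta> + B0 Y) (\<sigma> \<xi>)" by (rule \<sigma>sym[OF s(2) \<xi>])
    also have "\<dots> = \<eta> (\<sigma> \<xi>) + \<xi> (A Y)"
      using \<sigma>sym[OF \<xi> g0_dual[of "A Y"]] \<sigma>g0[OF A_in[of Y]] by (simp add: B0')
    also have "g0 (A X) (\<sigma> (\<eta> + B0 Y)) = (\<eta> + B0 Y) (A X)"
      using g0_sym[of "A X" "\<sigma> (\<eta> + B0 Y)"] g0\<sigma>[OF s(2) A_in, of X] by simp
    also have "\<dots> = \<eta> (A X) + g0 (A X) (A Y)" using g0_sym[of "A X" "A Y"] by (simp add: B0')
    finally have inv: "inverse_metric ?g g0 (\<xi> + B0 X) (\<eta> + B0 Y) =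
      \<eta> (\<sigma> \<xi>) + \<xi> (A Y) + (\<eta> (A X) + g0 (A X) (A Y))" .
    \<comment> \<open>N (0, g0 X) has vector part X, so testing the involution property on (0, g0 X)
      and (Y, 0) expresses \<G> on the Lie algebra through g0 and A; skewness turns the term with A
      (A Y) into the square.\<close>
    have a: "2 * \<G> (X, 0) (Y, 0) = g0 X Y + g0 (A X) (A Y)"
    proof -
      have YE: "(Y, 0) \<in> gen_algebra G" using Y zd by (simp add: in_E)
      have "\<G> (\<sigma> (g0 X), \<zeta> (g0 X)) (Y, 0) = g0 X Y / 2"
        using NN[OF E0[OF g0_dual[of X]] YE] by (simp add: N0 scalar_product_def)
      then have "\<G> (X, 0) (Y, 0) + \<G> (0, \<zeta> (g0 X)) (Y, 0) = g0 X Y / 2"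
        by (simp only: \<sigma>g0[OF X] split(2)[OF X \<zeta>_in])
      moreover have "2 * \<G> (0, \<zeta> (g0 X)) (Y, 0) = g0 X (A (A Y))"
        using A[OF \<zeta>_in, of "g0 X" Y] \<zeta>[OF g0_dual A_in, of X Y] sym[of "(Y, 0)" "(0, \<zeta> (g0 X))"] by simp
      moreover have "g0 X (A (A Y)) = - g0 (A X) (A Y)"
        using g0_sym[of X "A (A Y)"] A_skew[OF A_in[of Y] X] by simp
      ultimately show ?thesis by simp
    qed
    have "2 * \<G> (X, \<xi>) (Y, \<eta>) = 2 * \<G> (X, 0) (Y, 0) + 2 * \<G> (X, 0) (0, \<eta>) + 2 * \<G> (0, \<xi>) (Y, 0) + 2 * \<G> (0, \<xi>) (0, \<eta>)"
      by (simp only: split(1)[OF Y \<eta>] split(2)[OF X \<xi>] distrib_left add.assoc)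
    then show ?thesis
      unfolding inv
      using a A[OF \<eta>, of X] A[OF \<xi>, of Y] sym[of "(0, \<xi>)" "(Y, 0)"] \<sigma>[OF \<eta>, of \<xi>]
      by (simp add: field_simps)
  qed
  show ?thesis by (rule that[OF g0_symf g0_nd B0_alt \<G>_form])
qed

text \<open>The endomorphism exchanges vectors and covectors by (X, \<xi>) \<mapsto> (g^{-1} \<xi>,
  g X), which is visibly an involution.\<close>

lemma generalized_metric_gen_metric_of:
  assumes h: "g \<one> \<in> symmetric_forms (lie_algebra G)" "nondegenerate_on (lie_algebra G) (g \<one>)"
  shows "generalized_metric G (gen_metric_of G g)"
proof -
  let ?g = "lie_algebra G" and ?d = "dual_space (lie_algebra G)" and ?E = "gen_algebra G"
  let ?G = "gen_metric_of G g" and ?h = "g \<one>" and ?s = "sharp (lie_algebra G) (g \<one>)"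
  note sub = subspace_tangent_space[OF manifold_atlas] and subd = subspace_dual_space[of ?g]
  have b: "?h \<in> bilinear_forms ?g" and sym: "?h X Y = ?h Y X" for X Y
    using h(1) unfolding symmetric_forms_def by blast+
  note l = bilinear_formsD[OF b] and s = sharp[OF h]
  have zg: "0 \<in> ?g" and zd: "0 \<in> ?d" by (rule subspace_0[OF sub], rule subspace_0[OF subd])
  have z0: "?h 0 Y = 0" for Y using l(4)[OF zg, of 0 Y] by simp
  have sh: "?s (?h X) = X" if "X \<in> ?g" for X by (rule sharp_eqI[OF h that]) (rule refl)
  have hs: "?h (?s \<xi>) = \<xi>" if "\<xi> \<in> ?d" for \<xi> by (rule dual_eqI[OF l(1) that]) (rule s(2)[OF that])
  have val: "?G (X, \<xi>) (Y, \<eta>) = (?h X Y + \<xi> (?s \<eta>)) / 2"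
    if "X \<in> ?g" "\<xi> \<in> ?d" "Y \<in> ?g" "\<eta> \<in> ?d" for X \<xi> Y \<eta>
    using that s(2)[OF that(2) s(1)[OF that(4)]] by (simp add: gen_metric_of_def inverse_metric_def gen_space_def)
  have Gsym: "?G x y = ?G y x" for x y
    by (auto simp: gen_metric_of_def inverse_metric_def sym)
  have dual: "(\<lambda>x. ?G x y) \<in> dual_space ?E" for y
  proof (cases "y \<in> ?E")
    case False
    then show ?thesis by (simp add: gen_metric_of_def zero_dual_space)
  next
    case True
    then obtain Y \<eta> where y: "y = (Y, \<eta>)" "Y \<in> ?g" "\<eta> \<in> ?d" by (auto simp: gen_space_def)
    show ?thesis
      unfolding dual_space_def
    proof (intro CollectI conjI ballI allI impI)
      fix x x' assume xE: "x \<in> ?E" and xE': "x' \<in> ?E"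
      obtain X \<xi> where x: "x = (X, \<xi>)" "X \<in> ?g" "\<xi> \<in> ?d" using xE by (auto simp: gen_space_def)
      obtain X' \<xi>' where x': "x' = (X', \<xi>')" "X' \<in> ?g" "\<xi>' \<in> ?d" using xE' by (auto simp: gen_space_def)
      have "?G (X + X', \<xi> + \<xi>') (Y, \<eta>) = (?h (X + X') Y + (\<xi> + \<xi>') (?s \<eta>)) / 2"
        by (rule val[OF subspace_add[OF sub x(2) x'(2)] subspace_add[OF subd x(3) x'(3)] y(2,3)])
      also have "\<dots> = (?h X Y + \<xi> (?s \<eta>)) / 2 + (?h X' Y + \<xi>' (?s \<eta>)) / 2"
        unfolding l(3)[OF x(2) x'(2)] plus_fun_apply by (simp add: field_simps)
      finally show "?G (x + x') y = ?G x y + ?G x' y"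
        by (simp only: x(1) x'(1) y(1) add_Pair val[OF x(2,3) y(2,3)] val[OF x'(2,3) y(2,3)])
    next
      fix c x assume xE: "x \<in> ?E"
      obtain X \<xi> where x: "x = (X, \<xi>)" "X \<in> ?g" "\<xi> \<in> ?d" using xE by (auto simp: gen_space_def)
      have "?G (c *\<^sub>R X, c *\<^sub>R \<xi>) (Y, \<eta>) = (?h (c *\<^sub>R X) Y + (c *\<^sub>R \<xi>) (?s \<eta>)) / 2"
        by (rule val[OF subspace_scale[OF sub x(2)] subspace_scale[OF subd x(3)] y(2,3)])
      also have "\<dots> = c * ((?h X Y + \<xi> (?s \<eta>)) / 2)"
        unfolding l(4)[OF x(2)] by (simp add: scaleR_fun_def field_simps)
      finally show "?G (c *\<^sub>R x) y = c * ?G x y"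
        by (simp only: x(1) y(1) scaleR_Pair val[OF x(2,3) y(2,3)])
    next
      show "?G x y = 0" if "x \<notin> ?E" for x using that by (simp add: gen_metric_of_def)
    qed
  qed
  have "?G x \<in> dual_space ?E" for x
  proof -
    have "?G x = (\<lambda>y. ?G y x)" using Gsym by blast
    then show ?thesis using dual by (simp only:)
  qed
  then have "?G \<in> symmetric_forms ?E"
    unfolding symmetric_forms_def bilinear_forms_def using dual Gsym by blast
  moreover have endo: "gen_endomorphism G ?G (X, \<xi>) = (?s \<xi>, ?h X)" if X: "X \<in> ?g" and \<xi>: "\<xi> \<in> ?d" for X \<xi>
  proof (rule gen_endomorphism_eqI)
    show "(?s \<xi>, ?h X) \<in> ?E" using s(1)[OF \<xi>] l(1) by (simp add: gen_space_def)
    fix z assume "z \<in> ?E"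
    then obtain Y \<eta> where z: "z = (Y, \<eta>)" "Y \<in> ?g" "\<eta> \<in> ?d" by (auto simp: gen_space_def)
    have "\<eta> (?s \<xi>) = \<xi> (?s \<eta>)"
      using s(2)[OF z(3) s(1)[OF \<xi>]] s(2)[OF \<xi> s(1)[OF z(3)]] sym[of "?s \<xi>" "?s \<eta>"] by simp
    then show "scalar_product (?s \<xi>, ?h X) z = ?G (X, \<xi>) z"
      unfolding z(1) val[OF X \<xi> z(2,3)] by (simp add: scalar_product_def)
  qed
  moreover have "gen_endomorphism G ?G (gen_endomorphism G ?G x) = x" if xE: "x \<in> ?E" for x
  proof -
    obtain X \<xi> where x: "x = (X, \<xi>)" "X \<in> ?g" "\<xi> \<in> ?d" using xE by (auto simp: gen_space_def)
    show ?thesis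
      unfolding x(1) endo[OF x(2,3)] endo[OF s(1)[OF x(3)] l(1)] sh[OF x(2)] hs[OF x(3)] ..
  qed
  moreover have "nondegenerate_on ?d (\<lambda>\<xi> \<eta>. ?G (0, \<xi>) (0, \<eta>))"
    unfolding nondegenerate_on_def
  proof (intro ballI impI)
    fix \<xi> assume \<xi>: "\<xi> \<in> ?d" and z: "\<forall>\<eta>\<in>?d. ?G (0, \<xi>) (0, \<eta>) = 0"
    show "\<xi> = 0"
    proof (rule dual_eqI[OF \<xi> zd])
      fix X assume X: "X \<in> ?g"
      have "?G (0, \<xi>) (0, ?h X) = 0" using z l(1) by blast
      then show "\<xi> X = 0 X" unfolding val[OF zg \<xi> zg l(1)] sh[OF X] by (simp add: z0)
    qed
  qed
  ultimately show ?thesis unfolding generalized_metric_def by blast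
qed

lemma left_invariant_metric_left_tensor2:
  assumes h: "h \<in> symmetric_forms (lie_algebra G)" "nondegenerate_on (lie_algebra G) h"
  shows "left_invariant_metric G (left_tensor2 G h)"
proof -
  let ?A = "atlas G"
  note m = manifold_atlas
  have b: "h \<in> bilinear_forms (lie_algebra G)" and sym: "h X Y = h Y X" for X Y
    using h(1) unfolding symmetric_forms_def by blast+
  have "left_tensor2 G h p \<in> symmetric_forms (tangent_space ?A p)" for p
    using left_tensor2_bilinear[OF b] sym by (simp add: symmetric_forms_def left_tensor2_def)
  moreover have "nondegenerate_on (tangent_space ?A p) (left_tensor2 G h p)" for p
    unfolding nondegenerate_on_def
  proof (intro ballI impI)
    fix u assume u: "u \<in> tangent_space ?A p" and z: "\<forall>v\<in>tangent_space ?A p. left_tensor2 G h p u v = 0"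
    have "h (to_lie_algebra G p u) Y = 0" if Y: "Y \<in> lie_algebra G" for Y
      using z[rule_format, OF vector_field_tangent[OF vector_field_left_field[OF Y]]] u
      by (simp add: left_tensor2_def to_lie_algebra_left_field[OF Y] vector_field_tangent[OF vector_field_left_field[OF Y]])
    then have "to_lie_algebra G p u = 0"
      using h(2) to_lie_algebra_in[OF u] unfolding nondegenerate_on_def by blast
    then have "u = left_translate G p \<one> 0"
      using left_translate_to_lie_algebra[OF u] by (simp only:)
    then show "u = 0" using left_translate_scaleR[of p \<one> 0 0] by (simp only: scaleR_zero_left)
  qed
  moreover have "smooth_fun_on ?A UNIV (\<lambda>p. left_tensor2 G h p (X p) (Y p))"
    if X: "vector_field ?A X" and Y: "vector_field ?A Y" for X Y
    using smooth_left_tensor2[OF b X Y]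
    by (simp add: smooth_fun_on_iff[OF m] left_tensor2_def vector_field_tangent[OF X] vector_field_tangent[OF Y])
  ultimately show ?thesis
    unfolding left_invariant_metric_def using left_tensor2_left_translate by blast
qed

section \<open>Transport of generalized vectors to the identity\<close>

lemma to_identity_in:
  assumes "x \<in> gen_space (atlas G) p"
  shows "to_identity G p x \<in> gen_algebra G"
proof -
  have x: "fst x \<in> tangent_space (atlas G) p" "snd x \<in> cotangent_space (atlas G) p"
    using assms by (auto simp: gen_space_def)
  note t = left_translate_in[of _ \<one> p, simplified]
  have "(\<lambda>w. if w \<in> lie_algebra G then snd x (left_translate G p \<one> w) else 0) \<in> dual_space (lie_algebra G)"
    unfolding dual_space_def
    by (simp add: tangent_add[OF manifold_atlas] tangent_scaleR[OF manifold_atlas] left_translate_add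
        left_translate_scaleR dual_spaceD(1)[OF x(2) t t] dual_spaceD(2)[OF x(2) t])
  then show ?thesis
    using to_lie_algebra_in[OF x(1)] by (simp add: to_identity_def gen_space_def to_lie_algebra_def)
qed

text \<open>For an invariant two-form the shear commutes with left translation, so an identity
  between forms on the generalized Lie algebra gives the identity between the invariant fields at
  every point.\<close>

lemma to_identity_shear:
  assumes x: "x \<in> gen_space (atlas G) p" and \<beta>: "\<beta> \<in> bilinear_forms (lie_algebra G)"
  shows "to_identity G p (shear (left_tensor2 G \<beta>) p x) =
    (fst (to_identity G p x), snd (to_identity G p x) + \<beta> (fst (to_identity G p x)))"
proof (rule prod_eqI)
  show "fst (to_identity G p (shear (left_tensor2 G \<beta>) p x)) =
      fst (fst (to_identity G p x), snd (to_identity G p x) + \<beta> (fst (to_identity G p x)))"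
    by (simp add: to_identity_def shear_def)
  have xT: "fst x \<in> tangent_space (atlas G) p" using x by (auto simp: gen_space_def)
  have "left_tensor2 G \<beta> p (fst x) (left_translate G p \<one> w) = \<beta> (to_lie_algebra G p (fst x)) w"
    if w: "w \<in> lie_algebra G" for w
    using vector_field_tangent[OF vector_field_left_field[OF w], of p] to_lie_algebra_left_field[OF w, of p] xT
    by (simp add: left_tensor2_def left_field_def)
  then show "snd (to_identity G p (shear (left_tensor2 G \<beta>) p x)) =
      snd (fst (to_identity G p x), snd (to_identity G p x) + \<beta> (fst (to_identity G p x)))"
    using bilinear_formsD(8)[OF \<beta>]
    by (auto simp: to_identity_def shear_def fun_eq_iff simp flip: to_lie_algebra_def)
qed

end

theorem proposition2p4:
  fixes G :: "('a::{t2_space, second_countable_topology}, 'v::real_inner) lie_group_data"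
    and H :: "'a \<Rightarrow> 'a tangent \<Rightarrow> 'a tangent \<Rightarrow> 'a tangent \<Rightarrow> real"
    and \<G> :: "'a gen_tangent \<Rightarrow> 'a gen_tangent \<Rightarrow> real"
  assumes "generalized_lie_group G H \<G>"
  shows "\<exists>g H' \<Phi>. left_invariant_metric G g \<and>
           left_invariant_closed_three_form G H' \<and>
           H' \<one>\<^bsub>G\<^esub> \<in> cohomology_class3 (lie_algebra G) (lie_algebra_bracket G) (H \<one>\<^bsub>G\<^esub>) \<and>
           generalized_lie_group_iso G H \<G> G H' (gen_metric_of G g) id \<Phi>"
proof -
  interpret lie_group G using assms by (simp add: generalized_lie_group_def)
  let ?A = "atlas G"
  note m = manifold_atlas
  have H: "left_invariant_closed_three_form G H" and \<G>: "generalized_metric G \<G>"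
    using assms by (simp_all add: generalized_lie_group_def)
  obtain g0 B0 where g0: "g0 \<in> symmetric_forms (lie_algebra G)" "nondegenerate_on (lie_algebra G) g0"
    and B0: "B0 \<in> alternating_forms2 (lie_algebra G)"
    and \<G>_form: "\<And>X Y \<xi> \<eta>. X \<in> lie_algebra G \<Longrightarrow> Y \<in> lie_algebra G \<Longrightarrow> \<xi> \<in> dual_space (lie_algebra G) \<Longrightarrow>
      \<eta> \<in> dual_space (lie_algebra G) \<Longrightarrow> \<G> (X, \<xi>) (Y, \<eta>) =
        (g0 X Y + inverse_metric (lie_algebra G) g0 (\<xi> + B0 X) (\<eta> + B0 Y)) / 2"
    using generalized_metric_decompose[OF \<G>] by blast
  have B0b: "B0 \<in> bilinear_forms (lie_algebra G)" using B0 by (simp add: alternating_forms2_def)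
  have g0b: "g0 \<in> bilinear_forms (lie_algebra G)" using g0(1) by (simp add: symmetric_forms_def)
  define g where "g = left_tensor2 G g0"
  define b where "b = left_tensor2 G B0"
  \<comment> \<open>The subtracted form is db, by \<open>ext_d2_left_tensor2\<close>; the sign is
    the one required in \<open>dorfman_shear\<close>.\<close>
  define H' where "H' = (\<lambda>p u v w. H p u v w - left_tensor3 G (bracket_d2 B0) p u v w)"
  have g1: "g \<one>\<^bsub>G\<^esub> = g0" unfolding g_def by (rule left_tensor2_one[OF g0b])
  have b: "two_form ?A b" unfolding b_def by (rule two_form_left_tensor2[OF B0])
  have g: "left_invariant_metric G g" unfolding g_def by (rule left_invariant_metric_left_tensor2[OF g0])
  have H': "left_invariant_closed_three_form G H'"
    unfolding H'_def by (rule left_invariant_closed_three_form_diff_exact[OF H B0])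
  have coh: "H' \<one>\<^bsub>G\<^esub> \<in> cohomology_class3 (lie_algebra G) (lie_algebra_bracket G) (H \<one>\<^bsub>G\<^esub>)"
    unfolding H'_def by (rule diff_exact_cohomologous[OF H B0])
  have \<G>': "generalized_metric G (gen_metric_of G g)"
    by (rule generalized_metric_gen_metric_of) (simp_all only: g1 g0)
  have three: "three_form ?A H" "three_form ?A H'"
    using H H' by (simp_all add: left_invariant_closed_three_form_def closed_three_form_def)
  have "generalized_lie_group_iso G H \<G> G H' (gen_metric_of G g) id (shear b)"
    unfolding generalized_lie_group_iso_def
  proof (intro conjI allI ballI impI)
    show "generalized_lie_group G H \<G>" by (rule assms)
    show "generalized_lie_group G H' (gen_metric_of G g)"
      unfolding generalized_lie_group_def using lie_group_axioms H' \<G>' by blast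
    show "id \<in> iso G G" by (simp add: iso_def hom_def)
    show "gen_bundle_iso ?A ?A id (shear b)" by (rule gen_bundle_iso_shear[OF m b])
    show "fst (shear b p x) = tangent_map ?A id p (fst x)" if "x \<in> gen_space ?A p" for p x
      using that tangent_map_id[of "fst x" ?A p] by (auto simp: shear_def gen_space_def id_def)
    show "scalar_product (shear b p x) (shear b p y) = scalar_product x y" for p x y
      using two_formD(2)[OF m b, of p "fst x" "fst y"] by (simp add: scalar_product_def shear_def)
    show "push_section id (shear b) (dorfman ?A H e e') =
        dorfman ?A H' (push_section id (shear b) e) (push_section id (shear b) e')"
      if "gen_section ?A e \<and> gen_section ?A e'" for e e'
      by (rule dorfman_shear[OF three b])
        (use that in \<open>simp_all add: H'_def b_def ext_d2_left_tensor2[OF B0]\<close>)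
    show "left_invariant_field G (gen_metric_of G g) (id p) (shear b p x) (shear b p y) =
        left_invariant_field G \<G> p x y"
      if x: "x \<in> gen_space ?A p" and y: "y \<in> gen_space ?A p" for p x y
    proof -
      obtain X \<xi> where X: "to_identity G p x = (X, \<xi>)" "X \<in> lie_algebra G" "\<xi> \<in> dual_space (lie_algebra G)"
        using to_identity_in[OF x] by (auto simp: gen_space_def)
      obtain Y \<eta> where Y: "to_identity G p y = (Y, \<eta>)" "Y \<in> lie_algebra G" "\<eta> \<in> dual_space (lie_algebra G)"
        using to_identity_in[OF y] by (auto simp: gen_space_def)
      have s: "\<xi> + B0 X \<in> dual_space (lie_algebra G)" "\<eta> + B0 Y \<in> dual_space (lie_algebra G)"
        by (intro subspace_add[OF subspace_dual_space] X(3) Y(3) bilinear_formsD(1)[OF B0b])+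
      have E: "(X, \<xi> + B0 X) \<in> gen_algebra G" "(Y, \<eta> + B0 Y) \<in> gen_algebra G"
        unfolding gen_space_def by (intro SigmaI X(2) Y(2) s)+
      \<comment> \<open>After transport to the identity, the formula for \<G> is literally the value
        of \<open>gen_metric_of\<close> at the sheared pairs.\<close>
      show ?thesis
        unfolding left_invariant_field_def id_apply b_def to_identity_shear[OF x B0b] to_identity_shear[OF y B0b]
          X(1) Y(1) fst_conv snd_conv \<G>_form[OF X(2) Y(2) X(3) Y(3)]
        using E by (simp only: gen_metric_of_def if_True simp_thms fst_conv snd_conv g1)
    qed
  qed
  then show ?thesis using g H' coh by blast
qed

end
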